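(* Let $s>0$, $b>\max(\tfrac14,\tfrac12-\tfrac14 s)$ and $b_1>\tfrac12$. Then there is a constant $C>0$, independent of $\tau\in(0,1]$, such that for every $\tau\in(0,1]$, every permutation $\sigma$ of $\{1,2,3\}$ and all sequences of functions $(u_n)_{n\in\mathbb{Z}}$, $(u_{n,i})_{n\in\mathbb{Z}}$, $i=1,2,3$, on $\mathbb{T}^2$ belonging to the spaces appearing on the respective right-hand sides, $$\Vert\Pi_\tau u_n\Vert_{l^4_\tau L^4}\le C\,\Vert u_n\Vert_{X_\tau^{s,b_1}},$$ $$\Vert\Pi_\tau(\Pi_\tau u_{n,1}\,\overline{\Pi_\tau u_{n,2}}\,\Pi_\tau u_{n,3})\Vert_{X_\tau^{s,-b}}\le C\,\Vert u_{n,1}\Vert_{X_\tau^{s,b}}\Vert u_{n,2}\Vert_{X_\tau^{s,b}}\Vert u_{n,3}\Vert_{X_\tau^{s,b}},$$ $$\Vert\Pi_\tau(\Pi_\tau u_{n,1}\,\overline{\Pi_\tau u_{n,2}}\,\Pi_\tau u_{n,3})\Vert_{X_\tau^{0,-b}}\le C\,\Vert u_{n,\sigma(1)}\Vert_{X_\tau^{s,b}}\Vert u_{n,\sigma(2)}\Vert_{X_\tau^{s,b}}\Vert u_{n,\sigma(3)}\Vert_{X_\tau^{0,b}}.$$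
   Context: $\mathbb{T}^2=(\mathbb{R}/2\pi\mathbb{Z})^2$ and $\langle\cdot\rangle=(1+|\cdot|^2)^{1/2}$. For $\tau>0$, $\Pi_\tau$ is the Fourier multiplier on $\mathbb{T}^2$ with symbol $k\mapsto\chi(\tau^{1/2}k)$, $k\in\mathbb{Z}^2$, where $\chi$ is the characteristic function of $[-1,1]^2$. For a sequence $(u_n)_{n\in\mathbb{Z}}$ of functions on $\mathbb{T}^2$: $\Vert u_n\Vert_{l^p_\tau L^p}=\left(\tau\sum_n\Vert u_n\Vert_{L^p(\mathbb{T}^2)}^p\right)^{1/p}$; $\widehat{u_m}(k)=\frac1{4\pi^2}\int_{\mathbb{T}^2}u_m(x)e^{-i\langle k,x\rangle}dx$; $\widetilde{u_n}(\sigma,k)=\tau\sum_{m\in\mathbb{Z}}\widehat{u_m}(k)e^{im\tau\sigma}$, a $2\pi/\tau$-periodic function of $\sigma$. With $d_\tau(\sigma)=\frac{e^{i\tau\sigma}-1}{\tau}$, the discrete Bourgain norm is $$\Vert u_n\Vert_{X^{s,b}_\tau}=\Vert\langle k\rangle^s\langle d_\tau(\sigma-|k|^2)\rangle^b\widetilde{u_n}(\sigma,k)\Vert_{L^2_\sigma(-\pi/\tau,\pi/\tau)\,l^2_k(\mathbb{Z}^2)} .$$ *)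

theory Defs
  imports "HOL-Analysis.Analysis" "HOL-Combinatorics.Permutations"
begin

text \<open>Functions on the torus are represented by functions on the plane that are
  2 pi-periodic in each variable; integrals are taken over a fundamental square.\<close>

type_synonym plane_fun = "real \<times> real \<Rightarrow> complex"

definition torus_cell :: "(real \<times> real) set" where
  "torus_cell = cbox (- pi, - pi) (pi, pi)"

definition torus_periodic :: "plane_fun \<Rightarrow> bool" where
  "torus_periodic f \<longleftrightarrow>
     (\<forall>x y. f (x + 2 * pi, y) = f (x, y)) \<and> (\<forall>x y. f (x, y + 2 * pi) = f (x, y))"

definition freq :: "int \<times> int \<Rightarrow> real \<times> real" where
  "freq k = (of_int (fst k), of_int (snd k))"

definition jap :: "'a::real_normed_vector \<Rightarrow> real" where
  "jap x = sqrt (1 + (norm x)\<^sup>2)"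

definition torus_fourier :: "plane_fun \<Rightarrow> int \<times> int \<Rightarrow> complex" where
  "torus_fourier f k =
     (1 / (4 * pi\<^sup>2)) *\<^sub>R (LINT x:torus_cell|lborel. f x * cis (- (freq k \<bullet> x)))"

text \<open>For positive tau the symbol has finite support, so the sum over k below is finite.\<close>

definition Proj :: "real \<Rightarrow> plane_fun \<Rightarrow> plane_fun" where
  "Proj \<tau> f x =
     (\<Sum>\<^sub>\<infinity>k\<in>UNIV. of_real (indicat_real (cbox (-1, -1) (1, 1)) (sqrt \<tau> *\<^sub>R freq k))
        * torus_fourier f k * cis (freq k \<bullet> x))"

definition torus_Lp :: "real \<Rightarrow> plane_fun \<Rightarrow> bool" where
  "torus_Lp p f \<longleftrightarrow> torus_periodic f \<and> set_borel_measurable lborel torus_cell f \<and>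
     set_integrable lborel torus_cell (\<lambda>x. cmod (f x) powr p)"

definition torus_Lp_norm :: "real \<Rightarrow> plane_fun \<Rightarrow> real" where
  "torus_Lp_norm p f = (LINT x:torus_cell|lborel. cmod (f x) powr p) powr (1 / p)"

definition in_lpLp :: "real \<Rightarrow> (int \<Rightarrow> plane_fun) \<Rightarrow> bool" where
  "in_lpLp p u \<longleftrightarrow> (\<forall>n. torus_Lp p (u n)) \<and> (\<lambda>n. torus_Lp_norm p (u n) powr p) summable_on UNIV"

definition lpLp_norm :: "real \<Rightarrow> real \<Rightarrow> (int \<Rightarrow> plane_fun) \<Rightarrow> real" where
  "lpLp_norm \<tau> p u = (\<tau> * (\<Sum>\<^sub>\<infinity>n\<in>UNIV. torus_Lp_norm p (u n) powr p)) powr (1 / p)"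

definition time_cell :: "real \<Rightarrow> real set" where
  "time_cell \<tau> = {- pi / \<tau> <..< pi / \<tau>}"

text \<open>For square summable coefficients the Fourier series in the time variable need not converge
  absolutely; as usual, its sum is the limit in L2 of one period (along finite sets of indices).
  It is unique up to a null set, which affects none of the integrals below.\<close>

definition has_time_fourier :: "real \<Rightarrow> (int \<Rightarrow> plane_fun) \<Rightarrow> int \<times> int \<Rightarrow> (real \<Rightarrow> complex) \<Rightarrow> bool" where
  "has_time_fourier \<tau> u k g \<longleftrightarrow>
     (\<forall>\<sigma>. g (\<sigma> + 2 * pi / \<tau>) = g \<sigma>) \<and>
     set_borel_measurable lborel (time_cell \<tau>) g \<and>
     set_integrable lborel (time_cell \<tau>) (\<lambda>\<sigma>. (cmod (g \<sigma>))\<^sup>2) \<and>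
     ((\<lambda>M. LINT \<sigma>:time_cell \<tau>|lborel.
         (cmod (g \<sigma> - of_real \<tau> * (\<Sum>m\<in>M. torus_fourier (u m) k * cis (of_int m * \<tau> * \<sigma>))))\<^sup>2)
       \<longlongrightarrow> 0) (finite_subsets_at_top UNIV)"

definition time_fourier :: "real \<Rightarrow> (int \<Rightarrow> plane_fun) \<Rightarrow> real \<Rightarrow> int \<times> int \<Rightarrow> complex" where
  "time_fourier \<tau> u \<sigma> k = (SOME g. has_time_fourier \<tau> u k g) \<sigma>"

definition d_tau :: "real \<Rightarrow> real \<Rightarrow> complex" where
  "d_tau \<tau> \<sigma> = (cis (\<tau> * \<sigma>) - 1) / of_real \<tau>"

definition bourgain_density ::
    "real \<Rightarrow> real \<Rightarrow> real \<Rightarrow> (int \<Rightarrow> plane_fun) \<Rightarrow> int \<times> int \<Rightarrow> real \<Rightarrow> real" where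
  "bourgain_density \<tau> s b u k \<sigma> =
     (cmod (of_real (jap (freq k) powr s * jap (d_tau \<tau> (\<sigma> - (norm (freq k))\<^sup>2)) powr b)
        * time_fourier \<tau> u \<sigma> k))\<^sup>2"

text \<open>For nonnegative s (the only case used) every element of the space is a sequence of square
  integrable functions, so asking for integrable functions, for which the Fourier coefficients are
  defined, loses nothing.\<close>

definition in_bourgain :: "real \<Rightarrow> real \<Rightarrow> real \<Rightarrow> (int \<Rightarrow> plane_fun) \<Rightarrow> bool" where
  "in_bourgain \<tau> s b u \<longleftrightarrow>
     (\<forall>n. torus_periodic (u n) \<and> set_integrable lborel torus_cell (u n)) \<and>
     (\<forall>k. \<exists>g. has_time_fourier \<tau> u k g) \<and>
     (\<forall>k. set_integrable lborel (time_cell \<tau>) (bourgain_density \<tau> s b u k)) \<and>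
     (\<lambda>k. LINT \<sigma>:time_cell \<tau>|lborel. bourgain_density \<tau> s b u k \<sigma>) summable_on UNIV"

definition bourgain_norm :: "real \<Rightarrow> real \<Rightarrow> real \<Rightarrow> (int \<Rightarrow> plane_fun) \<Rightarrow> real" where
  "bourgain_norm \<tau> s b u =
     sqrt (\<Sum>\<^sub>\<infinity>k\<in>UNIV. LINT \<sigma>:time_cell \<tau>|lborel. bourgain_density \<tau> s b u k \<sigma>)"

definition cubic :: "real \<Rightarrow> (nat \<Rightarrow> int \<Rightarrow> plane_fun) \<Rightarrow> int \<Rightarrow> plane_fun" where
  "cubic \<tau> v n =
     Proj \<tau> (\<lambda>x. Proj \<tau> (v 1 n) x * cnj (Proj \<tau> (v 2 n) x) * Proj \<tau> (v 3 n) x)"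

end

theory Submission
  imports Defs
begin

text \<open>On the Fourier side, with frequencies \<open>(k, \<sigma>)\<close> in the group of integer vectors times one period in \<open>\<sigma>\<close>,
  everything reduces to nonnegative functions supported in \<open>\<bar>k\<bar> \<le> \<tau> powr (- 1 / 2)\<close>, and one may assume \<open>b < 1 / 2\<close>.
  The core is the bilinear estimate: the \<open>L2\<close> norm of the convolution of \<open>F\<close> and \<open>G\<close> is bounded by the
  \<open>X (0, b)\<close> norm of \<open>F\<close> times the \<open>X (s, b)\<close> norm of \<open>G\<close>. By the Cauchy-Schwarz inequality it follows from a
  uniform bound for a sum over \<open>h\<close> of \<open>jap h powr (- 2 * s) * jap (d_tau (\<sigma> - \<bar>h\<bar>\<^sup>2 - \<bar>k - h\<bar>\<^sup>2)) powr (- g)\<close> with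
  \<open>g < 4 * b - 1\<close> and \<open>g + s > 1\<close>. The equation \<open>\<bar>h\<bar>\<^sup>2 + \<bar>k - h\<bar>\<^sup>2 = m\<close> describes a circle, and the number of its lattice
  points with \<open>\<bar>h\<bar> \<le> M\<close> is at most a constant times any small power of \<open>M\<close>, uniformly in \<open>k\<close> and \<open>m\<close>: if the radius
  is large compared with a power of \<open>M\<close>, such a short arc contains at most two lattice points, and
  otherwise the divisor bound applies. The \<open>L4\<close> bound is the bilinear estimate for the square of a function;
  the cubic bounds follow by duality, writing the quadrilinear form as a pairing of two convolutions.\<close>

subsection \<open>Lattice points on circles\<close>

text \<open>Uniformity in \<tau> shapes the argument. A circle inside the band may carry a number of
  lattice points that grows as \<tau> tends to 0, so the divisor bound for whole circles would lose
  a small power of \<tau>. The weight \<open>jap h powr (- 2 * s)\<close> makes it enough to count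
  the points within distance \<open>M\<close> of the origin, with a bound in \<open>M\<close> alone.
  The thresholds on \<open>b\<close> have two sources. The time integral of two modulation weights
  of exponent \<open>- 2 * b\<close> leaves decay of any positive order \<open>g < 4 * b - 1\<close>
  in the distance of their peaks. The sum over \<open>h\<close> then converges uniformly if
  \<open>g + s > 1\<close>. Such a \<open>g\<close> exists exactly when \<open>b > 1 / 4\<close> and
  \<open>b > 1 / 2 - s / 4\<close>. In the quadrilinear form the dual function carries no spatial
  weight, and in the last estimate neither does one of the three arguments. These two have to be
  placed in different convolutions, which is why the bilinear estimate must do with a spatial weight
  on one factor only.\<close>

lemma card_divisors_mult_le:
  fixes a b :: nat
  assumes "a > 0" "b > 0"
  shows "card {d. d dvd a * b} \<le> card {d. d dvd a} * card {d. d dvd b}"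
proof -
  have "{d. d dvd a * b} \<subseteq> (\<lambda>(x, y). x * y) ` ({d. d dvd a} \<times> {d. d dvd b})"
    by (auto dest!: division_decomp simp: image_iff)
  then have "card {d. d dvd a * b} \<le> card ({d. d dvd a} \<times> {d. d dvd b})"
    using assms by (intro surj_card_le) auto
  then show ?thesis by (simp add: card_cartesian_product)
qed

lemma card_divisors_prime_power_le:
  fixes p :: nat
  assumes "prime p"
  shows "card {d. d dvd p ^ e} \<le> e + 1"
proof -
  have "{d. d dvd p ^ e} \<subseteq> (\<lambda>i. p ^ i) ` {..e}"
    using assms by (auto simp: divides_primepow_nat)
  then have "card {d. d dvd p ^ e} \<le> card {..e}" by (intro surj_card_le) auto
  then show ?thesis by simp
qed

text \<open>The number of divisors is a product of factors \<open>e + 1\<close> over the prime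
  powers in \<open>n\<close>, compared one by one with \<open>p powr (\<epsilon> * e)\<close>. A
  prime from \<open>P\<close> on costs nothing because \<open>e + 1 \<le> 2 ^ e\<close>; each
  smaller prime costs a factor \<open>c\<close>, and there are at most \<open>P\<close> of
  those.\<close>

lemma divisor_bound:
  fixes \<epsilon> :: real
  assumes eps: "\<epsilon> > 0"
  shows "\<exists>C>0. \<forall>n::nat. n > 0 \<longrightarrow> real (card {d. d dvd n}) \<le> C * real n powr \<epsilon>"
proof -
  \<comment> \<open>From \<open>P\<close> on, \<open>p powr \<epsilon>\<close> is at least
    2.\<close>
  define P where "P = nat \<lceil>2 powr (1 / \<epsilon>)\<rceil>"
  \<comment> \<open>By \<open>1 + x \<le> exp x\<close> with
    \<open>x = \<epsilon> * ln 2 * e\<close>, the bound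
    \<open>e + 1 \<le> c * 2 powr (\<epsilon> * e)\<close> needs only \<open>c \<ge> 1\<close> and
    \<open>c * \<epsilon> * ln 2 \<ge> 1\<close>.\<close>
  define c where "c = max 1 (1 / (\<epsilon> * ln 2))"
  have c1: "c \<ge> 1" by (simp add: c_def)
  have small: "real e + 1 \<le> c * 2 powr (\<epsilon> * real e)" for e :: nat
  proof -
    have pos: "\<epsilon> * ln 2 > 0" using eps by simp
    have "1 + \<epsilon> * ln 2 * real e \<le> exp (\<epsilon> * ln 2 * real e)" by (rule exp_ge_add_one_self)
    also have "\<dots> = 2 powr (\<epsilon> * real e)" by (simp add: powr_def mult_ac)
    finally have "c * (1 + \<epsilon> * ln 2 * real e) \<le> c * 2 powr (\<epsilon> * real e)"
      using c1 by (intro mult_left_mono) auto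
    moreover have "c * (\<epsilon> * ln 2) \<ge> 1"
      using pos eps by (simp add: c_def max_def field_simps)
    then have "c * (\<epsilon> * ln 2) * real e \<ge> 1 * real e" by (intro mult_right_mono) auto
    ultimately show ?thesis using c1 by (simp add: algebra_simps)
  qed
  have large: "2 \<le> real p powr \<epsilon>" if "p \<ge> P" for p :: nat
  proof -
    have "2 powr (1 / \<epsilon>) \<le> real p" using that unfolding P_def by linarith
    then have "(2 powr (1 / \<epsilon>)) powr \<epsilon> \<le> real p powr \<epsilon>"
      using eps by (intro powr_mono2) auto
    then show ?thesis using eps by (simp add: powr_powr)
  qed
  define S where "S = (\<lambda>n. {p::nat. prime p \<and> p dvd n \<and> p < P})"
  have main: "real (card {d. d dvd n}) \<le> c ^ card (S n) * real n powr \<epsilon>" if "n > 0" for n :: nat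
    using that
  proof (induction n rule: less_induct)
    case (less n)
    show ?case
    proof (cases "n = 1")
      case True
      have "S 1 = {}" by (auto simp: S_def)
      with True show ?thesis by simp
    next
      case False
      then obtain p where p: "prime p" "p dvd n" using prime_factor_nat by blast
      \<comment> \<open>The whole power of \<open>p\<close> is split off, so that passing from
        \<open>n\<close> to \<open>m\<close> removes \<open>p\<close> from the set of small primes
        or leaves that set unchanged.\<close>
      define e where "e = multiplicity p n"
      obtain m where m: "n = p ^ e * m" "\<not> p dvd m"
          unfolding e_def
        by (rule multiplicity_decompose'[of n p]) (use p less.prems not_prime_unit[of p] in auto)
      have e1: "e \<ge> 1" using p less.prems m by (cases e) auto
      have m0: "m > 0" using m less.prems by (cases m) auto
      have p2: "p \<ge> 2" using p prime_ge_2_nat by blast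
      have "p ^ e > 1" using e1 p2 by (intro one_less_power) auto
      then have mn: "m < n" using m0 m(1) by simp
      have IH: "real (card {d. d dvd m}) \<le> c ^ card (S m) * real m powr \<epsilon>"
        using less.IH[OF mn m0] .
      have "card {d. d dvd n} \<le> card {d. d dvd p ^ e} * card {d. d dvd m}"
        unfolding m(1) using p2 m0 by (intro card_divisors_mult_le) auto
      also have "\<dots> \<le> (e + 1) * card {d. d dvd m}"
        using card_divisors_prime_power_le[OF p(1)] by (intro mult_right_mono) auto
      finally have "real (card {d. d dvd n}) \<le> real ((e + 1) * card {d. d dvd m})"
        by (simp only: of_nat_le_iff)
      also have "\<dots> \<le> (real e + 1) * (c ^ card (S m) * real m powr \<epsilon>)"
        using mult_left_mono[OF IH, of "real e + 1"] by (simp add: algebra_simps)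
      finally have A: "real (card {d. d dvd n}) \<le> (real e + 1) * (c ^ card (S m) * real m powr \<epsilon>)" .
      have np: "real n powr \<epsilon> = real p powr (\<epsilon> * real e) * real m powr \<epsilon>"
        using p2 m0 by (simp add: m(1) powr_mult powr_realpow[symmetric] powr_powr mult.commute)
      have fin: "finite (S k)" for k by (auto simp: S_def)
      have pp: "q = p" if "prime q" "q dvd p ^ e" for q
        using that p(1) by (meson prime_dvd_power primes_dvd_imp_eq)
      show ?thesis
      proof (cases "p < P")
        case True
        have "S n = insert p (S m)"
          using True p m by (auto simp: S_def prime_dvd_mult_iff dest: pp)
        moreover have "p \<notin> S m" using m by (simp add: S_def)
        ultimately have cs: "card (S n) = Suc (card (S m))" using fin by simp
        have "real e + 1 \<le> c * real p powr (\<epsilon> * real e)"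
        proof -
          have "2 powr (\<epsilon> * real e) \<le> real p powr (\<epsilon> * real e)"
            using p2 eps by (intro powr_mono2) auto
          then show ?thesis using small[of e] c1 by (smt (verit) mult_left_mono)
        qed
        then have "(real e + 1) * (c ^ card (S m) * real m powr \<epsilon>)
            \<le> (c * real p powr (\<epsilon> * real e)) * (c ^ card (S m) * real m powr \<epsilon>)"
          using c1 by (intro mult_right_mono) auto
        with A show ?thesis by (simp add: cs np mult_ac)
      next
        case False
        have "S n = S m"
          using False p m by (auto simp: S_def prime_dvd_mult_iff dest: pp)
        moreover have "real e + 1 \<le> real p powr (\<epsilon> * real e)"
        proof -
          have "real e + 1 \<le> 2 ^ e"
            by (induction e) auto
          also have "\<dots> \<le> (real p powr \<epsilon>) ^ e" using large[of p] False by (intro power_mono) auto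
          also have "\<dots> = real p powr (\<epsilon> * real e)"
            using p2 by (simp add: powr_realpow[symmetric] powr_powr)
          finally show ?thesis .
        qed
        then have "(real e + 1) * (c ^ card (S m) * real m powr \<epsilon>)
            \<le> (real p powr (\<epsilon> * real e)) * (c ^ card (S m) * real m powr \<epsilon>)"
          using c1 by (intro mult_right_mono) auto
        ultimately show ?thesis using A by (simp add: np mult_ac)
      qed
    qed
  qed
  have "real (card {d. d dvd n}) \<le> c ^ P * real n powr \<epsilon>" if "n > 0" for n :: nat
  proof -
    have "card (S n) \<le> card {..<P}" by (intro card_mono) (auto simp: S_def)
    then have "c ^ card (S n) \<le> c ^ P" using c1 by (intro power_increasing) auto
    then have "c ^ card (S n) * real n powr \<epsilon> \<le> c ^ P * real n powr \<epsilon>"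
      by (intro mult_right_mono) auto
    with main[OF that] show ?thesis by linarith
  qed
  moreover have "c ^ P > 0" using c1 by simp
  ultimately show ?thesis by blast
qed

section \<open>Representations by a sum of two squares\<close>

definition nsq :: "int \<times> int \<Rightarrow> int" where
  "nsq h = (fst h)\<^sup>2 + (snd h)\<^sup>2"

lemma nsq_nonneg [simp]: "nsq h \<ge> 0"
  by (simp add: nsq_def)

lemma abs_le_of_square_le:
  fixes x n :: int
  assumes "x\<^sup>2 \<le> n"
  shows "\<bar>x\<bar> \<le> n"
proof -
  have "\<bar>x\<bar> * 1 \<le> \<bar>x\<bar> * \<bar>x\<bar>" if "x \<noteq> 0" using that by (intro mult_left_mono) auto
  then show ?thesis using assms by (cases "x = 0") (auto simp: power2_eq_square)
qed

lemma finite_nsq_le: "finite {v. nsq v \<le> n}"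
proof (rule finite_subset)
  show "{v. nsq v \<le> n} \<subseteq> {-n..n} \<times> {-n..n}"
  proof
    fix v assume "v \<in> {v. nsq v \<le> n}"
    then have "(fst v)\<^sup>2 + (snd v)\<^sup>2 \<le> n" by (simp add: nsq_def)
    then have "(fst v)\<^sup>2 \<le> n" "(snd v)\<^sup>2 \<le> n"
      using zero_le_power2[of "fst v"] zero_le_power2[of "snd v"] by linarith+
    then have "\<bar>fst v\<bar> \<le> n" "\<bar>snd v\<bar> \<le> n" by (auto intro: abs_le_of_square_le)
    then show "v \<in> {-n..n} \<times> {-n..n}" by (cases v) auto
  qed
qed auto

lemma finite_nsq_eq: "finite {v. nsq v = n}"
  by (rule finite_subset[OF _ finite_nsq_le[of n]]) auto

text \<open>The product of \<open>x * y0 - y * x0\<close> and \<open>x * y0 + y * x0\<close> is a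
  multiple of \<open>n\<close>. Hence \<open>(x, y)\<close> is proportional to
  \<open>(x0, y0)\<close> modulo \<open>d\<close> and to \<open>(- x0, y0)\<close> modulo
  \<open>n / d\<close>. Two pairs with the same \<open>d\<close> are thus proportional to each other
  modulo both factors, whose gcd divides 2.\<close>

lemma primitive_fibre_dvd:
  fixes x y x' y' x0 y0 n d :: int
  assumes n: "n > 0" and d: "d = gcd n (x * y0 - y * x0)" and d': "d = gcd n (x' * y0 - y' * x0)"
    and c: "x\<^sup>2 + y\<^sup>2 = n" and c': "x'\<^sup>2 + y'\<^sup>2 = n" and c0: "x0\<^sup>2 + y0\<^sup>2 = n"
    and p: "coprime x y" and p0: "coprime x0 y0"
  shows "n dvd 2 * (x * y' - x' * y)"
proof -
  have cop0: "coprime n x0" "coprime n y0"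
  proof -
    have cp: "coprime (y0\<^sup>2) x0" "coprime (x0\<^sup>2) y0" using p0 by (auto simp: coprime_commute)
    have "c dvd 1" if "c dvd n" "c dvd x0" for c
    proof -
      have "c dvd n - x0 * x0" using that by simp
      also have "n - x0 * x0 = y0\<^sup>2" using c0 by (simp add: power2_eq_square)
      finally have "c dvd y0\<^sup>2" .
      then show ?thesis using that cp(1) not_coprimeI[of c "y0\<^sup>2" x0] by auto
    qed
    then show "coprime n x0" by (intro coprimeI) auto
    have "c dvd 1" if "c dvd n" "c dvd y0" for c
    proof -
      have "c dvd n - y0 * y0" using that by simp
      also have "n - y0 * y0 = x0\<^sup>2" using c0 by (simp add: power2_eq_square)
      finally have "c dvd x0\<^sup>2" .
      then show ?thesis using that cp(2) not_coprimeI[of c "x0\<^sup>2" y0] by auto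
    qed
    then show "coprime n y0" by (intro coprimeI) auto
  qed
  have d0: "d > 0" using n d by (simp add: gcd_pos_int)
  have "d dvd n" using d by simp
  then obtain e where e: "n = d * e" by (elim dvdE)
  have dvdR: "e dvd a * y0 + b * x0"
    if "d = gcd n (a * y0 - b * x0)" "a\<^sup>2 + b\<^sup>2 = n" for a b
  proof -
    have "d dvd a * y0 - b * x0" using that(1) by simp
    then obtain q where q: "a * y0 - b * x0 = d * q" by (elim dvdE)
    \<comment> \<open>Cancelling \<open>d\<close> leaves \<open>e\<close> and \<open>q\<close>
      coprime, so that \<open>e\<close> has to divide the conjugate form.\<close>
    have "gcd (d * e) (d * q) = d" using that(1) e q by simp
    then have "d * gcd e q = d" using d0 by (simp add: gcd_mult_distrib_int[symmetric])
    then have "coprime e q" using d0 by (simp add: coprime_iff_gcd_eq_1)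
    have "(a * y0 - b * x0) * (a * y0 + b * x0) = n * (a\<^sup>2 - x0\<^sup>2)"
    proof -
      have "(a * y0 - b * x0) * (a * y0 + b * x0) = a\<^sup>2 * y0\<^sup>2 - b\<^sup>2 * x0\<^sup>2"
        by (simp add: algebra_simps power2_eq_square)
      also have "y0\<^sup>2 = n - x0\<^sup>2" using c0 by simp
      also have "b\<^sup>2 = n - a\<^sup>2" using that(2) by simp
      finally show ?thesis by (simp add: algebra_simps)
    qed
    then have "d * (q * (a * y0 + b * x0)) = d * (e * (a\<^sup>2 - x0\<^sup>2))" using q e by (simp add: mult_ac)
    then have "q * (a * y0 + b * x0) = e * (a\<^sup>2 - x0\<^sup>2)" using d0 by simp
    then have "e dvd q * (a * y0 + b * x0)" by simp
    then show ?thesis using \<open>coprime e q\<close> by (simp add: coprime_dvd_mult_right_iff)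
  qed
  have R: "e dvd x * y0 + y * x0" "e dvd x' * y0 + y' * x0" using dvdR d d' c c' by auto
  have Q: "d dvd x * y0 - y * x0" "d dvd x' * y0 - y' * x0"
    subgoal using d by simp
    subgoal using d' by simp
    done
  let ?W = "x * y' - x' * y"
  have "?W * y0 = (x * y0 - y * x0) * y' - (x' * y0 - y' * x0) * y" by (simp add: algebra_simps)
  then have "d dvd ?W * y0" using Q by simp
  moreover have "coprime d y0" using cop0 e by simp
  ultimately have dW: "d dvd ?W" by (simp add: coprime_dvd_mult_left_iff)
  have "?W * y0 = (x * y0 + y * x0) * y' - (x' * y0 + y' * x0) * y" by (simp add: algebra_simps)
  then have "e dvd ?W * y0" using R by simp
  moreover have "coprime e y0" using cop0 e by simp
  ultimately have eW: "e dvd ?W" by (simp add: coprime_dvd_mult_left_iff)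
  \<comment> \<open>A common divisor of \<open>d\<close> and \<open>e\<close> divides the sum and
    the difference of the two forms, \<open>2 * x * y0\<close> and \<open>2 * y * x0\<close>. By
    coprimality it divides 2, so passing from \<open>lcm d e\<close> to \<open>d * e\<close> costs
    at most a factor 2.\<close>
  define g where "g = gcd d e"
  have gd: "g dvd d" "g dvd e" by (auto simp: g_def)
  have "g dvd (x * y0 + y * x0) + (x * y0 - y * x0)" "g dvd (x * y0 + y * x0) - (x * y0 - y * x0)"
    using dvd_trans[OF gd(1) Q(1)] dvd_trans[OF gd(2) R(1)] by (blast intro: dvd_add dvd_diff)+
  moreover have "(x * y0 + y * x0) + (x * y0 - y * x0) = 2 * x * y0"
    "(x * y0 + y * x0) - (x * y0 - y * x0) = 2 * y * x0" by simp_all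
  ultimately have "g dvd 2 * x * y0" "g dvd 2 * y * x0" by metis+
  moreover have "coprime g y0" "coprime g x0"
    using gd cop0 e by (auto intro: coprime_divisors[of g n])
  ultimately have "g dvd 2 * x" "g dvd 2 * y" by (simp_all add: coprime_dvd_mult_left_iff)
  then have "g dvd gcd (2 * x) (2 * y)" by simp
  also have "gcd (2 * x) (2 * y) = 2" using p by (simp add: gcd_mult_distrib_int[symmetric])
  finally have g2: "g dvd 2" .
  have "d * e dvd g * lcm d e" by (simp add: g_def abs_mult[symmetric])
  also have "g * lcm d e dvd 2 * ?W" using g2 dW eW by (intro mult_dvd_mono) auto
  finally show ?thesis using e by simp
qed

text \<open>The points are sorted by the divisor \<open>d\<close> of
  \<open>primitive_fibre_dvd\<close>, taken with respect to a fixed point. Within a fibre, the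
  determinant with a fixed member \<open>v'\<close> is a multiple of \<open>n / 2\<close> of modulus
  at most \<open>n\<close>, which leaves five values. The scalar product with \<open>v'\<close> is
  then known up to sign, and both together determine the point: \<open>10 = 5 * 2\<close>.\<close>

lemma card_primitive_le:
  fixes n :: nat
  assumes n: "n > 0"
  shows "card {v. nsq v = int n \<and> coprime (fst v) (snd v)} \<le> 10 * card {d. d dvd n}"
proof -
  define A where "A = {v. nsq v = int n \<and> coprime (fst v) (snd v)}"
  have finA: "finite A" by (rule finite_subset[OF _ finite_nsq_eq[of "int n"]]) (auto simp: A_def)
  show ?thesis
  proof (cases "A = {}")
    case True then show ?thesis by (simp only: A_def card.empty)
  next
    case False
    then obtain v0 where v0: "v0 \<in> A" by blast
    define f where "f = (\<lambda>v. nat (gcd (int n) (fst v * snd v0 - snd v * fst v0)))"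
    have "f ` A \<subseteq> {d. d dvd n}"
      by (auto simp: f_def nat_dvd_iff)
    have fib: "card {v\<in>A. f v = d} \<le> 10" for d
    proof (cases "{v\<in>A. f v = d} = {}")
      case True then show ?thesis by (simp only: True) simp
    next
      case False
      then obtain v' where v': "v' \<in> A" "f v' = d" by blast
      define g where "g = (\<lambda>v. (2 * (fst v * snd v' - fst v' * snd v) div int n,
          fst v * fst v' + snd v * snd v' \<ge> 0))"
      have key: "int n dvd 2 * (fst v * snd v' - fst v' * snd v) \<and>
          (fst v * snd v' - fst v' * snd v)\<^sup>2 + (fst v * fst v' + snd v * snd v')\<^sup>2 = (int n)\<^sup>2"
        if "v \<in> A" "f v = d" for v
      proof
        have gp: "gcd (int n) t \<ge> 0" for t by simp
        have 1: "gcd (int n) (fst v * snd v0 - snd v * fst v0) = int d"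
          using that gp[of "fst v * snd v0 - snd v * fst v0"] by (auto simp: f_def)
        have 2: "gcd (int n) (fst v' * snd v0 - snd v' * fst v0) = int d"
          using v' gp[of "fst v' * snd v0 - snd v' * fst v0"] by (auto simp: f_def)
        show "int n dvd 2 * (fst v * snd v' - fst v' * snd v)"
          by (rule primitive_fibre_dvd[where d="int d" and ?x0.0="fst v0" and ?y0.0="snd v0"])
            (use 1 2 that v0 v' n in \<open>auto simp: A_def nsq_def\<close>)
        have "(fst v * snd v' - fst v' * snd v)\<^sup>2 + (fst v * fst v' + snd v * snd v')\<^sup>2
          = nsq v * nsq v'" by (simp add: nsq_def power2_eq_square algebra_simps)
        then show "(fst v * snd v' - fst v' * snd v)\<^sup>2 + (fst v * fst v' + snd v * snd v')\<^sup>2 = (int n)\<^sup>2"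
          using that v' by (simp add: A_def power2_eq_square)
      qed
      have "inj_on g {v\<in>A. f v = d}"
      proof (rule inj_onI)
        fix v w assume v: "v \<in> {v\<in>A. f v = d}" and w: "w \<in> {v\<in>A. f v = d}" and eq: "g v = g w"
        define V where "V = fst v * snd v' - fst v' * snd v"
        define W where "W = fst w * snd v' - fst v' * snd w"
        define S where "S = fst v * fst v' + snd v * snd v'"
        define T where "T = fst w * fst v' + snd w * snd v'"
        have pv: "int n dvd 2 * V" "V\<^sup>2 + S\<^sup>2 = (int n)\<^sup>2" using key[of v] v by (auto simp: V_def S_def)
        have pw: "int n dvd 2 * W" "W\<^sup>2 + T\<^sup>2 = (int n)\<^sup>2" using key[of w] w by (auto simp: W_def T_def)
        have "2 * V div int n = 2 * W div int n" and sg: "S \<ge> 0 \<longleftrightarrow> T \<ge> 0"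
          using eq by (auto simp: g_def V_def W_def S_def T_def)
        then have VW: "V = W" using pv(1) pw(1) by (metis dvd_div_mult_self mult_left_cancel zero_neq_numeral)
        then have "S\<^sup>2 = T\<^sup>2" using pv pw by simp
        then have ST: "S = T" using sg by (auto simp: power2_eq_iff)
        have n': "(fst v')\<^sup>2 + (snd v')\<^sup>2 = int n" using v' by (simp add: A_def nsq_def)
        \<comment> \<open>Determinant and scalar product with \<open>v'\<close> are the coordinates
          of \<open>v\<close> in the orthogonal frame spanned by \<open>v'\<close>, whose squared
          length is \<open>n\<close>.\<close>
        have "int n * fst v = V * snd v' + S * fst v'" "int n * fst w = W * snd v' + T * fst v'"
          "int n * snd v = S * snd v' - V * fst v'" "int n * snd w = T * snd v' - W * fst v'"
          unfolding n'[symmetric] V_def W_def S_def T_def by (simp_all add: power2_eq_square algebra_simps)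
        then have "int n * fst v = int n * fst w" "int n * snd v = int n * snd w" using VW ST by simp_all
        then show "v = w" using n by (simp add: prod_eq_iff)
      qed
      moreover have "g ` {v\<in>A. f v = d} \<subseteq> {-2..2} \<times> UNIV"
      proof
        fix z assume "z \<in> g ` {v\<in>A. f v = d}"
        then obtain v where v: "v \<in> A" "f v = d" "z = g v" by blast
        define V where "V = fst v * snd v' - fst v' * snd v"
        define S where "S = fst v * fst v' + snd v * snd v'"
        have "V\<^sup>2 + S\<^sup>2 = (int n)\<^sup>2" using key[of v] v by (auto simp: V_def S_def)
        then have "V\<^sup>2 \<le> (int n)\<^sup>2" using zero_le_power2[of S] by linarith
        then have "\<bar>V\<bar> \<le> int n" by (simp add: abs_le_square_iff[symmetric])
        moreover obtain j where j: "2 * V = int n * j" using key[of v] v by (auto simp: V_def elim: dvdE)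
        ultimately have "\<bar>int n * j\<bar> \<le> int n * 2" by linarith
        then have "int n * \<bar>j\<bar> \<le> int n * 2" by (simp add: abs_mult)
        then have "\<bar>j\<bar> \<le> 2" using n by simp
        moreover have "fst z = j" using v(3) j n by (simp add: g_def V_def)
        ultimately show "z \<in> {-2..2} \<times> UNIV" by (cases z) auto
      qed
      ultimately have "card {v\<in>A. f v = d} \<le> card (({-2..2} :: int set) \<times> (UNIV :: bool set))"
        by (intro card_inj_on_le) auto
      then show ?thesis by (simp add: card_cartesian_product)
    qed
    have finD: "finite {d. d dvd n}" using n by simp
    have "A = (\<Union>d\<in>{d. d dvd n}. {v\<in>A. f v = d})" using \<open>f ` A \<subseteq> {d. d dvd n}\<close> by blast
    then have "card A \<le> (\<Sum>d\<in>{d. d dvd n}. card {v\<in>A. f v = d})"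
      using card_UN_le[OF finD, of "\<lambda>d. {v\<in>A. f v = d}"] by simp
    also have "\<dots> \<le> (\<Sum>d\<in>{d. d dvd n}. 10)" by (intro sum_mono fib)
    finally show ?thesis by (simp add: A_def mult.commute)
  qed
qed

text \<open>Dividing a point by the gcd \<open>g\<close> of its coordinates gives a primitive point
  for \<open>n div g\<^sup>2\<close>. Each possible \<open>g\<close> is itself a divisor of
  \<open>n\<close>, whence the square.\<close>

lemma card_two_squares_le:
  fixes n :: nat
  assumes n: "n > 0"
  shows "card {v. nsq v = int n} \<le> 10 * (card {d. d dvd n})\<^sup>2"
proof -
  define G where "G = {g. g dvd n \<and> g\<^sup>2 dvd n}"
  define P where "P = (\<lambda>g. {v. nsq v = int (n div g\<^sup>2) \<and> coprime (fst v) (snd v)})"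
  have finG: "finite G" using n by (auto simp: G_def)
  have finP: "finite (P g)" for g
    by (rule finite_subset[OF _ finite_nsq_eq[of "int (n div g\<^sup>2)"]]) (auto simp: P_def)
  have sub: "{v. nsq v = int n} \<subseteq> (\<Union>g\<in>G. (\<lambda>v. (int g * fst v, int g * snd v)) ` P g)"
  proof
    fix v assume "v \<in> {v. nsq v = int n}"
    then have v: "nsq v = int n" by simp
    obtain x y where xy: "v = (x, y)" by (cases v)
    define g where "g = gcd x y"
    have g0: "g > 0"
    proof -
      have "x \<noteq> 0 \<or> y \<noteq> 0" using v n xy by (auto simp: nsq_def)
      then show ?thesis by (auto simp: g_def gcd_pos_int)
    qed
    obtain x' y' where x': "x = x' * g" "y = y' * g" "coprime x' y'"
      using gcd_coprime_exists[of x y] g0 unfolding g_def by (metis less_irrefl)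
    have eq: "int n = g\<^sup>2 * (x'\<^sup>2 + y'\<^sup>2)"
      using v xy x' by (simp add: nsq_def power2_eq_square algebra_simps)
    define h where "h = nat g"
    have gh: "g = int h" "h > 0" using g0 by (auto simp: h_def)
    have d2: "h\<^sup>2 dvd n" using eq gh by (metis dvd_triv_left int_dvd_int_iff of_nat_power)
    then have "h dvd n" by (metis dvd_mult_left power2_eq_square)
    then have hG: "h \<in> G" using d2 by (simp add: G_def)
    have "int (n div h\<^sup>2) = int n div g\<^sup>2" by (simp add: zdiv_int gh)
    also have "\<dots> = x'\<^sup>2 + y'\<^sup>2" using eq g0 by simp
    finally have "(x', y') \<in> P h" using x' by (simp add: P_def nsq_def)
    then show "v \<in> (\<Union>g\<in>G. (\<lambda>v. (int g * fst v, int g * snd v)) ` P g)"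
      using hG xy x' gh by (force simp: mult.commute)
  qed
  have Pc: "card (P g) \<le> 10 * card {d. d dvd n}" if "g \<in> G" for g
  proof -
    have gn: "n div g\<^sup>2 > 0" "n div g\<^sup>2 dvd n" using that n
      by (auto simp: G_def elim!: dvdE)
    have "card (P g) \<le> 10 * card {d. d dvd n div g\<^sup>2}" unfolding P_def by (rule card_primitive_le[OF gn(1)])
    also have "\<dots> \<le> 10 * card {d. d dvd n}"
      using n gn by (intro mult_left_mono card_mono) (auto intro: dvd_trans)
    finally show ?thesis .
  qed
  have "card {v. nsq v = int n} \<le> card (\<Union>g\<in>G. (\<lambda>v. (int g * fst v, int g * snd v)) ` P g)"
    using finG finP by (intro card_mono sub) auto
  also have "\<dots> \<le> (\<Sum>g\<in>G. card ((\<lambda>v. (int g * fst v, int g * snd v)) ` P g))"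
    by (rule card_UN_le[OF finG])
  also have "\<dots> \<le> (\<Sum>g\<in>G. 10 * card {d. d dvd n})"
    by (intro sum_mono order_trans[OF card_image_le Pc] finP)
  also have "\<dots> = card G * (10 * card {d. d dvd n})" by simp
  also have "\<dots> \<le> card {d. d dvd n} * (10 * card {d. d dvd n})"
    using n by (intro mult_right_mono card_mono) (auto simp: G_def)
  finally show ?thesis by (simp add: power2_eq_square mult_ac)
qed

text \<open>Three lattice points on a circle span a triangle whose area is at least \<open>1/2\<close>; the area is also
  the product of the sides over four times the radius.\<close>

lemma lattice_circle_identity:
  fixes w1 w2 u1 u2 v1 v2 :: int
  assumes "w1 * u1 + w2 * u2 = - (u1\<^sup>2 + u2\<^sup>2)" "w1 * v1 + w2 * v2 = - (v1\<^sup>2 + v2\<^sup>2)"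
  shows "(w1\<^sup>2 + w2\<^sup>2) * (u1 * v2 - u2 * v1)\<^sup>2 = (u1\<^sup>2 + u2\<^sup>2) * (v1\<^sup>2 + v2\<^sup>2) * ((u1 - v1)\<^sup>2 + (u2 - v2)\<^sup>2)"
proof -
  \<comment> \<open>The hypotheses say that \<open>w\<close>, \<open>w + 2 * u\<close> and
    \<open>w + 2 * v\<close> have the same length. They are a linear system for \<open>w\<close>,
    solved by Cramer's rule; its determinant \<open>u1 * v2 - u2 * v1\<close> is, up to sign, twice
    the area of the triangle with sides \<open>u\<close> and \<open>v\<close>.\<close>
  define a where "a = u1\<^sup>2 + u2\<^sup>2"
  define b where "b = v1\<^sup>2 + v2\<^sup>2"
  have 1: "w1 * (u1 * v2 - u2 * v1) = - a * v2 + b * u2"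
    using assms unfolding a_def[symmetric] b_def[symmetric] by algebra
  have 2: "w2 * (u1 * v2 - u2 * v1) = a * v1 - b * u1"
    using assms unfolding a_def[symmetric] b_def[symmetric] by algebra
  have "(w1\<^sup>2 + w2\<^sup>2) * (u1 * v2 - u2 * v1)\<^sup>2
      = (w1 * (u1 * v2 - u2 * v1))\<^sup>2 + (w2 * (u1 * v2 - u2 * v1))\<^sup>2"
    by (simp only: power_mult_distrib distrib_right)
  also have "\<dots> = a\<^sup>2 * b + b\<^sup>2 * a - 2 * a * b * (u1 * v1 + u2 * v2)"
    unfolding 1 2 by (simp add: a_def b_def power2_eq_square algebra_simps)
  also have "\<dots> = a * b * ((u1 - v1)\<^sup>2 + (u2 - v2)\<^sup>2)"
    by (simp add: a_def b_def power2_eq_square algebra_simps)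
  finally show ?thesis by (simp add: a_def b_def)
qed

text \<open>The points \<open>2 * h - k\<close> lie on the circle of squared radius
  \<open>n = 2 * m - nsq k\<close> about the origin. Three of them with
  \<open>nsq h \<le> M\<^sup>2\<close> span a nonzero area, which forces
  \<open>n \<le> 64 * M powr 6\<close>, and a divisor bound in \<open>n\<close> becomes a bound in
  \<open>M\<close>.\<close>

lemma lattice_arc_bound:
  fixes \<epsilon> :: real
  assumes eps: "\<epsilon> > 0"
  shows "\<exists>C>0. \<forall>M\<ge>1. \<forall>k m. real (card {h. real_of_int (nsq h) \<le> M\<^sup>2 \<and> nsq h + nsq (k - h) = m}) \<le> C * M powr \<epsilon>"
proof -
  \<comment> \<open>The divisor count enters squared and \<open>n\<close> may reach the sixth power
    of \<open>M\<close>, which turns \<open>\<epsilon> / 12\<close> into \<epsilon>.\<close>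
  obtain C0 where C0: "C0 > 0" "\<And>n::nat. n > 0 \<Longrightarrow> real (card {d. d dvd n}) \<le> C0 * real n powr (\<epsilon> / 12)"
    using divisor_bound[of "\<epsilon> / 12"] eps by auto
  define C where "C = 2 + 10 * C0\<^sup>2 * 64 powr (\<epsilon> / 6)"
  have "real (card {h. real_of_int (nsq h) \<le> M\<^sup>2 \<and> nsq h + nsq (k - h) = m}) \<le> C * M powr \<epsilon>"
    if M: "M \<ge> 1" for M k m
  proof -
    define A where "A = {h. real_of_int (nsq h) \<le> M\<^sup>2 \<and> nsq h + nsq (k - h) = m}"
    define n where "n = 2 * m - nsq k"
    define w where "w = (\<lambda>h::int\<times>int. (2 * fst h - fst k, 2 * snd h - snd k))"
    have wA: "nsq (w h) = n" if "h \<in> A" for h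
      using that by (auto simp: A_def w_def n_def nsq_def power2_eq_square algebra_simps)
    have Mp: "M powr \<epsilon> \<ge> 1" using M eps by (simp add: ge_one_powr_ge_zero)
    have C2: "C \<ge> 2" by (simp add: C_def)
    have "real (card A) \<le> C * M powr \<epsilon>"
    proof (cases "card A \<le> 2")
      case True
      have "real (card A) \<le> 2 * 1" using True by simp
      also have "\<dots> \<le> C * M powr \<epsilon>" using C2 Mp by (intro mult_mono) auto
      finally show ?thesis .
    next
      case False
      then obtain T where T: "T \<subseteq> A" "card T = 3"
        by (metis Suc_leI not_le numeral_2_eq_2 numeral_3_eq_3 obtain_subset_with_card_n)
      then obtain h1 h2 h3 where h: "h1 \<in> A" "h2 \<in> A" "h3 \<in> A" "h1 \<noteq> h2" "h2 \<noteq> h3" "h1 \<noteq> h3"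
        by (auto simp: card_3_iff)
      define u where "u = h2 - h1"
      define v where "v = h3 - h1"
      define D where "D = fst u * snd v - snd u * fst v"
      have eq: "fst (w h1) * fst p + snd (w h1) * snd p = - ((fst p)\<^sup>2 + (snd p)\<^sup>2)"
        if "p = h - h1" "h \<in> A" for p h
        using wA[OF h(1)] wA[OF that(2)] unfolding that(1) w_def nsq_def
        by (simp add: power2_eq_square algebra_simps)
      have id: "n * D\<^sup>2 = nsq u * nsq v * nsq (u - v)"
        using lattice_circle_identity[OF eq[OF u_def h(2)] eq[OF v_def h(3)]] wA[OF h(1)]
        by (simp add: nsq_def D_def)
      have pos: "nsq (p - q) > 0" if "p \<noteq> q" for p q
        using that by (cases p; cases q) (auto simp: nsq_def sum_power2_gt_zero_iff)
      have up: "real_of_int (nsq (p - q)) \<le> 4 * M\<^sup>2" if "p \<in> A" "q \<in> A" for p q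
      proof -
        have "nsq (p - q) + nsq (p + q) = 2 * nsq p + 2 * nsq q"
          by (simp add: nsq_def power2_eq_square algebra_simps)
        then have "nsq (p - q) \<le> 2 * nsq p + 2 * nsq q" using nsq_nonneg[of "p + q"] by linarith
        then have "real_of_int (nsq (p - q)) \<le> 2 * real_of_int (nsq p) + 2 * real_of_int (nsq q)"
          by linarith
        also have "\<dots> \<le> 4 * M\<^sup>2" using that by (auto simp: A_def)
        finally show ?thesis .
      qed
      have uv: "u - v = h2 - h3" by (simp add: u_def v_def)
      have pos3: "nsq u * nsq v * nsq (u - v) > 0"
        unfolding uv unfolding u_def v_def using h by (intro mult_pos_pos pos) auto
      have n0: "n > 0" using id pos3 by (metis zero_less_mult_pos2 zero_less_power2 mult_eq_0_iff less_irrefl power2_eq_square)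
      \<comment> \<open>Three distinct points of a circle are never collinear; here this shows as
        the positive right-hand side of \<open>id\<close>. The integer \<open>D\<close> is therefore
        nonzero.\<close>
      have D1: "D\<^sup>2 \<ge> 1" using id pos3 by (cases "D = 0") (auto simp: int_one_le_iff_zero_less)
      have "n * 1 \<le> n * D\<^sup>2" using n0 D1 by (intro mult_left_mono) auto
      then have "n \<le> nsq u * nsq v * nsq (u - v)" using id by simp
      then have "real_of_int n \<le> real_of_int (nsq u * nsq v * nsq (u - v))" by (simp only: of_int_le_iff)
      also have "\<dots> = real_of_int (nsq (h2 - h1)) * real_of_int (nsq (h3 - h1)) * real_of_int (nsq (h2 - h3))"
        by (simp add: uv) (simp add: u_def v_def)
      also have "\<dots> \<le> (4 * M\<^sup>2) * (4 * M\<^sup>2) * (4 * M\<^sup>2)"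
        using h by (intro mult_mono up) auto
      also have "\<dots> = 64 * M powr 6" using M by (simp add: powr_numeral numeral_eq_Suc)
      finally have nle: "real_of_int n \<le> 64 * M powr 6" .
      have nn: "int (nat n) = n" "nat n > 0" using n0 by auto
      have "card A \<le> card {v. nsq v = int (nat n)}"
      proof (rule card_inj_on_le[of w])
        show "inj_on w A" by (auto simp: inj_on_def w_def prod_eq_iff)
        show "w ` A \<subseteq> {v. nsq v = int (nat n)}" using wA nn by auto
      qed (rule finite_nsq_eq)
      also have "\<dots> \<le> 10 * (card {d. d dvd nat n})\<^sup>2" by (rule card_two_squares_le[OF nn(2)])
      finally have "real (card A) \<le> real (10 * (card {d. d dvd nat n})\<^sup>2)" by (simp only: of_nat_le_iff)
      also have "\<dots> = 10 * (real (card {d. d dvd nat n}))\<^sup>2" by simp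
      also have "\<dots> \<le> 10 * (C0 * real (nat n) powr (\<epsilon> / 12))\<^sup>2"
        using C0(2)[OF nn(2)] by (intro mult_left_mono power_mono) auto
      also have "\<dots> = 10 * C0\<^sup>2 * real (nat n) powr (\<epsilon> / 6)"
        using nn by (simp add: power_mult_distrib powr_power)
      also have "\<dots> \<le> 10 * C0\<^sup>2 * (64 * M powr 6) powr (\<epsilon> / 6)"
        using nle n0 eps by (intro mult_left_mono powr_mono2) auto
      also have "\<dots> = 10 * C0\<^sup>2 * 64 powr (\<epsilon> / 6) * M powr \<epsilon>"
        using M by (simp add: powr_mult powr_powr del: powr_numeral)
      also have "\<dots> \<le> C * M powr \<epsilon>" unfolding C_def by (intro mult_right_mono) auto
      finally show ?thesis .
    qed
    then show ?thesis by (simp add: A_def)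
  qed
  moreover have "C > 0" unfolding C_def by (intro add_pos_nonneg) auto
  ultimately show ?thesis by blast
qed


subsection \<open>The resonance kernel\<close>

lemma jap_ge_1: "jap x \<ge> 1"
  by (simp add: jap_def)

lemma jap_pos [simp]: "jap x > 0"
  using jap_ge_1[of x] by linarith

lemma jap_nonneg [simp]: "jap x \<ge> 0"
  using jap_pos[of x] by linarith

lemma jap_sq: "(jap x)\<^sup>2 = 1 + (norm x)\<^sup>2"
  by (simp add: jap_def)

lemma norm_le_jap: "norm x \<le> jap x"
  unfolding jap_def by (rule real_le_rsqrt) simp

lemma jap_add_le:
  assumes "norm x \<le> norm y + norm z"
  shows "jap x \<le> jap y + jap z"
proof -
  have "(norm x)\<^sup>2 \<le> (norm y + norm z)\<^sup>2" using assms by (intro power_mono) auto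
  also have "\<dots> = (norm y)\<^sup>2 + (norm z)\<^sup>2 + 2 * (norm y * norm z)" by (simp add: power2_sum)
  also have "norm y * norm z \<le> jap y * jap z" by (intro mult_mono norm_le_jap) auto
  finally have "1 + (norm x)\<^sup>2 \<le> (jap y + jap z)\<^sup>2"
    by (simp add: power2_sum jap_sq)
  then show ?thesis unfolding jap_def[of x] by (intro real_le_lsqrt) auto
qed

lemma norm_freq_sq: "(norm (freq k))\<^sup>2 = real_of_int (nsq k)"
  unfolding norm_prod_def by (simp add: freq_def nsq_def)

text \<open>The endpoint is half of \<open>pi + 2\<close>, since the sine in
  \<open>norm_d_tau\<close> halves its argument. It lies below \<open>pi\<close>, so the sine has no
  zero in the range except 0: Taylor expansion up to 1 and compactness beyond give a linear
  bound.\<close>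

lemma sin_lower_bound: "\<exists>c>0. \<forall>y. 0 \<le> y \<and> y \<le> 1 + pi / 2 \<longrightarrow> c * y \<le> sin y"
proof -
  define a where "a = 1 + pi / 2"
  have a: "a < pi" using pi_gt3 by (simp add: a_def)
  have a1: "1 \<le> a" by (simp add: a_def)
  have "\<exists>z\<in>{1..a}. \<forall>y\<in>{1..a}. sin z \<le> sin y"
    by (rule continuous_attains_inf) (use a1 in \<open>auto intro!: continuous_intros\<close>)
  then obtain z where z: "z \<in> {1..a}" "\<And>y. y \<in> {1..a} \<Longrightarrow> sin z \<le> sin y" by blast
  have sz: "sin z > 0" using z a by (intro sin_gt_zero) auto
  define c where "c = min (5 / 6) (sin z / a)"
  have "c * y \<le> sin y" if y: "0 \<le> y" "y \<le> a" for y
  proof (cases "y \<le> 1")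
    case True
    have "y - y ^ 3 / 6 \<le> sin y"
    proof -
      have "\<bar>sin y - (\<Sum>m<3. sin_coeff m * y ^ m)\<bar> \<le> inverse (fact 3) * \<bar>y\<bar> ^ 3"
        by (rule Maclaurin_sin_bound)
      then have "6 * \<bar>sin y - y\<bar> \<le> y ^ 3" using y
        by (simp add: sin_coeff_def numeral_3_eq_3 fact_numeral)
      then show ?thesis by (simp add: abs_if split: if_splits)
    qed
    moreover have "y ^ 3 \<le> y"
      using y True power_decreasing[of 1 3 y] by simp
    moreover have "c \<le> 5 / 6" unfolding c_def by (rule min.cobounded1)
    then have "c * y \<le> 5 / 6 * y" using y by (intro mult_right_mono)
    ultimately show ?thesis by simp
  next
    case False
    have "c * y \<le> sin z / a * a" using y sz a1 by (intro mult_mono) (auto simp: c_def)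
    also have "\<dots> = sin z" using a1 by simp
    also have "\<dots> \<le> sin y" using False y by (intro z(2)) auto
    finally show ?thesis .
  qed
  moreover have "c > 0" using sz a1 by (auto simp: c_def)
  ultimately show ?thesis unfolding a_def by (intro exI[of _ c]) auto
qed

lemma norm_d_tau:
  assumes "\<tau> > 0"
  shows "cmod (d_tau \<tau> x) = 2 * \<bar>sin (\<tau> * x / 2)\<bar> / \<tau>"
proof -
  define y where "y = \<tau> * x / 2"
  have "(cmod (cis (2 * y) - 1))\<^sup>2 = (cos (2 * y) - 1)\<^sup>2 + (sin (2 * y))\<^sup>2"
    by (simp add: cmod_power2)
  also have "\<dots> = 2 - 2 * cos (2 * y)"
    using sin_cos_squared_add[of "2 * y"] by (simp add: power2_eq_square algebra_simps)
  also have "\<dots> = (2 * \<bar>sin y\<bar>)\<^sup>2" by (simp add: cos_double_sin power_mult_distrib)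
  finally have "cmod (cis (2 * y) - 1) = 2 * \<bar>sin y\<bar>"
    by (rule power2_eq_imp_eq) auto
  then have "cmod (cis (\<tau> * x) - 1) = 2 * \<bar>sin y\<bar>" by (simp add: y_def)
  then show ?thesis unfolding d_tau_def y_def using assms by (simp add: norm_divide)
qed

lemma d_tau_periodic: 
  assumes "\<tau> \<noteq> 0"
  shows "d_tau \<tau> (x + 2 * pi / \<tau>) = d_tau \<tau> x"
proof -
  have "cis (\<tau> * (x + 2 * pi / \<tau>)) = cis (\<tau> * x)"
    using assms by (simp add: distrib_left cis_mult[symmetric] cis_2pi)
  then show ?thesis by (simp add: d_tau_def)
qed

definition jd :: "real \<Rightarrow> real \<Rightarrow> real" where
  "jd \<tau> x = jap (d_tau \<tau> x)"

lemma jd_ge_1: "jd \<tau> x \<ge> 1" unfolding jd_def by (rule jap_ge_1)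

lemma jd_pos [simp]: "jd \<tau> x > 0" using jd_ge_1[of \<tau> x] by linarith

lemma jd_periodic: "\<tau> \<noteq> 0 \<Longrightarrow> jd \<tau> (x + 2 * pi / \<tau>) = jd \<tau> x"
  by (simp add: jd_def d_tau_periodic)

lemma periodic_shift_int:
  fixes f :: "real \<Rightarrow> 'a" and L :: real
  assumes "\<And>x. f (x + L) = f x"
  shows "f (x + of_int n * L) = f x"
proof -
  have nat: "f (x + of_nat m * L) = f x" for m x
  proof (induction m)
    case (Suc m)
    have "x + of_nat (Suc m) * L = (x + of_nat m * L) + L"
      by (simp add: algebra_simps)
    then show ?case using Suc assms by metis
  qed simp
  show ?thesis
  proof (cases "n \<ge> 0")
    case True then show ?thesis using nat[of x "nat n"] by simp
  next
    case False then show ?thesis using nat[of "x + of_int n * L" "nat (- n)"] by simp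
  qed
qed

lemma jd_shift_int: "\<tau> \<noteq> 0 \<Longrightarrow> jd \<tau> (x + of_int n * (2 * pi / \<tau>)) = jd \<tau> x"
  by (rule periodic_shift_int[where f="jd \<tau>"]) (rule jd_periodic)

lemma jd_measurable [measurable]: "jd \<tau> \<in> borel_measurable borel"
proof -
  have "continuous_on UNIV (jd \<tau>)"
    unfolding jd_def[abs_def] jap_def d_tau_def
    by (cases "\<tau> = 0") (auto intro!: continuous_intros)
  then show ?thesis by (rule borel_measurable_continuous_onI)
qed

text \<open>Up to a unimodular factor \<open>d_tau\<close> is additive, so chord lengths on the
  circle obey a triangle inequality. This takes the place of the subadditivity of the absolute
  value.\<close>

lemma jd_le_add: "jd \<tau> x \<le> jd \<tau> (x - y) + jd \<tau> y"
proof (cases "\<tau> = 0")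
  \<comment> \<open>Division by zero makes \<open>d_tau 0\<close> vanish, and \<open>jd 0\<close> is
    constantly 1.\<close>
  case True
  then show ?thesis by (simp add: jd_def d_tau_def)
next
  case False
  have "d_tau \<tau> x = cis (\<tau> * y) * d_tau \<tau> (x - y) + d_tau \<tau> y"
    using False by (simp add: d_tau_def divide_simps algebra_simps cis_mult)
  then have "cmod (d_tau \<tau> x) \<le> cmod (d_tau \<tau> (x - y)) + cmod (d_tau \<tau> y)"
    using norm_triangle_ineq[of "cis (\<tau> * y) * d_tau \<tau> (x - y)" "d_tau \<tau> y"] by (simp add: norm_mult)
  then show ?thesis unfolding jd_def by (rule jap_add_le)
qed

text \<open>Half a period \<open>pi / \<tau>\<close> would be too short a range: the integers of the
  resonance sum fill an interval of half-length \<open>2 / \<tau>\<close>, which is added to it. The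
  total \<open>(pi + 2) / \<tau>\<close> is still less than a full period.\<close>

lemma jd_lower_bound:
  "\<exists>c>0. \<forall>\<tau> x. 0 < \<tau> \<and> \<bar>x\<bar> \<le> (pi + 2) / \<tau> \<longrightarrow> c * (1 + \<bar>x\<bar>) \<le> jd \<tau> x"
proof -
  obtain c0 where c0: "c0 > 0" "\<And>y. 0 \<le> y \<Longrightarrow> y \<le> 1 + pi / 2 \<Longrightarrow> c0 * y \<le> sin y"
    using sin_lower_bound by blast
  define c where "c = min c0 1 / 2"
  have "c * (1 + \<bar>x\<bar>) \<le> jd \<tau> x" if h: "0 < \<tau>" "\<bar>x\<bar> \<le> (pi + 2) / \<tau>" for \<tau> x
  proof -
    define y where "y = \<tau> * \<bar>x\<bar> / 2"
    have y: "0 \<le> y" "y \<le> 1 + pi / 2" using h by (auto simp: y_def field_simps)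
    have "c0 * y \<le> sin y" using c0(2)[OF y] .
    also have "sin y \<le> \<bar>sin (\<tau> * x / 2)\<bar>"
      by (cases "x \<ge> 0") (auto simp: y_def)
    finally have "c0 * y * 2 / \<tau> \<le> cmod (d_tau \<tau> x)"
      using h by (simp add: norm_d_tau field_simps)
    then have "c0 * \<bar>x\<bar> \<le> cmod (d_tau \<tau> x)" using h by (simp add: y_def)
    also have "\<dots> \<le> jd \<tau> x" unfolding jd_def by (rule norm_le_jap)
    finally have 1: "c0 * \<bar>x\<bar> \<le> jd \<tau> x" .
    have "min c0 1 * (1 + \<bar>x\<bar>) \<le> 1 + c0 * \<bar>x\<bar>"
    proof -
      have "min c0 1 * \<bar>x\<bar> \<le> c0 * \<bar>x\<bar>" by (intro mult_right_mono) auto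
      then show ?thesis by (simp add: distrib_left add_mono)
    qed
    also have "\<dots> \<le> 2 * jd \<tau> x" using 1 jd_ge_1[of \<tau> x] by linarith
    finally show ?thesis by (simp add: c_def)
  qed
  moreover have "c > 0" using c0 by (simp add: c_def)
  ultimately show ?thesis by blast
qed

text \<open>If the elements are listed by increasing \<open>f\<close>, the \<open>j\<close>-th one has \<open>f\<close> at least \<open>(j / C) powr (1 / a)\<close>.\<close>

lemma sum_powr_of_counting:
  fixes a p C :: real
  assumes a: "a > 0" "p > a" and C: "C > 0"
  shows "\<exists>C'>0. \<forall>(F::'a set) f. finite F \<longrightarrow> (\<forall>x\<in>F. f x \<ge> 1) \<longrightarrow>
    (\<forall>M\<ge>1. real (card {x\<in>F. f x \<le> M}) \<le> C * M powr a) \<longrightarrow> (\<Sum>x\<in>F. f x powr (- p)) \<le> C'"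
proof -
  define t where "t = p / a"
  have t: "t > 1" using a by (simp add: t_def)
  \<comment> \<open>The index 0 contributes nothing, as \<open>0 powr (- t)\<close> is 0.\<close>
  have sm: "summable (\<lambda>n. real n powr (- t))" using t by (simp add: summable_real_powr_iff)
  define Z where "Z = suminf (\<lambda>n. real n powr (- t))"
  have Z0: "Z \<ge> 0" unfolding Z_def by (intro suminf_nonneg sm) auto
  have ind: "(\<Sum>x\<in>F. f x powr (- p)) \<le> C powr t * (\<Sum>j<Suc n. real j powr (- t))"
    if "finite F" "card F = n" "\<forall>x\<in>F. f x \<ge> 1" "\<forall>M\<ge>1. real (card {x\<in>F. f x \<le> M}) \<le> C * M powr a"
    for F :: "'a set" and f n
    using that
  proof (induction n arbitrary: F)
    case 0
    then show ?case by simp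
  next
    case (Suc n)
    then have ne: "F \<noteq> {}" by auto
    have "Max (f ` F) \<in> f ` F" using Suc ne by (intro Max_in) auto
    then obtain x where x: "x \<in> F" "f x = Max (f ` F)" by auto
    have mx: "f y \<le> f x" if "y \<in> F" for y using that Suc x by simp
    have fx: "f x \<ge> 1" using Suc x by auto
    have IH: "(\<Sum>x\<in>F - {x}. f x powr (- p)) \<le> C powr t * (\<Sum>j<Suc n. real j powr (- t))"
    proof (rule Suc.IH)
      show "\<forall>M\<ge>1. real (card {y\<in>F - {x}. f y \<le> M}) \<le> C * M powr a"
      proof (intro allI impI)
        fix M :: real assume "1 \<le> M"
        have "card {y\<in>F - {x}. f y \<le> M} \<le> card {y\<in>F. f y \<le> M}"
          using Suc by (intro card_mono) auto
        then show "real (card {y\<in>F - {x}. f y \<le> M}) \<le> C * M powr a"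
          using Suc.prems(4) \<open>1 \<le> M\<close> by (meson of_nat_le_iff order_trans)
      qed
    qed (use Suc x in auto)
    \<comment> \<open>At \<open>M = f x\<close>, the maximum, the counting hypothesis counts all of
      \<open>F\<close>.\<close>
    have "{y\<in>F. f y \<le> f x} = F" using mx by auto
    then have "real (Suc n) \<le> C * f x powr a" using Suc.prems(2,4) fx by metis
    then have "real (Suc n) / C \<le> f x powr a" using C by (simp add: field_simps)
    then have "(f x powr a) powr (- t) \<le> (real (Suc n) / C) powr (- t)"
      using C t by (intro powr_mono2') auto
    also have "(f x powr a) powr (- t) = f x powr (- p)" using a by (simp add: powr_powr t_def)
    also have "(real (Suc n) / C) powr (- t) = C powr t * real (Suc n) powr (- t)"
      using C by (simp add: powr_divide powr_minus divide_simps)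
    finally have "f x powr (- p) \<le> C powr t * real (Suc n) powr (- t)" .
    moreover have "(\<Sum>y\<in>F. f y powr (- p)) = f x powr (- p) + (\<Sum>x\<in>F - {x}. f x powr (- p))"
      using Suc x by (simp add: sum.remove)
    ultimately show ?case using IH by (simp add: distrib_left)
  qed
  have "(\<Sum>x\<in>F. f x powr (- p)) \<le> C powr t * Z + 1"
    if "finite F" "\<forall>x\<in>F. f x \<ge> 1" "\<forall>M\<ge>1. real (card {x\<in>F. f x \<le> M}) \<le> C * M powr a"
    for F :: "'a set" and f
  proof -
    have "(\<Sum>x\<in>F. f x powr (- p)) \<le> C powr t * (\<Sum>j<Suc (card F). real j powr (- t))"
      using ind[OF that(1) refl that(2,3)] .
    also have "\<dots> \<le> C powr t * Z" unfolding Z_def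
      by (intro mult_left_mono sum_le_suminf sm) auto
    finally show ?thesis by simp
  qed
  moreover have "C powr t * Z + 1 > 0" using Z0 by (intro add_nonneg_pos) auto
  ultimately show ?thesis by blast
qed

section \<open>Sums over the lattice, over circles and over the integers\<close>

lemma abs_fst_le_jap: "\<bar>real_of_int (fst h)\<bar> \<le> jap (freq h)" "\<bar>real_of_int (snd h)\<bar> \<le> jap (freq h)"
proof -
  have "norm (fst (freq h)) \<le> norm (freq h)" "norm (snd (freq h)) \<le> norm (freq h)"
    using norm_fst_le[of "fst (freq h)" "snd (freq h)"] norm_snd_le[of "snd (freq h)" "fst (freq h)"] by simp_all
  then show "\<bar>real_of_int (fst h)\<bar> \<le> jap (freq h)" "\<bar>real_of_int (snd h)\<bar> \<le> jap (freq h)"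
    using norm_le_jap[of "freq h"] by (simp_all add: freq_def)
qed

lemma sum_jap_freq_powr_le:
  fixes p :: real
  assumes "p > 2"
  shows "\<exists>C>0. \<forall>F. finite F \<longrightarrow> (\<Sum>h\<in>F. jap (freq h) powr (- p)) \<le> C"
proof -
  have count: "real (card {h\<in>F. jap (freq h) \<le> M}) \<le> 9 * M powr 2"
    if "finite F" "M \<ge> 1" for F M
  proof -
    define N where "N = \<lfloor>M\<rfloor>"
    have N: "N \<ge> 1" "real_of_int N \<le> M" using that by (auto simp: N_def le_floor_iff)
    have "{h\<in>F. jap (freq h) \<le> M} \<subseteq> {-N..N} \<times> {-N..N}"
    proof
      fix h assume "h \<in> {h\<in>F. jap (freq h) \<le> M}"
      then have "\<bar>real_of_int (fst h)\<bar> \<le> M" "\<bar>real_of_int (snd h)\<bar> \<le> M"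
        using abs_fst_le_jap[of h] by auto
      then have "\<bar>fst h\<bar> \<le> N" "\<bar>snd h\<bar> \<le> N" unfolding N_def le_floor_iff by auto
      then show "h \<in> {-N..N} \<times> {-N..N}" by (cases h) auto
    qed
    then have "card {h\<in>F. jap (freq h) \<le> M} \<le> card ({-N..N} \<times> {-N..N})"
      by (intro card_mono) auto
    also have "\<dots> = nat (2 * N + 1) * nat (2 * N + 1)" by (simp add: card_cartesian_product)
    finally have "real (card {h\<in>F. jap (freq h) \<le> M}) \<le> real (nat (2 * N + 1) * nat (2 * N + 1))"
      by (simp only: of_nat_le_iff)
    also have "\<dots> = (2 * real_of_int N + 1) * (2 * real_of_int N + 1)" using N by simp
    also have "\<dots> \<le> (3 * M) * (3 * M)" using N that by (intro mult_mono) auto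
    also have "\<dots> = 9 * M powr 2" using that by (simp add: powr_numeral power2_eq_square)
    finally show ?thesis .
  qed
  obtain C' where C': "C' > 0" "\<And>(F::(int\<times>int) set) f. finite F \<Longrightarrow> (\<forall>x\<in>F. f x \<ge> 1) \<Longrightarrow>
    (\<forall>M\<ge>1. real (card {x\<in>F. f x \<le> M}) \<le> 9 * M powr 2) \<Longrightarrow> (\<Sum>x\<in>F. f x powr (- p)) \<le> C'"
    using sum_powr_of_counting[of 2 p 9, where 'a="int\<times>int"] assms by auto
  have "(\<Sum>h\<in>F. jap (freq h) powr (- p)) \<le> C'" if "finite F" for F
    by (rule C'(2)[OF that]) (use count[OF that] jap_ge_1 in auto)
  with C'(1) show ?thesis by auto
qed

text \<open>Counting with exponent \<open>p / 2\<close> leaves half of the decay for convergence.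
  The constant depends neither on the centre nor on the radius of the circle because the arc bound
  does not.\<close>

lemma sum_jap_freq_circle_le:
  fixes p :: real
  assumes p: "p > 0"
  shows "\<exists>C>0. \<forall>F k m. finite F \<longrightarrow> (\<forall>h\<in>F. nsq h + nsq (k - h) = m) \<longrightarrow>
    (\<Sum>h\<in>F. jap (freq h) powr (- p)) \<le> C"
proof -
  obtain C0 where C0: "C0 > 0" "\<And>M k m. M \<ge> 1 \<Longrightarrow>
      real (card {h. real_of_int (nsq h) \<le> M\<^sup>2 \<and> nsq h + nsq (k - h) = m}) \<le> C0 * M powr (p / 2)"
    using lattice_arc_bound[of "p / 2"] p by auto
  have count: "real (card {h\<in>F. jap (freq h) \<le> M}) \<le> C0 * M powr (p / 2)"
    if "finite F" "\<forall>h\<in>F. nsq h + nsq (k - h) = m" "M \<ge> 1" for F M k m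
  proof -
    have sub: "{h\<in>F. jap (freq h) \<le> M} \<subseteq> {h. real_of_int (nsq h) \<le> M\<^sup>2 \<and> nsq h + nsq (k - h) = m}"
    proof safe
      fix h assume "h \<in> F" "jap (freq h) \<le> M"
      then have "norm (freq h) \<le> M" using norm_le_jap[of "freq h"] by simp
      then have "(norm (freq h))\<^sup>2 \<le> M\<^sup>2" by (intro power_mono) auto
      then show "real_of_int (nsq h) \<le> M\<^sup>2" by (simp add: norm_freq_sq)
    qed (use that in auto)
    have fin: "finite {h. real_of_int (nsq h) \<le> M\<^sup>2 \<and> nsq h + nsq (k - h) = m}"
      by (rule finite_subset[OF _ finite_nsq_le[of "\<lfloor>M\<^sup>2\<rfloor>"]]) (auto simp: le_floor_iff)
    have "real (card {h\<in>F. jap (freq h) \<le> M})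
        \<le> real (card {h. real_of_int (nsq h) \<le> M\<^sup>2 \<and> nsq h + nsq (k - h) = m})"
      using card_mono[OF fin sub] by simp
    also have "\<dots> \<le> C0 * M powr (p / 2)" using C0(2)[OF that(3)] .
    finally show ?thesis .
  qed
  obtain C' where C': "C' > 0" "\<And>(F::(int\<times>int) set) f. finite F \<Longrightarrow> (\<forall>x\<in>F. f x \<ge> 1) \<Longrightarrow>
    (\<forall>M\<ge>1. real (card {x\<in>F. f x \<le> M}) \<le> C0 * M powr (p / 2)) \<Longrightarrow> (\<Sum>x\<in>F. f x powr (- p)) \<le> C'"
    using sum_powr_of_counting[of "p / 2" p C0, where 'a="int\<times>int"] p C0 by auto
  have "(\<Sum>h\<in>F. jap (freq h) powr (- p)) \<le> C'"
    if "finite F" "\<forall>h\<in>F. nsq h + nsq (k - h) = m" for F k m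
    by (rule C'(2)[OF that(1)]) (use count[OF that] jap_ge_1 in auto)
  with C'(1) show ?thesis by (intro exI[of _ C']) auto
qed

lemma sum_int_shift_powr_le:
  fixes p :: real
  assumes "p > 1"
  shows "\<exists>C>0. \<forall>F \<sigma>. finite F \<longrightarrow> (\<Sum>m\<in>F. (1 + \<bar>\<sigma> - real_of_int m\<bar>) powr (- p)) \<le> C"
proof -
  have count: "real (card {m\<in>F. 1 + \<bar>\<sigma> - real_of_int m\<bar> \<le> M}) \<le> 2 * M powr 1"
    if "finite F" "M \<ge> 1" for F M \<sigma>
  proof -
    have "{m\<in>F. 1 + \<bar>\<sigma> - real_of_int m\<bar> \<le> M} \<subseteq> {\<lceil>\<sigma> - (M - 1)\<rceil>..\<lfloor>\<sigma> + (M - 1)\<rfloor>}"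
      by (auto simp: ceiling_le_iff le_floor_iff)
    then have "card {m\<in>F. 1 + \<bar>\<sigma> - real_of_int m\<bar> \<le> M} \<le> card {\<lceil>\<sigma> - (M - 1)\<rceil>..\<lfloor>\<sigma> + (M - 1)\<rfloor>}"
      by (intro card_mono) auto
    also have "real \<dots> \<le> 2 * M" using that by simp linarith
    finally show ?thesis using that by simp
  qed
  obtain C' where C': "C' > 0" "\<And>(F::int set) f. finite F \<Longrightarrow> (\<forall>x\<in>F. f x \<ge> 1) \<Longrightarrow>
    (\<forall>M\<ge>1. real (card {x\<in>F. f x \<le> M}) \<le> 2 * M powr 1) \<Longrightarrow> (\<Sum>x\<in>F. f x powr (- p)) \<le> C'"
    using sum_powr_of_counting[of 1 p 2, where 'a="int"] assms by auto
  have "(\<Sum>m\<in>F. (1 + \<bar>\<sigma> - real_of_int m\<bar>) powr (- p)) \<le> C'" if "finite F" for F \<sigma>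
    by (rule C'(2)[OF that]) (use count[OF that] in auto)
  with C'(1) show ?thesis by (intro exI[of _ C']) auto
qed

text \<open>The integers \<open>m = nsq h + nsq (k - h)\<close> lie in \<open>[0, 4 / \<tau>]\<close>, which is shorter than the period \<open>2 pi / \<tau>\<close>
  of \<open>jd \<tau>\<close>: after a shift of \<open>A\<close> by a period, \<open>jd \<tau> (A - m)\<close> is comparable to \<open>1 + \<bar>A - m\<bar>\<close>. Young's
  inequality separates a summable power of the spatial weight from the terms in which each value
  of \<open>m\<close> is attained only boundedly often, up to an arbitrarily small power of the weight.\<close>

lemma resonance_sum_bound:
  fixes s \<gamma> :: real
  assumes s: "s > 0" and g: "\<gamma> > 0" and sg: "\<gamma> + s > 1"
  shows "\<exists>C>0. \<forall>\<tau> A k F. 0 < \<tau> \<longrightarrow> finite F \<longrightarrow>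
    (\<forall>h\<in>F. real_of_int (nsq h) \<le> 2 / \<tau> \<and> real_of_int (nsq (k - h)) \<le> 2 / \<tau>) \<longrightarrow>
    (\<Sum>h\<in>F. jap (freq h) powr (- 2 * s) * jd \<tau> (A - real_of_int (nsq h + nsq (k - h))) powr (- \<gamma>)) \<le> C"
proof -
  \<comment> \<open>\<open>t\<close> lies strictly between \<open>max 0 (1 - s)\<close> and
    \<open>min 1 \<gamma>\<close>, an interval that \<open>\<gamma> + s > 1\<close> makes nonempty.
    The conjugate exponents \<open>p\<close> and \<open>q\<close> then satisfy
    \<open>s * p > 1\<close> and \<open>\<gamma> * q > 1\<close>.\<close>
  define t where "t = (max 0 (1 - s) + min 1 \<gamma>) / 2"
  have t: "0 < t" "t < 1" "1 - s < t" "t < \<gamma>" using s g sg by (auto simp: t_def)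
  define q where "q = 1 / t"
  define p where "p = 1 / (1 - t)"
  have pq: "p > 1" "q > 1" "1 / p + 1 / q = 1" using t by (auto simp: p_def q_def field_simps)
  have sp: "s * p > 1" using t by (simp add: p_def field_simps)
  have gq: "\<gamma> * q > 1" using t by (simp add: q_def field_simps)
  \<comment> \<open>The part of the spatial weight kept out of Young's inequality. It is chosen to
    give the purely spatial term the exponent \<open>s * p + 1 > 2\<close>, summable over the
    lattice, while \<open>e > 0\<close> suffices for the sum over one circle.\<close>
  define e where "e = (s * p - 1) / (p - 1)"
  have e: "e > 0" using sp pq by (simp add: e_def)
  have "e * (p - 1) = s * p - 1" using pq by (simp add: e_def)
  then have ee: "e + (2 * s - e) * p = s * p + 1" by (simp add: algebra_simps)
  obtain C1 where C1: "C1 > 0" "\<And>F. finite F \<Longrightarrow> (\<Sum>h\<in>F. jap (freq h) powr (- (s * p + 1))) \<le> C1"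
    using sum_jap_freq_powr_le[of "s * p + 1"] sp by auto
  obtain C2 where C2: "C2 > 0" "\<And>F k m. finite F \<Longrightarrow> (\<forall>h\<in>F. nsq h + nsq (k - h) = m) \<Longrightarrow>
      (\<Sum>h\<in>F. jap (freq h) powr (- e)) \<le> C2"
    using sum_jap_freq_circle_le[OF e] by metis
  obtain C3 where C3: "C3 > 0" "\<And>F \<sigma>. finite F \<Longrightarrow> (\<Sum>m\<in>F. (1 + \<bar>\<sigma> - real_of_int m\<bar>) powr (- (\<gamma> * q))) \<le> C3"
    using sum_int_shift_powr_le[OF gq] by metis
  obtain c where c: "c > 0" "\<And>\<tau> x. 0 < \<tau> \<Longrightarrow> \<bar>x\<bar> \<le> (pi + 2) / \<tau> \<Longrightarrow> c * (1 + \<bar>x\<bar>) \<le> jd \<tau> x"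
    using jd_lower_bound by metis
  define C where "C = C1 + C2 * (c powr (- (\<gamma> * q)) * C3)"
  have "(\<Sum>h\<in>F. jap (freq h) powr (- 2 * s) * jd \<tau> (A - real_of_int (nsq h + nsq (k - h))) powr (- \<gamma>)) \<le> C"
    if tau: "0 < \<tau>" and F: "finite F"
      and Fb: "\<And>h. h \<in> F \<Longrightarrow> real_of_int (nsq h) \<le> 2 / \<tau> \<and> real_of_int (nsq (k - h)) \<le> 2 / \<tau>"
    for \<tau> A k F
  proof -
    define B where "B = (\<lambda>h. nsq h + nsq (k - h))"
    define J where "J = (\<lambda>h. jap (freq h))"
    define Y where "Y = (\<lambda>m. jd \<tau> (A - real_of_int m))"
    have J: "J h > 0" for h by (simp add: J_def)
    have Y: "Y m > 0" for m by (simp add: Y_def)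
    have dv: "x / r \<le> x" if "r > 1" "x \<ge> 0" for x r :: real using that frac_le[of x x 1 r] by simp
    have young: "J h powr (- 2 * s) * Y m powr (- \<gamma>)
        \<le> J h powr (- (s * p + 1)) + J h powr (- e) * Y m powr (- (\<gamma> * q))" for h m
    proof -
      have "J h powr (- (2 * s - e)) * Y m powr (- \<gamma>)
          \<le> (J h powr (- (2 * s - e))) powr p / p + (Y m powr (- \<gamma>)) powr q / q"
        using pq by (intro Youngs_inequality) auto
      also have "\<dots> \<le> (J h powr (- (2 * s - e))) powr p + (Y m powr (- \<gamma>)) powr q"
        using pq by (intro add_mono dv) auto
      also have "\<dots> = J h powr (- ((2 * s - e) * p)) + Y m powr (- (\<gamma> * q))"
        by (simp only: powr_powr mult_minus_left)
      finally have "J h powr (- e) * (J h powr (- (2 * s - e)) * Y m powr (- \<gamma>))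
          \<le> J h powr (- e) * (J h powr (- ((2 * s - e) * p)) + Y m powr (- (\<gamma> * q)))"
        by (intro mult_left_mono) auto
      moreover have "J h powr (- e) * J h powr (- (2 * s - e)) = J h powr (- 2 * s)"
        by (simp add: powr_add[symmetric])
      moreover have "J h powr (- e) * J h powr (- ((2 * s - e) * p)) = J h powr (- (s * p + 1))"
        unfolding ee[symmetric] by (simp add: powr_add[symmetric])
      ultimately show ?thesis by (simp add: distrib_left mult.assoc[symmetric])
    qed
    have sum1: "(\<Sum>h\<in>F. J h powr (- (s * p + 1))) \<le> C1" using C1(2)[OF F] by (simp add: J_def)
    \<comment> \<open>\<open>A'\<close> is a representative of \<open>A\<close> modulo the period
      within half a period of \<open>2 / \<tau>\<close>, the midpoint of the range of the integers
      \<open>m\<close>. Hence \<open>A' - m\<close> stays in the range of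
      \<open>jd_lower_bound\<close>.\<close>
    define n where "n = - \<lfloor>(A - 2 / \<tau>) / (2 * pi / \<tau>) + 1 / 2\<rfloor>"
    define A' where "A' = A + real_of_int n * (2 * pi / \<tau>)"
    have A': "\<bar>A' - 2 / \<tau>\<bar> \<le> pi / \<tau>"
    proof -
      define L where "L = 2 * pi / \<tau>"
      have L: "L > 0" using tau by (simp add: L_def)
      define y where "y = (A - 2 / \<tau>) / L"
      have "\<bar>y + real_of_int n\<bar> \<le> 1 / 2"
        unfolding n_def L_def[symmetric] y_def[symmetric] by linarith
      then have "L * \<bar>y + real_of_int n\<bar> \<le> L * (1 / 2)" using L by (intro mult_left_mono) auto
      also have "L * \<bar>y + real_of_int n\<bar> = \<bar>L * (y + real_of_int n)\<bar>" using L by (simp add: abs_mult)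
      also have "L * (y + real_of_int n) = A' - 2 / \<tau>"
        unfolding A'_def L_def[symmetric] using L by (simp add: y_def distrib_left mult.commute)
      finally show ?thesis by (simp add: L_def)
    qed
    have Ym: "Y m powr (- (\<gamma> * q)) \<le> c powr (- (\<gamma> * q)) * (1 + \<bar>A' - real_of_int m\<bar>) powr (- (\<gamma> * q))"
      if mB: "m \<in> B ` F" for m
    proof -
      obtain h where h: "h \<in> F" "m = B h" using mB by blast
      have "real_of_int m = real_of_int (nsq h) + real_of_int (nsq (k - h))" by (simp add: h B_def)
      then have "0 \<le> real_of_int m" "real_of_int m \<le> 4 / \<tau>" using Fb[OF h(1)] by auto
      then have "\<bar>A' - real_of_int m\<bar> \<le> pi / \<tau> + 2 / \<tau>" using A' by (simp add: abs_le_iff)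
      then have "\<bar>A' - real_of_int m\<bar> \<le> (pi + 2) / \<tau>" by (simp add: add_divide_distrib)
      then have "c * (1 + \<bar>A' - real_of_int m\<bar>) \<le> jd \<tau> (A' - real_of_int m)" using c tau by blast
      also have "jd \<tau> (A' - real_of_int m) = Y m"
        using jd_shift_int[of \<tau> "A - real_of_int m" n] tau by (simp add: A'_def Y_def algebra_simps)
      finally have cY: "c * (1 + \<bar>A' - real_of_int m\<bar>) \<le> Y m" .
      have "Y m powr (- (\<gamma> * q)) \<le> (c * (1 + \<bar>A' - real_of_int m\<bar>)) powr (- (\<gamma> * q))"
        using c(1) gq cY by (intro powr_mono2' mult_pos_pos) auto
      then show ?thesis using c(1) by (simp add: powr_mult)
    qed
    have "(\<Sum>h\<in>F. J h powr (- e) * Y (B h) powr (- (\<gamma> * q)))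
        = (\<Sum>m\<in>B ` F. \<Sum>h\<in>{h\<in>F. B h = m}. J h powr (- e) * Y (B h) powr (- (\<gamma> * q)))"
      by (rule sum.image_gen[OF F])
    also have "\<dots> = (\<Sum>m\<in>B ` F. Y m powr (- (\<gamma> * q)) * (\<Sum>h\<in>{h\<in>F. B h = m}. J h powr (- e)))"
      unfolding sum_distrib_left by (intro sum.cong refl) (auto simp: mult.commute)
    also have "\<dots> \<le> (\<Sum>m\<in>B ` F. c powr (- (\<gamma> * q)) * (1 + \<bar>A' - real_of_int m\<bar>) powr (- (\<gamma> * q)) * C2)"
    proof (intro sum_mono mult_mono Ym)
      fix m
      show "(\<Sum>h\<in>{h\<in>F. B h = m}. J h powr (- e)) \<le> C2"
        unfolding J_def by (rule C2(2)[where k=k and m=m]) (use F in \<open>auto simp: B_def\<close>)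
    qed (auto intro!: sum_nonneg)
    also have "\<dots> = C2 * (c powr (- (\<gamma> * q)) * (\<Sum>m\<in>B ` F. (1 + \<bar>A' - real_of_int m\<bar>) powr (- (\<gamma> * q))))"
      by (simp add: sum_distrib_left mult_ac)
    also have "\<dots> \<le> C2 * (c powr (- (\<gamma> * q)) * C3)"
      using C2(1) F by (intro mult_left_mono C3(2)) auto
    finally have sum2: "(\<Sum>h\<in>F. J h powr (- e) * Y (B h) powr (- (\<gamma> * q))) \<le> C2 * (c powr (- (\<gamma> * q)) * C3)" .
    have "(\<Sum>h\<in>F. J h powr (- 2 * s) * Y (B h) powr (- \<gamma>))
        \<le> (\<Sum>h\<in>F. J h powr (- (s * p + 1)) + J h powr (- e) * Y (B h) powr (- (\<gamma> * q)))"
      by (intro sum_mono young)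
    also have "\<dots> \<le> C" using sum1 sum2 by (simp add: sum.distrib C_def)
    finally show ?thesis by (simp add: J_def Y_def B_def)
  qed
  moreover have "C > 0" unfolding C_def using C1 C2 C3 by (intro add_pos_nonneg) auto
  ultimately show ?thesis by (intro exI[of _ C]) blast
qed

lemma nn_integral_powr_finite:
  fixes p :: real
  assumes p: "p > 1"
  shows "\<exists>C>0. (\<integral>\<^sup>+x. ennreal ((1 + \<bar>x\<bar>) powr (- p)) \<partial>lborel) \<le> ennreal C"
proof -
  define f where "f = (\<lambda>x::real. ennreal ((1 + \<bar>x\<bar>) powr (- p)))"
  define I where "I = (\<integral>\<^sup>+x. f x * indicator {0..} x \<partial>lborel)"
  have "I = ennreal (0 - (1 + 0) powr (1 - p) / (1 - p))"
  proof -
    have "(\<integral>\<^sup>+x. ennreal ((1 + x) powr (- p)) * indicator {0..} x \<partial>lborel)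
        = ennreal (0 - (1 + 0) powr (1 - p) / (1 - p))"
    proof (rule nn_integral_FTC_atLeast)
      fix x :: real assume "0 \<le> x"
      then show "((\<lambda>x. (1 + x) powr (1 - p) / (1 - p)) has_real_derivative (1 + x) powr (- p)) (at x)"
        using p by (auto intro!: derivative_eq_intros)
      show "0 \<le> (1 + x) powr (- p)" by simp
    next
      have "((\<lambda>x. (1 + x) powr (1 - p)) \<longlongrightarrow> 0) at_top"
        using p by (intro tendsto_neg_powr filterlim_tendsto_add_at_top[OF tendsto_const] filterlim_ident) auto
      then show "((\<lambda>x. (1 + x) powr (1 - p) / (1 - p)) \<longlongrightarrow> 0) at_top"
        by (rule tendsto_divide_zero)
    qed simp
    also have "(\<integral>\<^sup>+x. ennreal ((1 + x) powr (- p)) * indicator {0..} x \<partial>lborel) = I"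
      unfolding I_def f_def by (intro nn_integral_cong) (auto simp: indicator_def)
    finally show ?thesis .
  qed
  then have I: "I = ennreal (1 / (p - 1))" using p by (simp add: divide_simps)
  have fm [measurable]: "f \<in> borel_measurable borel" unfolding f_def by measurable
  have "(\<integral>\<^sup>+x. f x \<partial>lborel) \<le> (\<integral>\<^sup>+x. f x * indicator {0..} x + f x * indicator {..0} x \<partial>lborel)"
    by (intro nn_integral_mono) (auto simp: indicator_def)
  also have "\<dots> = I + (\<integral>\<^sup>+x. f x * indicator {..0} x \<partial>lborel)"
    unfolding I_def by (intro nn_integral_add) auto
  also have "(\<integral>\<^sup>+x. f x * indicator {..0} x \<partial>lborel) = I"
    unfolding I_def by (subst nn_integral_real_affine[where c="-1" and t=0])
      (auto simp: f_def indicator_def intro!: nn_integral_cong)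
  also have "I + I = ennreal (2 / (p - 1))" using p unfolding I by (simp add: ennreal_plus[symmetric] del: ennreal_plus)
  finally show ?thesis using p unfolding f_def by (intro exI[of _ "2 / (p - 1)"]) auto
qed


subsection \<open>Convolutions on frequency space\<close>

text \<open>A density on the whole line instead of a restricted space: functions of \<sigma> stay
  total, and translating or reflecting their argument raises no domain conditions.\<close>

definition cellM :: "real \<Rightarrow> real measure" where
  "cellM \<tau> = density lborel (indicator (time_cell \<tau>))"

lemma sets_cellM [measurable_cong, simp]: "sets (cellM \<tau>) = sets borel"
  by (simp add: cellM_def)

lemma space_cellM [simp]: "space (cellM \<tau>) = UNIV"
  by (simp add: cellM_def)

lemma time_cell_measurable [measurable]: "time_cell \<tau> \<in> sets borel"
  by (simp add: time_cell_def)

lemma nn_integral_cellM: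
  "f \<in> borel_measurable borel \<Longrightarrow> (\<integral>\<^sup>+x. f x \<partial>cellM \<tau>) = (\<integral>\<^sup>+x. f x * indicator (time_cell \<tau>) x \<partial>lborel)"
  unfolding cellM_def by (subst nn_integral_density) (auto simp: mult.commute)

lemma emeasure_cellM: "\<tau> > 0 \<Longrightarrow> emeasure (cellM \<tau>) UNIV = ennreal (2 * pi / \<tau>)"
  unfolding cellM_def
  by (subst emeasure_density) (auto simp: time_cell_def divide_le_eq)

lemma finite_measure_cellM: "finite_measure (cellM \<tau>)"
proof
  show "emeasure (cellM \<tau>) (space (cellM \<tau>)) \<noteq> \<infinity>"
    using emeasure_bounded_finite[of "time_cell \<tau>"] unfolding cellM_def
    by (subst emeasure_density) (auto simp: time_cell_def)
qed

lemma sigma_finite_cellM: "sigma_finite_measure (cellM \<tau>)"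
  using finite_measure_cellM by (rule finite_measure.axioms)

lemma nn_integral_period:
  fixes f :: "real \<Rightarrow> ennreal"
  assumes [measurable]: "f \<in> borel_measurable borel" and per: "\<And>x. f (x + L) = f x" and L: "L > 0"
  shows "(\<integral>\<^sup>+x. f x * indicator {a..<a + L} x \<partial>lborel) = (\<integral>\<^sup>+x. f x * indicator {0..<L} x \<partial>lborel)"
proof -
  define n where "n = \<lfloor>a / L\<rfloor>"
  define r where "r = a - of_int n * L"
  have r: "0 \<le> r" "r < L"
    using floor_divide_lower[OF L, of a] floor_divide_upper[OF L, of a]
    by (auto simp: r_def n_def algebra_simps)
  have "(\<integral>\<^sup>+x. f x * indicator {a..<a + L} x \<partial>lborel)
      = (\<integral>\<^sup>+x. f (of_int n * L + 1 * x) * indicator {a..<a + L} (of_int n * L + 1 * x) \<partial>lborel)"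
    by (subst nn_integral_real_affine[where c=1 and t="of_int n * L"]) auto
  also have "\<dots> = (\<integral>\<^sup>+x. f x * indicator {r..<L} x + f x * indicator {L..<r + L} x \<partial>lborel)"
  proof (intro nn_integral_cong)
    fix x
    have "f (of_int n * L + 1 * x) = f x" using periodic_shift_int[of f L x n, OF per] by (simp add: add.commute)
    moreover have "indicator {a..<a + L} (of_int n * L + 1 * x)
        = (indicator {r..<L} x + indicator {L..<r + L} x :: ennreal)"
      using r by (auto simp: indicator_def r_def algebra_simps)
    ultimately show "f (of_int n * L + 1 * x) * indicator {a..<a + L} (of_int n * L + 1 * x)
        = f x * indicator {r..<L} x + f x * indicator {L..<r + L} x" by (simp add: distrib_left)
  qed
  also have "\<dots> = (\<integral>\<^sup>+x. f x * indicator {r..<L} x \<partial>lborel) + (\<integral>\<^sup>+x. f x * indicator {L..<r + L} x \<partial>lborel)"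
    by (intro nn_integral_add) auto
  also have "(\<integral>\<^sup>+x. f x * indicator {L..<r + L} x \<partial>lborel)
      = (\<integral>\<^sup>+x. f (L + 1 * x) * indicator {L..<r + L} (L + 1 * x) \<partial>lborel)"
    by (subst nn_integral_real_affine[where c=1 and t=L]) auto
  also have "\<dots> = (\<integral>\<^sup>+x. f x * indicator {0..<r} x \<partial>lborel)"
    using per by (intro nn_integral_cong) (auto simp: indicator_def add.commute)
  also have "(\<integral>\<^sup>+x. f x * indicator {r..<L} x \<partial>lborel) + (\<integral>\<^sup>+x. f x * indicator {0..<r} x \<partial>lborel)
      = (\<integral>\<^sup>+x. f x * indicator {r..<L} x + f x * indicator {0..<r} x \<partial>lborel)"
    by (intro nn_integral_add[symmetric]) auto
  also have "\<dots> = (\<integral>\<^sup>+x. f x * indicator {0..<L} x \<partial>lborel)"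
    using r by (intro nn_integral_cong) (auto simp: indicator_def)
  finally show ?thesis .
qed

text \<open>Haar invariance on the circle of length \<open>2 * pi / \<tau>\<close>: a periodic
  function has the same integral over every interval of one period.\<close>

lemma nn_integral_cellM_shift:
  fixes f :: "real \<Rightarrow> ennreal"
  assumes [measurable]: "f \<in> borel_measurable borel" and per: "\<And>x. f (x + 2 * pi / \<tau>) = f x" and tau: "\<tau> > 0"
  shows "(\<integral>\<^sup>+x. f (x + c) \<partial>cellM \<tau>) = (\<integral>\<^sup>+x. f x \<partial>cellM \<tau>)"
proof -
  define L where "L = 2 * pi / \<tau>"
  have L: "L > 0" using tau by (simp add: L_def)
  have cell: "time_cell \<tau> = {- L / 2<..<L / 2}" by (simp add: time_cell_def L_def)
  have gen: "(\<integral>\<^sup>+x. f (x + c) \<partial>cellM \<tau>) = (\<integral>\<^sup>+x. f x * indicator {0..<L} x \<partial>lborel)" for c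
  proof -
    have "(\<integral>\<^sup>+x. f (x + c) \<partial>cellM \<tau>) = (\<integral>\<^sup>+x. f (x + c) * indicator (time_cell \<tau>) x \<partial>lborel)"
      by (rule nn_integral_cellM) measurable
    also have "\<dots> = (\<integral>\<^sup>+x. f (x + c) * indicator {- L / 2..<L / 2} x \<partial>lborel)"
    proof (rule nn_integral_cong_AE)
      \<comment> \<open>The cell is open; the half-open interval has one more point, a null
        set.\<close>
      have "AE x in lborel. x \<noteq> - L / 2" by (rule AE_lborel_singleton)
      then show "AE x in lborel. f (x + c) * indicator (time_cell \<tau>) x = f (x + c) * indicator {- L / 2..<L / 2} x"
        by eventually_elim (auto simp: cell indicator_def)
    qed
    also have "\<dots> = (\<integral>\<^sup>+x. f (- c + 1 * x + c) * indicator {- L / 2..<L / 2} (- c + 1 * x) \<partial>lborel)"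
      by (subst nn_integral_real_affine[where c=1 and t="- c"]) auto
    also have "\<dots> = (\<integral>\<^sup>+x. f x * indicator {c - L / 2..<(c - L / 2) + L} x \<partial>lborel)"
      by (intro nn_integral_cong) (auto simp: indicator_def)
    also have "\<dots> = (\<integral>\<^sup>+x. f x * indicator {0..<L} x \<partial>lborel)"
      by (rule nn_integral_period) (use per L in \<open>auto simp: L_def\<close>)
    finally show ?thesis .
  qed
  show ?thesis using gen[of c] gen[of 0] by simp
qed

lemma nn_integral_cellM_minus:
  fixes f :: "real \<Rightarrow> ennreal"
  assumes [measurable]: "f \<in> borel_measurable borel"
  shows "(\<integral>\<^sup>+x. f (- x) \<partial>cellM \<tau>) = (\<integral>\<^sup>+x. f x \<partial>cellM \<tau>)"
proof -
  have "(\<integral>\<^sup>+x. f x \<partial>cellM \<tau>) = (\<integral>\<^sup>+x. f x * indicator (time_cell \<tau>) x \<partial>lborel)"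
    by (rule nn_integral_cellM) measurable
  also have "\<dots> = (\<integral>\<^sup>+x. f (0 + - 1 * x) * indicator (time_cell \<tau>) (0 + - 1 * x) \<partial>lborel)"
    by (subst nn_integral_real_affine[where c="- 1" and t=0]) auto
  also have "\<dots> = (\<integral>\<^sup>+x. f (- x) * indicator (time_cell \<tau>) x \<partial>lborel)"
    by (intro nn_integral_cong) (auto simp: indicator_def time_cell_def)
  also have "\<dots> = (\<integral>\<^sup>+x. f (- x) \<partial>cellM \<tau>)"
    by (rule nn_integral_cellM[symmetric]) measurable
  finally show ?thesis by simp
qed

section \<open>Frequency space, its measure and its translations\<close>

type_synonym freq_space = "(int \<times> int) \<times> real"

definition Gam :: "freq_space measure" where
  "Gam = count_space UNIV \<Otimes>\<^sub>M borel"

text \<open>The Haar measure of the group of integer vectors times a circle of length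
  \<open>2 * pi / \<tau>\<close>. Points of the circle are represented by reals, so invariance under
  translations holds for functions with \<open>periodic2\<close>; \<open>Gam\<close> only supplies
  the measurable sets.\<close>

definition FM :: "real \<Rightarrow> freq_space measure" where
  "FM \<tau> = count_space UNIV \<Otimes>\<^sub>M cellM \<tau>"

lemma sets_FM [measurable_cong, simp]: "sets (FM \<tau>) = sets Gam"
  unfolding FM_def Gam_def by (intro sets_pair_measure_cong) auto

lemma space_Gam [simp]: "space Gam = UNIV"
  by (simp add: Gam_def space_pair_measure)

lemma space_FM [simp]: "space (FM \<tau>) = UNIV"
  by (simp add: FM_def space_pair_measure)

lemma sigma_finite_FM: "sigma_finite_measure (FM \<tau>)"
proof -
  interpret C: sigma_finite_measure "count_space (UNIV :: (int \<times> int) set)"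
    by (rule sigma_finite_measure_count_space_countable) simp
  interpret T: sigma_finite_measure "cellM \<tau>" by (rule sigma_finite_cellM)
  interpret P: pair_sigma_finite "count_space (UNIV :: (int \<times> int) set)" "cellM \<tau>" ..
  show ?thesis unfolding FM_def by (rule P.sigma_finite_measure_axioms)
qed

lemma measurable_Gam_iff_fst_snd:
  assumes "(\<lambda>x. fst (f x)) \<in> measurable M (count_space UNIV)" "(\<lambda>x. snd (f x)) \<in> borel_measurable M"
  shows "f \<in> measurable M Gam"
  unfolding Gam_def by (rule measurable_pair) (use assms in \<open>auto simp: comp_def\<close>)

lemma measurable_fst_Gam [measurable]:
  "f \<in> measurable M Gam \<Longrightarrow> (\<lambda>x. fst (f x)) \<in> measurable M (count_space UNIV)"
  unfolding Gam_def by (rule measurable_fst')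

lemma measurable_snd_Gam [measurable]:
  "f \<in> measurable M Gam \<Longrightarrow> (\<lambda>x. snd (f x)) \<in> borel_measurable M"
  unfolding Gam_def by (rule measurable_snd')

lemma measurable_count_space_binary:
  fixes h :: "'a::countable \<Rightarrow> 'b::countable \<Rightarrow> 'c"
  assumes "f \<in> measurable M (count_space UNIV)" "g \<in> measurable M (count_space UNIV)"
  shows "(\<lambda>x. h (f x) (g x)) \<in> measurable M (count_space UNIV)"
proof -
  have "(\<lambda>x. (f x, g x)) \<in> measurable M (count_space UNIV \<Otimes>\<^sub>M count_space UNIV)"
    by (rule measurable_Pair[OF assms])
  then have "(\<lambda>x. (f x, g x)) \<in> measurable M (count_space (UNIV \<times> UNIV))"
    by (simp add: pair_measure_countable)
  then have "(\<lambda>x. case (f x, g x) of (a, b) \<Rightarrow> h a b) \<in> measurable M (count_space UNIV)"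
    by (rule measurable_compose) auto
  then show ?thesis by simp
qed

lemma measurable_add_Gam [measurable]:
  assumes [measurable]: "f \<in> measurable M Gam" "g \<in> measurable M Gam"
  shows "(\<lambda>x. f x + g x) \<in> measurable M Gam"
proof (rule measurable_Gam_iff_fst_snd)
  show "(\<lambda>x. fst (f x + g x)) \<in> measurable M (count_space UNIV)"
    unfolding fst_add
    by (rule measurable_count_space_binary[where h="(+)" and f="\<lambda>x. fst (f x)" and g="\<lambda>x. fst (g x)"]) measurable
  show "(\<lambda>x. snd (f x + g x)) \<in> borel_measurable M"
    unfolding snd_add by measurable
qed

lemma measurable_diff_Gam [measurable]:
  assumes [measurable]: "f \<in> measurable M Gam" "g \<in> measurable M Gam"
  shows "(\<lambda>x. f x - g x) \<in> measurable M Gam"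
proof (rule measurable_Gam_iff_fst_snd)
  show "(\<lambda>x. fst (f x - g x)) \<in> measurable M (count_space UNIV)"
    unfolding fst_diff
    by (rule measurable_count_space_binary[where h="(-)" and f="\<lambda>x. fst (f x)" and g="\<lambda>x. fst (g x)"]) measurable
  show "(\<lambda>x. snd (f x - g x)) \<in> borel_measurable M"
    unfolding snd_diff by measurable
qed

lemma measurable_section_Gam:
  assumes "F \<in> borel_measurable Gam"
  shows "(\<lambda>\<sigma>. F (k, \<sigma>)) \<in> borel_measurable borel"
proof -
  have "(\<lambda>\<sigma>::real. (k, \<sigma>)) \<in> measurable borel Gam" unfolding Gam_def by measurable
  then show ?thesis using assms by (rule measurable_compose)
qed

lemma borel_measurable_Gam_iff:
  "(\<And>k. (\<lambda>\<sigma>. F (k, \<sigma>)) \<in> borel_measurable borel) \<Longrightarrow> F \<in> borel_measurable Gam"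
  unfolding Gam_def by (rule measurable_pair_measure_countable1) auto

lemma nn_integral_FM:
  assumes "F \<in> borel_measurable Gam"
  shows "(\<integral>\<^sup>+p. F p \<partial>FM \<tau>) = (\<integral>\<^sup>+k. (\<integral>\<^sup>+\<sigma>. F (k, \<sigma>) \<partial>cellM \<tau>) \<partial>count_space UNIV)"
proof -
  have "F \<in> borel_measurable (FM \<tau>)" using assms by simp
  then show ?thesis
    unfolding FM_def by (rule sigma_finite_measure.nn_integral_fst[OF sigma_finite_cellM, symmetric])
qed

definition periodic2 :: "real \<Rightarrow> (freq_space \<Rightarrow> 'a) \<Rightarrow> bool" where
  "periodic2 \<tau> F \<longleftrightarrow> (\<forall>k \<sigma>. F (k, \<sigma> + 2 * pi / \<tau>) = F (k, \<sigma>))"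

lemma periodic2D: "periodic2 \<tau> F \<Longrightarrow> F (k, \<sigma> + 2 * pi / \<tau>) = F (k, \<sigma>)"
  unfolding periodic2_def by blast

lemma periodic2I: "(\<And>k \<sigma>. F (k, \<sigma> + 2 * pi / \<tau>) = F (k, \<sigma>)) \<Longrightarrow> periodic2 \<tau> F"
  unfolding periodic2_def by blast

lemma nn_integral_FM_shift:
  fixes F :: "freq_space \<Rightarrow> ennreal"
  assumes F [measurable]: "F \<in> borel_measurable Gam" and per: "periodic2 \<tau> F" and tau: "\<tau> > 0"
  shows "(\<integral>\<^sup>+p. F (p + t) \<partial>FM \<tau>) = (\<integral>\<^sup>+p. F p \<partial>FM \<tau>)"
proof -
  have "(\<integral>\<^sup>+p. F (p + t) \<partial>FM \<tau>) = (\<integral>\<^sup>+k. (\<integral>\<^sup>+\<sigma>. F ((k, \<sigma>) + t) \<partial>cellM \<tau>) \<partial>count_space UNIV)"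
    by (rule nn_integral_FM) measurable
  also have "\<dots> = (\<integral>\<^sup>+k. (\<integral>\<^sup>+\<sigma>. F (k + fst t, \<sigma> + snd t) \<partial>cellM \<tau>) \<partial>count_space UNIV)"
    by (intro nn_integral_cong arg_cong[where f=F]) (auto simp: prod_eq_iff)
  also have "\<dots> = (\<integral>\<^sup>+k. (\<integral>\<^sup>+\<sigma>. F (k + fst t, \<sigma>) \<partial>cellM \<tau>) \<partial>count_space UNIV)"
  proof (rule nn_integral_cong)
    fix k
    show "(\<integral>\<^sup>+\<sigma>. F (k + fst t, \<sigma> + snd t) \<partial>cellM \<tau>) = (\<integral>\<^sup>+\<sigma>. F (k + fst t, \<sigma>) \<partial>cellM \<tau>)"
      by (intro nn_integral_cellM_shift measurable_section_Gam F periodic2D[OF per] tau)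
  qed
  also have "\<dots> = (\<integral>\<^sup>+k. (\<integral>\<^sup>+\<sigma>. F (k, \<sigma>) \<partial>cellM \<tau>) \<partial>count_space UNIV)"
    by (rule nn_integral_bij_count_space[where g="\<lambda>k. k + fst t"])
      (auto intro!: bij_betw_byWitness[where f'="\<lambda>k. k - fst t"])
  also have "\<dots> = (\<integral>\<^sup>+p. F p \<partial>FM \<tau>)" by (rule nn_integral_FM[symmetric]) fact
  finally show ?thesis .
qed

lemma nn_integral_FM_minus:
  fixes F :: "freq_space \<Rightarrow> ennreal"
  assumes F [measurable]: "F \<in> borel_measurable Gam"
  shows "(\<integral>\<^sup>+p. F (- p) \<partial>FM \<tau>) = (\<integral>\<^sup>+p. F p \<partial>FM \<tau>)"
proof -
  have m0: "(\<lambda>p. F (0 - p)) \<in> borel_measurable Gam"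
    by (rule measurable_compose[OF measurable_diff_Gam F]) auto
  have "(\<integral>\<^sup>+p. F (- p) \<partial>FM \<tau>) = (\<integral>\<^sup>+k. (\<integral>\<^sup>+\<sigma>. F (- (k, \<sigma>)) \<partial>cellM \<tau>) \<partial>count_space UNIV)"
    by (rule nn_integral_FM) (use m0 in simp)
  also have "\<dots> = (\<integral>\<^sup>+k. (\<integral>\<^sup>+\<sigma>. F (- k, - \<sigma>) \<partial>cellM \<tau>) \<partial>count_space UNIV)"
    by (intro nn_integral_cong arg_cong[where f=F]) (auto simp: prod_eq_iff)
  also have "\<dots> = (\<integral>\<^sup>+k. (\<integral>\<^sup>+\<sigma>. F (- k, \<sigma>) \<partial>cellM \<tau>) \<partial>count_space UNIV)"
    by (intro nn_integral_cong nn_integral_cellM_minus measurable_section_Gam F)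
  also have "\<dots> = (\<integral>\<^sup>+k. (\<integral>\<^sup>+\<sigma>. F (k, \<sigma>) \<partial>cellM \<tau>) \<partial>count_space UNIV)"
    by (rule nn_integral_bij_count_space[where g="\<lambda>k. - k"])
      (auto intro!: bij_betw_byWitness[where f'="\<lambda>k. - k"])
  also have "\<dots> = (\<integral>\<^sup>+p. F p \<partial>FM \<tau>)" by (rule nn_integral_FM[symmetric]) fact
  finally show ?thesis .
qed

lemma FM_Fubini:
  fixes h :: "freq_space \<Rightarrow> freq_space \<Rightarrow> ennreal"
  assumes "(\<lambda>(x, y). h x y) \<in> borel_measurable (Gam \<Otimes>\<^sub>M Gam)"
  shows "(\<integral>\<^sup>+x. (\<integral>\<^sup>+y. h x y \<partial>FM \<tau>) \<partial>FM \<tau>) = (\<integral>\<^sup>+y. (\<integral>\<^sup>+x. h x y \<partial>FM \<tau>) \<partial>FM \<tau>)"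
proof -
  interpret T: sigma_finite_measure "FM \<tau>" by (rule sigma_finite_FM)
  interpret P: pair_sigma_finite "FM \<tau>" "FM \<tau>" ..
  have "sets (FM \<tau> \<Otimes>\<^sub>M FM \<tau>) = sets (Gam \<Otimes>\<^sub>M Gam)" by (intro sets_pair_measure_cong) auto
  then have "(\<lambda>(x, y). h x y) \<in> borel_measurable (FM \<tau> \<Otimes>\<^sub>M FM \<tau>)"
    using assms by (simp cong: measurable_cong_sets)
  from P.Fubini'[OF this] show ?thesis by simp
qed

lemma nn_integral_FM_measurable [measurable (raw)]:
  fixes h :: "'a \<Rightarrow> freq_space \<Rightarrow> ennreal"
  assumes "(\<lambda>(x, y). h x y) \<in> borel_measurable (M \<Otimes>\<^sub>M Gam)"
  shows "(\<lambda>x. (\<integral>\<^sup>+y. h x y \<partial>FM \<tau>)) \<in> borel_measurable M"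
proof -
  have "sets (M \<Otimes>\<^sub>M FM \<tau>) = sets (M \<Otimes>\<^sub>M Gam)" by (intro sets_pair_measure_cong) auto
  then have "(\<lambda>(x, y). h x y) \<in> borel_measurable (M \<Otimes>\<^sub>M FM \<tau>)"
    using assms by (simp cong: measurable_cong_sets)
  then show ?thesis by (rule sigma_finite_measure.borel_measurable_nn_integral[OF sigma_finite_FM])
qed

definition conv :: "real \<Rightarrow> (freq_space \<Rightarrow> ennreal) \<Rightarrow> (freq_space \<Rightarrow> ennreal) \<Rightarrow> freq_space \<Rightarrow> ennreal" where
  "conv \<tau> F G t = (\<integral>\<^sup>+p. F (t - p) * G p \<partial>FM \<tau>)"

lemma conv_measurable [measurable]:
  assumes [measurable]: "F \<in> borel_measurable Gam" "G \<in> borel_measurable Gam"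
  shows "conv \<tau> F G \<in> borel_measurable Gam"
  unfolding conv_def[abs_def] by measurable

lemma periodic2_compose_plus:
  assumes "periodic2 \<tau> F"
  shows "periodic2 \<tau> (\<lambda>p. F (p + t))" "periodic2 \<tau> (\<lambda>p. F (p - t))"
proof -
  have "F (((k, \<sigma> + 2 * pi / \<tau>) :: freq_space) + u) = F ((k, \<sigma>) + u)" for k \<sigma> and u :: freq_space
  proof -
    have "((k, \<sigma> + 2 * pi / \<tau>) :: freq_space) + u = (k + fst u, (\<sigma> + snd u) + 2 * pi / \<tau>)"
      by (simp add: prod_eq_iff)
    moreover have "(k, \<sigma>) + u = (k + fst u, \<sigma> + snd u)" by (simp add: prod_eq_iff)
    ultimately show ?thesis using periodic2D[OF assms] by simp
  qed
  from this[of _ _ t] this[of _ _ "- t"] show "periodic2 \<tau> (\<lambda>p. F (p + t))" "periodic2 \<tau> (\<lambda>p. F (p - t))"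
    by (auto intro!: periodic2I)
qed

lemma periodic2_compose_minus:
  assumes "periodic2 \<tau> F"
  shows "periodic2 \<tau> (\<lambda>p. F (t - p))"
proof -
  have "F (t - (k, \<sigma> + 2 * pi / \<tau>)) = F (t - (k, \<sigma>))" for k \<sigma>
  proof -
    have "t - (k, \<sigma>) = (fst t - k, (snd t - (\<sigma> + 2 * pi / \<tau>)) + 2 * pi / \<tau>)"
      by (simp add: prod_eq_iff)
    moreover have "t - (k, \<sigma> + 2 * pi / \<tau>) = (fst t - k, snd t - (\<sigma> + 2 * pi / \<tau>))" by (simp add: prod_eq_iff)
    ultimately show ?thesis
      using periodic2D[OF assms, of "fst t - k" "snd t - (\<sigma> + 2 * pi / \<tau>)"] by simp
  qed
  then show ?thesis by (rule periodic2I)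
qed

lemma periodic2_mult:
  fixes F G :: "freq_space \<Rightarrow> 'a::times"
  shows "periodic2 \<tau> F \<Longrightarrow> periodic2 \<tau> G \<Longrightarrow> periodic2 \<tau> (\<lambda>p. F p * G p)"
  by (simp add: periodic2_def)

lemma conv_periodic2:
  assumes "periodic2 \<tau> F"
  shows "periodic2 \<tau> (conv \<tau> F G)"
proof -
  have "F ((k, \<sigma> + 2 * pi / \<tau>) - p) = F ((k, \<sigma>) - p)" for k \<sigma> p
    by (rule periodic2D[OF periodic2_compose_plus(2)[OF assms, of p]])
  then show ?thesis by (intro periodic2I) (simp add: conv_def)
qed

lemma conv_commute:
  assumes [measurable]: "F \<in> borel_measurable Gam" "G \<in> borel_measurable Gam"
    and "periodic2 \<tau> F" "periodic2 \<tau> G" "\<tau> > 0"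
  shows "conv \<tau> F G t = conv \<tau> G F t"
proof -
  have "conv \<tau> G F t = (\<integral>\<^sup>+p. G (t - p) * F p \<partial>FM \<tau>)" by (simp add: conv_def)
  also have "\<dots> = (\<integral>\<^sup>+p. G (t - (p + t)) * F (p + t) \<partial>FM \<tau>)"
    by (rule nn_integral_FM_shift[symmetric])
      (use assms in \<open>auto intro!: periodic2_mult periodic2_compose_minus\<close>)
  also have "\<dots> = (\<integral>\<^sup>+p. F (t - (- p)) * G (- p) \<partial>FM \<tau>)"
    by (simp add: mult.commute add.commute)
  also have "\<dots> = (\<integral>\<^sup>+p. F (t - p) * G p \<partial>FM \<tau>)"
    by (rule nn_integral_FM_minus) measurable
  finally show ?thesis by (simp add: conv_def)
qed


subsection \<open>The bilinear estimate\<close>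

definition KS :: "real \<Rightarrow> (int \<times> int) set" where
  "KS \<tau> = {k. sqrt \<tau> *\<^sub>R freq k \<in> cbox (-1, -1) (1, 1)}"

lemma nsq_le_of_KS:
  assumes "\<tau> > 0" "k \<in> KS \<tau>"
  shows "real_of_int (nsq k) \<le> 2 / \<tau>"
proof -
  have *: "\<tau> * (real_of_int a)\<^sup>2 \<le> 1" if "\<bar>sqrt \<tau> * real_of_int a\<bar> \<le> 1" for a
  proof -
    have "(sqrt \<tau> * real_of_int a)\<^sup>2 \<le> 1" using that by (simp add: abs_square_le_1)
    then show ?thesis using assms by (simp add: power_mult_distrib)
  qed
  have "\<bar>sqrt \<tau> * real_of_int (fst k)\<bar> \<le> 1" "\<bar>sqrt \<tau> * real_of_int (snd k)\<bar> \<le> 1"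
    using assms by (auto simp: KS_def freq_def cbox_Pair_eq abs_le_iff)
  then have "\<tau> * (real_of_int (fst k))\<^sup>2 \<le> 1" "\<tau> * (real_of_int (snd k))\<^sup>2 \<le> 1" using * by blast+
  then have "\<tau> * real_of_int (nsq k) \<le> 2" by (simp add: nsq_def distrib_left)
  then show ?thesis using assms by (simp add: field_simps)
qed

lemma finite_KS:
  assumes "\<tau> > 0"
  shows "finite (KS \<tau>)"
  by (rule finite_subset[OF _ finite_nsq_le[of "\<lfloor>2 / \<tau>\<rfloor>"]])
    (use nsq_le_of_KS[OF assms] in \<open>auto simp: le_floor_iff\<close>)

text \<open>The modulation weight: it measures how far \<sigma> is from the paraboloid
  \<open>\<sigma> = nsq k\<close>, modulo the period.\<close>

definition wt :: "real \<Rightarrow> freq_space \<Rightarrow> real" where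
  "wt \<tau> p = jd \<tau> (snd p - real_of_int (nsq (fst p)))"

definition jf :: "freq_space \<Rightarrow> real" where
  "jf p = jap (freq (fst p))"

lemma wt_ge_1: "wt \<tau> p \<ge> 1" by (simp add: wt_def jd_ge_1)
lemma wt_pos [simp]: "wt \<tau> p > 0" by (simp add: wt_def)
lemma jf_ge_1: "jf p \<ge> 1" by (simp add: jf_def jap_ge_1)
lemma jf_pos [simp]: "jf p > 0" by (simp add: jf_def)

lemma borel_measurable_of_fst_Gam:
  fixes h :: "int \<times> int \<Rightarrow> 'a::topological_space"
  shows "(\<lambda>p. h (fst p)) \<in> borel_measurable Gam"
proof -
  have "fst \<in> measurable Gam (count_space UNIV)" unfolding Gam_def by (rule measurable_fst)
  then show ?thesis by (rule measurable_compose) auto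
qed

lemma wt_measurable [measurable]: "wt \<tau> \<in> borel_measurable Gam"
proof -
  have [measurable]: "(\<lambda>p. real_of_int (nsq (fst p))) \<in> borel_measurable Gam"
    by (rule borel_measurable_of_fst_Gam)
  show ?thesis unfolding wt_def[abs_def] by measurable
qed

lemma jf_measurable [measurable]: "jf \<in> borel_measurable Gam"
  unfolding jf_def[abs_def] by (rule borel_measurable_of_fst_Gam)

lemma wt_periodic2: "\<tau> > 0 \<Longrightarrow> periodic2 \<tau> (wt \<tau>)"
proof (rule periodic2I)
  fix k \<sigma> assume "\<tau> > 0"
  then show "wt \<tau> (k, \<sigma> + 2 * pi / \<tau>) = wt \<tau> (k, \<sigma>)"
    using jd_periodic[of \<tau> "\<sigma> - real_of_int (nsq k)"] by (simp add: wt_def algebra_simps)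
qed

lemma jf_periodic2: "periodic2 \<tau> jf"
  by (rule periodic2I) (simp add: jf_def)

text \<open>The larger of \<open>x\<close> and \<open>y\<close> is at least \<open>z / 2\<close>. Of
  its exponent \<open>- 2 * b\<close>, the part \<open>- g\<close> is spent on decay in
  \<open>z\<close> and the rest is handed to the smaller one, which ends up with
  \<open>- (4 * b - g)\<close>. The sum on the right covers both cases.\<close>

lemma powr_kernel_le:
  fixes x y z b g :: real
  assumes "x \<ge> 1" "y \<ge> 1" "z > 0" "z \<le> x + y" "0 \<le> g" "g \<le> 2 * b"
  shows "x powr (- 2 * b) * y powr (- 2 * b)
    \<le> 2 powr g * z powr (- g) * (x powr (- (4 * b - g)) + y powr (- (4 * b - g)))"
proof -
  have main: "x powr (- 2 * b) * y powr (- 2 * b) \<le> 2 powr g * z powr (- g) * x powr (- (4 * b - g))"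
    if "1 \<le> x" "x \<le> y" "z \<le> x + y" for x y
  proof -
    have "y powr (- g) \<le> (z / 2) powr (- g)" using assms that by (intro powr_mono2') auto
    also have "\<dots> = 2 powr g * z powr (- g)" using assms by (simp add: powr_divide powr_minus divide_simps)
    finally have 1: "y powr (- g) \<le> 2 powr g * z powr (- g)" .
    have 2: "y powr (- (2 * b - g)) \<le> x powr (- (2 * b - g))" using assms that by (intro powr_mono2') auto
    have "y powr (- 2 * b) = y powr (- g) * y powr (- (2 * b - g))" by (simp add: powr_add[symmetric])
    also have "\<dots> \<le> (2 powr g * z powr (- g)) * x powr (- (2 * b - g))" by (intro mult_mono 1 2) auto
    finally have "x powr (- 2 * b) * y powr (- 2 * b)
        \<le> x powr (- 2 * b) * ((2 powr g * z powr (- g)) * x powr (- (2 * b - g)))"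
      by (intro mult_left_mono) auto
    also have "\<dots> = 2 powr g * z powr (- g) * (x powr (- 2 * b) * x powr (- (2 * b - g)))" by (simp add: mult_ac)
    also have "x powr (- 2 * b) * x powr (- (2 * b - g)) = x powr (- (4 * b - g))"
      by (simp add: powr_add[symmetric])
    finally show ?thesis .
  qed
  show ?thesis
  proof (cases "x \<le> y")
    case True
    have "2 powr g * z powr (- g) * x powr (- (4 * b - g))
        \<le> 2 powr g * z powr (- g) * (x powr (- (4 * b - g)) + y powr (- (4 * b - g)))"
      by (intro mult_left_mono) auto
    with main[of x y] True assms show ?thesis by linarith
  next
    case False
    have "2 powr g * z powr (- g) * y powr (- (4 * b - g))
        \<le> 2 powr g * z powr (- g) * (x powr (- (4 * b - g)) + y powr (- (4 * b - g)))"
      by (intro mult_left_mono) auto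
    moreover have "y powr (- 2 * b) * x powr (- 2 * b) \<le> 2 powr g * z powr (- g) * y powr (- (4 * b - g))"
      using False assms by (intro main) auto
    moreover have "x powr (- 2 * b) * y powr (- 2 * b) = y powr (- 2 * b) * x powr (- 2 * b)"
      by (rule mult.commute)
    ultimately show ?thesis by linarith
  qed
qed

lemma jd_powr_integral_bound:
  fixes d :: real
  assumes d: "d > 1"
  shows "\<exists>C>0. \<forall>\<tau>>0. (\<integral>\<^sup>+r. ennreal (jd \<tau> r powr (- d)) \<partial>cellM \<tau>) \<le> ennreal C"
proof -
  obtain c where c: "c > 0" "\<And>\<tau> x. 0 < \<tau> \<Longrightarrow> \<bar>x\<bar> \<le> (pi + 2) / \<tau> \<Longrightarrow> c * (1 + \<bar>x\<bar>) \<le> jd \<tau> x"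
    using jd_lower_bound by metis
  obtain C0 where C0: "C0 > 0" "(\<integral>\<^sup>+x. ennreal ((1 + \<bar>x\<bar>) powr (- d)) \<partial>lborel) \<le> ennreal C0"
    using nn_integral_powr_finite[OF d] by blast
  have "(\<integral>\<^sup>+r. ennreal (jd \<tau> r powr (- d)) \<partial>cellM \<tau>) \<le> ennreal (c powr (- d) * C0)"
    if tau: "\<tau> > 0" for \<tau>
  proof -
    have "(\<integral>\<^sup>+r. ennreal (jd \<tau> r powr (- d)) \<partial>cellM \<tau>)
        = (\<integral>\<^sup>+r. ennreal (jd \<tau> r powr (- d)) * indicator (time_cell \<tau>) r \<partial>lborel)"
      by (rule nn_integral_cellM) measurable
    also have "\<dots> \<le> (\<integral>\<^sup>+r. ennreal (c powr (- d)) * ennreal ((1 + \<bar>r\<bar>) powr (- d)) \<partial>lborel)"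
    proof (rule nn_integral_mono)
      fix r :: real
      show "ennreal (jd \<tau> r powr (- d)) * indicator (time_cell \<tau>) r
          \<le> ennreal (c powr (- d)) * ennreal ((1 + \<bar>r\<bar>) powr (- d))"
      proof (cases "r \<in> time_cell \<tau>")
        case True
        then have "\<bar>r\<bar> \<le> pi / \<tau>" by (auto simp: time_cell_def)
        also have "\<dots> \<le> (pi + 2) / \<tau>" using tau by (intro divide_right_mono) auto
        finally have "c * (1 + \<bar>r\<bar>) \<le> jd \<tau> r" using c tau by blast
        then have "jd \<tau> r powr (- d) \<le> (c * (1 + \<bar>r\<bar>)) powr (- d)"
          using c d by (intro powr_mono2' mult_pos_pos) auto
        then show ?thesis using True c by (simp add: powr_mult ennreal_mult[symmetric] ennreal_leI)
      qed auto
    qed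
    also have "\<dots> = ennreal (c powr (- d)) * (\<integral>\<^sup>+r. ennreal ((1 + \<bar>r\<bar>) powr (- d)) \<partial>lborel)"
      by (rule nn_integral_cmult) measurable
    also have "\<dots> \<le> ennreal (c powr (- d)) * ennreal C0" by (intro mult_left_mono C0) auto
    finally show ?thesis using C0 by (simp add: ennreal_mult)
  qed
  moreover have "c powr (- d) * C0 > 0" using c C0 by simp
  ultimately show ?thesis by blast
qed

text \<open>The two weights have their peaks at distance \<open>A\<close>, and the convolution
  decays in that distance. The condition \<open>g < 4 * b - 1\<close> keeps the remaining exponent
  \<open>4 * b - g\<close> above 1, where the integral over a period is bounded uniformly in
  \<tau>.\<close>

lemma time_kernel_bound:
  fixes b g :: real
  assumes "0 \<le> g" "g \<le> 2 * b" "g < 4 * b - 1"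
  shows "\<exists>C>0. \<forall>\<tau>>0. \<forall>A. (\<integral>\<^sup>+r. ennreal (jd \<tau> (A - r) powr (- 2 * b) * jd \<tau> r powr (- 2 * b)) \<partial>cellM \<tau>)
    \<le> ennreal (C * jd \<tau> A powr (- g))"
proof -
  define d where "d = 4 * b - g"
  have "d > 1" using assms by (simp add: d_def)
  from jd_powr_integral_bound[OF this] obtain C0 where C0: "C0 > 0"
    "\<And>\<tau>. \<tau> > 0 \<Longrightarrow> (\<integral>\<^sup>+r. ennreal (jd \<tau> r powr (- d)) \<partial>cellM \<tau>) \<le> ennreal C0" by blast
  have "(\<integral>\<^sup>+r. ennreal (jd \<tau> (A - r) powr (- 2 * b) * jd \<tau> r powr (- 2 * b)) \<partial>cellM \<tau>)
    \<le> ennreal ((2 powr g * (C0 + C0)) * jd \<tau> A powr (- g))" if tau: "\<tau> > 0" for \<tau> A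
  proof -
    have "(\<integral>\<^sup>+r. ennreal (jd \<tau> (A - r) powr (- d)) \<partial>cellM \<tau>) = (\<integral>\<^sup>+r. ennreal (jd \<tau> (r + A) powr (- d)) \<partial>cellM \<tau>)"
      using nn_integral_cellM_minus[of "\<lambda>r. ennreal (jd \<tau> (r + A) powr (- d))" \<tau>]
      by (simp add: add.commute)
    also have "\<dots> = (\<integral>\<^sup>+r. ennreal (jd \<tau> r powr (- d)) \<partial>cellM \<tau>)"
      by (rule nn_integral_cellM_shift) (use tau jd_periodic in auto)
    finally have sh: "(\<integral>\<^sup>+r. ennreal (jd \<tau> (A - r) powr (- d)) \<partial>cellM \<tau>) \<le> ennreal C0"
      using C0(2)[OF tau] by simp
    have "(\<integral>\<^sup>+r. ennreal (jd \<tau> (A - r) powr (- 2 * b) * jd \<tau> r powr (- 2 * b)) \<partial>cellM \<tau>)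
        \<le> (\<integral>\<^sup>+r. ennreal (2 powr g * jd \<tau> A powr (- g)) *
             (ennreal (jd \<tau> (A - r) powr (- d)) + ennreal (jd \<tau> r powr (- d))) \<partial>cellM \<tau>)"
    proof (rule nn_integral_mono)
      fix r
      have "jd \<tau> (A - r) powr (- 2 * b) * jd \<tau> r powr (- 2 * b)
          \<le> 2 powr g * jd \<tau> A powr (- g) * (jd \<tau> (A - r) powr (- d) + jd \<tau> r powr (- d))"
        unfolding d_def using assms by (intro powr_kernel_le jd_ge_1 jd_le_add) auto
      then show "ennreal (jd \<tau> (A - r) powr (- 2 * b) * jd \<tau> r powr (- 2 * b))
        \<le> ennreal (2 powr g * jd \<tau> A powr (- g)) *
             (ennreal (jd \<tau> (A - r) powr (- d)) + ennreal (jd \<tau> r powr (- d)))"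
        by (simp add: ennreal_mult[symmetric] ennreal_plus[symmetric] ennreal_leI del: ennreal_plus)
    qed
    also have "\<dots> = ennreal (2 powr g * jd \<tau> A powr (- g)) *
        ((\<integral>\<^sup>+r. ennreal (jd \<tau> (A - r) powr (- d)) \<partial>cellM \<tau>) + (\<integral>\<^sup>+r. ennreal (jd \<tau> r powr (- d)) \<partial>cellM \<tau>))"
      by (subst nn_integral_cmult, measurable) (subst nn_integral_add, measurable)
    also have "\<dots> \<le> ennreal (2 powr g * jd \<tau> A powr (- g)) * (ennreal C0 + ennreal C0)"
      by (intro mult_left_mono add_mono sh C0(2) tau) auto
    also have "\<dots> = ennreal ((2 powr g * (C0 + C0)) * jd \<tau> A powr (- g))"
      using C0 by (simp add: ennreal_mult[symmetric] ennreal_plus[symmetric] mult_ac del: ennreal_plus)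
    finally show ?thesis .
  qed
  moreover have "2 powr g * (C0 + C0) > 0" using C0 by simp
  ultimately show ?thesis by blast
qed

text \<open>The Cauchy-Schwarz inequality in \<open>p\<close> separates the weights from the
  functions. The weights are bounded uniformly in \<open>t\<close>, and the remaining convolution of
  the squares of \<open>f\<close> and \<open>g\<close> integrates to a product by Fubini and
  translation invariance.\<close>

lemma conv_schur:
  fixes f g A B :: "freq_space \<Rightarrow> ennreal"
  assumes [measurable]: "f \<in> borel_measurable Gam" "g \<in> borel_measurable Gam"
      "A \<in> borel_measurable Gam" "B \<in> borel_measurable Gam"
    and per: "periodic2 \<tau> f" and tau: "\<tau> > 0"
    and C: "\<And>t. (\<integral>\<^sup>+p. (A (t - p) * B p)\<^sup>2 \<partial>FM \<tau>) \<le> C"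
  shows "(\<integral>\<^sup>+t. (conv \<tau> (\<lambda>p. A p * f p) (\<lambda>p. B p * g p) t)\<^sup>2 \<partial>FM \<tau>)
    \<le> C * (\<integral>\<^sup>+p. (f p)\<^sup>2 \<partial>FM \<tau>) * (\<integral>\<^sup>+p. (g p)\<^sup>2 \<partial>FM \<tau>)"
proof -
  have "(conv \<tau> (\<lambda>p. A p * f p) (\<lambda>p. B p * g p) t)\<^sup>2 \<le> C * (\<integral>\<^sup>+p. (f (t - p))\<^sup>2 * (g p)\<^sup>2 \<partial>FM \<tau>)" for t
  proof -
    have "(conv \<tau> (\<lambda>p. A p * f p) (\<lambda>p. B p * g p) t)\<^sup>2
        = (\<integral>\<^sup>+p. (A (t - p) * B p) * (f (t - p) * g p) \<partial>FM \<tau>)\<^sup>2"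
      unfolding conv_def by (simp add: mult_ac)
    also have "\<dots> \<le> (\<integral>\<^sup>+p. (A (t - p) * B p)\<^sup>2 \<partial>FM \<tau>) * (\<integral>\<^sup>+p. (f (t - p) * g p)\<^sup>2 \<partial>FM \<tau>)"
      by (rule Cauchy_Schwarz_nn_integral) measurable
    also have "\<dots> \<le> C * (\<integral>\<^sup>+p. (f (t - p) * g p)\<^sup>2 \<partial>FM \<tau>)"
      by (intro mult_right_mono C) auto
    finally show ?thesis by (simp add: power_mult_distrib)
  qed
  then have "(\<integral>\<^sup>+t. (conv \<tau> (\<lambda>p. A p * f p) (\<lambda>p. B p * g p) t)\<^sup>2 \<partial>FM \<tau>)
      \<le> (\<integral>\<^sup>+t. C * (\<integral>\<^sup>+p. (f (t - p))\<^sup>2 * (g p)\<^sup>2 \<partial>FM \<tau>) \<partial>FM \<tau>)"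
    by (intro nn_integral_mono)
  also have "\<dots> = C * (\<integral>\<^sup>+t. (\<integral>\<^sup>+p. (f (t - p))\<^sup>2 * (g p)\<^sup>2 \<partial>FM \<tau>) \<partial>FM \<tau>)"
    by (rule nn_integral_cmult) measurable
  also have "(\<integral>\<^sup>+t. (\<integral>\<^sup>+p. (f (t - p))\<^sup>2 * (g p)\<^sup>2 \<partial>FM \<tau>) \<partial>FM \<tau>)
      = (\<integral>\<^sup>+p. (\<integral>\<^sup>+t. (f (t - p))\<^sup>2 * (g p)\<^sup>2 \<partial>FM \<tau>) \<partial>FM \<tau>)"
    by (rule FM_Fubini) measurable
  also have "\<dots> = (\<integral>\<^sup>+p. (\<integral>\<^sup>+t. (f t)\<^sup>2 \<partial>FM \<tau>) * (g p)\<^sup>2 \<partial>FM \<tau>)"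
  proof (rule nn_integral_cong)
    fix p
    have "(\<integral>\<^sup>+t. (f (t - p))\<^sup>2 * (g p)\<^sup>2 \<partial>FM \<tau>) = (\<integral>\<^sup>+t. (f (t - p))\<^sup>2 \<partial>FM \<tau>) * (g p)\<^sup>2"
      by (rule nn_integral_multc) measurable
    also have "(\<integral>\<^sup>+t. (f (t - p))\<^sup>2 \<partial>FM \<tau>) = (\<integral>\<^sup>+t. (f t)\<^sup>2 \<partial>FM \<tau>)"
      using nn_integral_FM_shift[of "\<lambda>t. (f t)\<^sup>2" \<tau> "- p"] per tau
      by (auto simp: power2_eq_square intro: periodic2_mult)
    finally show "(\<integral>\<^sup>+t. (f (t - p))\<^sup>2 * (g p)\<^sup>2 \<partial>FM \<tau>) = (\<integral>\<^sup>+t. (f t)\<^sup>2 \<partial>FM \<tau>) * (g p)\<^sup>2" .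
  qed
  also have "\<dots> = (\<integral>\<^sup>+t. (f t)\<^sup>2 \<partial>FM \<tau>) * (\<integral>\<^sup>+p. (g p)\<^sup>2 \<partial>FM \<tau>)"
    by (rule nn_integral_cmult) measurable
  finally show ?thesis by (simp add: mult.assoc)
qed

text \<open>For fixed \<open>h\<close> the modulation weights peak at \<open>nsq h\<close> and at
  \<open>\<sigma> - nsq (k - h)\<close>. The time integral leaves decay in the distance of the
  peaks, and what remains to be summed over \<open>h\<close> is the resonance sum.\<close>

lemma kernel_bound:
  fixes s b :: real
  assumes s: "s > 0" and b: "1 / 4 < b" "1 / 2 - s / 4 < b" "b < 1 / 2"
  shows "\<exists>C>0. \<forall>\<tau>>0. \<forall>t. (\<integral>\<^sup>+p. (ennreal (indicat_real (KS \<tau>) (fst (t - p)) * wt \<tau> (t - p) powr (- b))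
      * ennreal (indicat_real (KS \<tau>) (fst p) * (jf p powr (- s) * wt \<tau> p powr (- b))))\<^sup>2 \<partial>FM \<tau>) \<le> ennreal C"
proof -
  \<comment> \<open>The midpoint of \<open>max 0 (1 - s)\<close> and \<open>4 * b - 1\<close>; the
    lower bounds on \<open>b\<close> say that the first is less than the second.\<close>
  define g where "g = (max 0 (1 - s) + (4 * b - 1)) / 2"
  have g: "0 < g" "g < 4 * b - 1" "g + s > 1" "g \<le> 2 * b" using s b by (auto simp: g_def max_def field_simps)
  have g0: "0 \<le> g" using g by simp
  obtain C1 where C1: "C1 > 0" "\<And>\<tau> A. \<tau> > 0 \<Longrightarrow>
      (\<integral>\<^sup>+r. ennreal (jd \<tau> (A - r) powr (- 2 * b) * jd \<tau> r powr (- 2 * b)) \<partial>cellM \<tau>) \<le> ennreal (C1 * jd \<tau> A powr (- g))"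
    using time_kernel_bound[OF g0 g(4) g(2)] by blast
  obtain C2 where C2: "C2 > 0" "\<And>\<tau> A k F. 0 < \<tau> \<Longrightarrow> finite F \<Longrightarrow>
    (\<forall>h\<in>F. real_of_int (nsq h) \<le> 2 / \<tau> \<and> real_of_int (nsq (k - h)) \<le> 2 / \<tau>) \<Longrightarrow>
    (\<Sum>h\<in>F. jap (freq h) powr (- 2 * s) * jd \<tau> (A - real_of_int (nsq h + nsq (k - h))) powr (- g)) \<le> C2"
    using resonance_sum_bound[OF s g(1) g(3)] by blast
  have "(\<integral>\<^sup>+p. (ennreal (indicat_real (KS \<tau>) (fst (t - p)) * wt \<tau> (t - p) powr (- b))
      * ennreal (indicat_real (KS \<tau>) (fst p) * (jf p powr (- s) * wt \<tau> p powr (- b))))\<^sup>2 \<partial>FM \<tau>) \<le> ennreal (C1 * C2)"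
    if tau: "\<tau> > 0" for \<tau> t
  proof -
    obtain k \<sigma> where t: "t = (k, \<sigma>)" by (cases t)
    \<comment> \<open>Only finitely many \<open>h\<close> contribute for given \<open>k\<close>.
      Membership of both \<open>h\<close> and \<open>k - h\<close> in the band is also what keeps
      the integers of the resonance sum below \<open>4 / \<tau>\<close>.\<close>
    define H where "H = {h\<in>KS \<tau>. k - h \<in> KS \<tau>}"
    have finH: "finite H" using finite_KS[OF tau] by (simp add: H_def)
    have [measurable]: "(\<lambda>p. indicat_real (KS \<tau>) (fst p)) \<in> borel_measurable Gam"
      by (rule borel_measurable_of_fst_Gam)
    define \<Phi> where "\<Phi> = (\<lambda>p. (ennreal (indicat_real (KS \<tau>) (fst (t - p)) * wt \<tau> (t - p) powr (- b))
      * ennreal (indicat_real (KS \<tau>) (fst p) * (jf p powr (- s) * wt \<tau> p powr (- b))))\<^sup>2)"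
    have [measurable]: "(\<lambda>p. indicat_real (KS \<tau>) (fst (t - p))) \<in> borel_measurable Gam"
      using borel_measurable_of_fst_Gam[of "\<lambda>h. indicat_real (KS \<tau>) (k - h)"] by (simp add: t)
    have \<Phi>m: "\<Phi> \<in> borel_measurable Gam" unfolding \<Phi>_def by measurable
    have \<Phi>eq: "\<Phi> (h, \<rho>) = (if h \<in> H then ennreal (jap (freq h) powr (- 2 * s)) *
        ennreal (jd \<tau> (\<sigma> - \<rho> - real_of_int (nsq (k - h))) powr (- 2 * b) * jd \<tau> (\<rho> - real_of_int (nsq h)) powr (- 2 * b))
        else 0)" for h \<rho>
    proof (cases "h \<in> H")
      case True
      have sq: "(x powr a)\<^sup>2 = x powr (2 * a)" if "x > 0" for x a :: real
        using that by (simp add: power2_eq_square powr_add[symmetric])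
      show ?thesis using True
        by (simp add: \<Phi>_def t H_def wt_def jf_def ennreal_mult[symmetric] ennreal_power power_mult_distrib sq mult_ac)
    next
      case False
      then show ?thesis by (auto simp: \<Phi>_def t H_def)
    qed
    have inner: "(\<integral>\<^sup>+\<rho>. \<Phi> (h, \<rho>) \<partial>cellM \<tau>)
        \<le> ennreal (C1 * (jap (freq h) powr (- 2 * s) * jd \<tau> (\<sigma> - real_of_int (nsq h + nsq (k - h))) powr (- g)))"
      if "h \<in> H" for h
    proof -
      \<comment> \<open>Shifting \<rho> by \<open>nsq h\<close> moves one peak to 0 and turns the
        argument of the other weight into \<open>A - r\<close>.\<close>
      define A where "A = \<sigma> - real_of_int (nsq h + nsq (k - h))"
      define \<psi> where "\<psi> = (\<lambda>\<rho>. ennreal (jd \<tau> (\<sigma> - \<rho> - real_of_int (nsq (k - h))) powr (- 2 * b)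
          * jd \<tau> (\<rho> - real_of_int (nsq h)) powr (- 2 * b)))"
      have \<psi>m [measurable]: "\<psi> \<in> borel_measurable borel" unfolding \<psi>_def by measurable
      have \<psi>p: "\<psi> (\<rho> + 2 * pi / \<tau>) = \<psi> \<rho>" for \<rho>
      proof -
        have "jd \<tau> (\<sigma> - \<rho> - real_of_int (nsq (k - h))) = jd \<tau> (\<sigma> - (\<rho> + 2 * pi / \<tau>) - real_of_int (nsq (k - h)))"
        proof -
          have eq: "\<sigma> - \<rho> - real_of_int (nsq (k - h)) = (\<sigma> - (\<rho> + 2 * pi / \<tau>) - real_of_int (nsq (k - h))) + 2 * pi / \<tau>"
            by simp
          show ?thesis by (subst eq, rule jd_periodic) (use tau in simp)
        qed
        moreover have "jd \<tau> (\<rho> + 2 * pi / \<tau> - real_of_int (nsq h)) = jd \<tau> (\<rho> - real_of_int (nsq h))"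
          using jd_periodic[of \<tau> "\<rho> - real_of_int (nsq h)"] tau by (simp add: algebra_simps)
        ultimately show ?thesis by (simp add: \<psi>_def)
      qed
      have "(\<integral>\<^sup>+\<rho>. \<psi> \<rho> \<partial>cellM \<tau>) = (\<integral>\<^sup>+\<rho>. \<psi> (\<rho> + real_of_int (nsq h)) \<partial>cellM \<tau>)"
        by (rule nn_integral_cellM_shift[symmetric]) (use \<psi>m \<psi>p tau in auto)
      also have "\<dots> = (\<integral>\<^sup>+r. ennreal (jd \<tau> (A - r) powr (- 2 * b) * jd \<tau> r powr (- 2 * b)) \<partial>cellM \<tau>)"
        by (simp add: \<psi>_def A_def algebra_simps)
      also have "\<dots> \<le> ennreal (C1 * jd \<tau> A powr (- g))" by (rule C1(2)[OF tau])
      finally have le: "(\<integral>\<^sup>+\<rho>. \<psi> \<rho> \<partial>cellM \<tau>) \<le> ennreal (C1 * jd \<tau> A powr (- g))" .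
      have "(\<integral>\<^sup>+\<rho>. \<Phi> (h, \<rho>) \<partial>cellM \<tau>) = (\<integral>\<^sup>+\<rho>. ennreal (jap (freq h) powr (- 2 * s)) * \<psi> \<rho> \<partial>cellM \<tau>)"
        using that by (simp add: \<Phi>eq \<psi>_def)
      also have "\<dots> = ennreal (jap (freq h) powr (- 2 * s)) * (\<integral>\<^sup>+\<rho>. \<psi> \<rho> \<partial>cellM \<tau>)"
        by (rule nn_integral_cmult) measurable
      also have "\<dots> \<le> ennreal (jap (freq h) powr (- 2 * s)) * ennreal (C1 * jd \<tau> A powr (- g))"
        by (intro mult_left_mono le) auto
      also have "\<dots> = ennreal (C1 * (jap (freq h) powr (- 2 * s) * jd \<tau> A powr (- g)))"
        using C1(1) by (simp add: ennreal_mult[symmetric] mult_ac)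
      finally show ?thesis by (simp only: A_def)
    qed
    have "(\<integral>\<^sup>+p. \<Phi> p \<partial>FM \<tau>) = (\<integral>\<^sup>+h. (\<integral>\<^sup>+\<rho>. \<Phi> (h, \<rho>) \<partial>cellM \<tau>) \<partial>count_space UNIV)"
      by (rule nn_integral_FM[OF \<Phi>m])
    also have "\<dots> = (\<Sum>h\<in>H. (\<integral>\<^sup>+\<rho>. \<Phi> (h, \<rho>) \<partial>cellM \<tau>))"
      by (rule nn_integral_count_space'[OF finH]) (auto simp: \<Phi>eq)
    also have "\<dots> \<le> (\<Sum>h\<in>H. ennreal (C1 * (jap (freq h) powr (- 2 * s) * jd \<tau> (\<sigma> - real_of_int (nsq h + nsq (k - h))) powr (- g))))"
      by (intro sum_mono inner)
    also have "\<dots> = ennreal (C1 * (\<Sum>h\<in>H. jap (freq h) powr (- 2 * s) * jd \<tau> (\<sigma> - real_of_int (nsq h + nsq (k - h))) powr (- g)))"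
      using C1 by (subst sum_ennreal) (auto simp: sum_distrib_left)
    also have "\<dots> \<le> ennreal (C1 * C2)"
      using C1 nsq_le_of_KS[OF tau] by (intro ennreal_leI mult_left_mono C2(2) tau finH) (auto simp: H_def)
    finally show ?thesis by (simp add: \<Phi>_def)
  qed
  moreover have "C1 * C2 > 0" using C1 C2 by simp
  ultimately show ?thesis by blast
qed

text \<open>The squared Bourgain norm on the Fourier side, with infinity as a possible value, so
  that estimates can be stated without membership conditions.\<close>

definition bsq :: "real \<Rightarrow> real \<Rightarrow> real \<Rightarrow> (freq_space \<Rightarrow> ennreal) \<Rightarrow> ennreal" where
  "bsq \<tau> s b F = (\<integral>\<^sup>+p. (ennreal (jf p powr s * wt \<tau> p powr b) * F p)\<^sup>2 \<partial>FM \<tau>)"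

definition band_limited :: "real \<Rightarrow> (freq_space \<Rightarrow> ennreal) \<Rightarrow> bool" where
  "band_limited \<tau> F \<longleftrightarrow> F \<in> borel_measurable Gam \<and> periodic2 \<tau> F \<and> (\<forall>p. fst p \<notin> KS \<tau> \<longrightarrow> F p = 0)"

lemma band_limited_outside: "band_limited \<tau> F \<Longrightarrow> fst p \<notin> KS \<tau> \<Longrightarrow> F p = 0"
  unfolding band_limited_def by blast

lemma band_limited_weight:
  assumes "band_limited \<tau> F" "\<tau> > 0"
  shows "(\<lambda>p. ennreal (jf p powr s * wt \<tau> p powr b) * F p) \<in> borel_measurable Gam"
    "periodic2 \<tau> (\<lambda>p. ennreal (jf p powr s * wt \<tau> p powr b) * F p)"
proof -
  have [measurable]: "F \<in> borel_measurable Gam" and per: "periodic2 \<tau> F" using assms by (auto simp: band_limited_def)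
  show "(\<lambda>p. ennreal (jf p powr s * wt \<tau> p powr b) * F p) \<in> borel_measurable Gam" by measurable
  show "periodic2 \<tau> (\<lambda>p. ennreal (jf p powr s * wt \<tau> p powr b) * F p)"
    by (rule periodic2I)
      (simp add: periodic2D[OF per] periodic2D[OF wt_periodic2[OF assms(2)]] periodic2D[OF jf_periodic2])
qed

text \<open>The weights of both norms are divided out, and their inverses become the kernel of
  \<open>conv_schur\<close>. Only \<open>G\<close> has to supply a spatial weight.\<close>

lemma bilinear_bound:
  fixes s b :: real
  assumes s: "s > 0" and b: "1 / 4 < b" "1 / 2 - s / 4 < b" "b < 1 / 2"
  shows "\<exists>C>0. \<forall>\<tau>>0. \<forall>F G. band_limited \<tau> F \<longrightarrow> band_limited \<tau> G \<longrightarrow>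
    (\<integral>\<^sup>+t. (conv \<tau> F G t)\<^sup>2 \<partial>FM \<tau>) \<le> ennreal C * bsq \<tau> 0 b F * bsq \<tau> s b G"
proof -
  obtain C where C: "C > 0" "\<And>\<tau> t. \<tau> > 0 \<Longrightarrow> (\<integral>\<^sup>+p. (ennreal (indicat_real (KS \<tau>) (fst (t - p)) * wt \<tau> (t - p) powr (- b))
      * ennreal (indicat_real (KS \<tau>) (fst p) * (jf p powr (- s) * wt \<tau> p powr (- b))))\<^sup>2 \<partial>FM \<tau>) \<le> ennreal C"
    using kernel_bound[OF assms] by blast
  have "(\<integral>\<^sup>+t. (conv \<tau> F G t)\<^sup>2 \<partial>FM \<tau>) \<le> ennreal C * bsq \<tau> 0 b F * bsq \<tau> s b G"
    if tau: "\<tau> > 0" and F: "band_limited \<tau> F" and G: "band_limited \<tau> G" for \<tau> F G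
  proof -
    have [measurable]: "(\<lambda>p. indicat_real (KS \<tau>) (fst p)) \<in> borel_measurable Gam"
      by (rule borel_measurable_of_fst_Gam)
    \<comment> \<open>The indicators cost nothing, as \<open>F\<close> and \<open>G\<close> vanish
      outside the band, and they confine the kernel to the region where \<open>kernel_bound\<close>
      applies.\<close>
    define A where "A = (\<lambda>p. ennreal (indicat_real (KS \<tau>) (fst p) * wt \<tau> p powr (- b)))"
    define B where "B = (\<lambda>p. ennreal (indicat_real (KS \<tau>) (fst p) * (jf p powr (- s) * wt \<tau> p powr (- b))))"
    define f where "f = (\<lambda>p. ennreal (jf p powr 0 * wt \<tau> p powr b) * F p)"
    define g where "g = (\<lambda>p. ennreal (jf p powr s * wt \<tau> p powr b) * G p)"
    have Af: "F = (\<lambda>p. A p * f p)"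
    proof
      fix p
      show "F p = A p * f p"
      proof (cases "fst p \<in> KS \<tau>")
        case True
        have "ennreal (wt \<tau> p powr (- b)) * ennreal (wt \<tau> p powr b) = 1"
          by (simp add: ennreal_mult[symmetric] powr_add[symmetric] less_imp_neq[OF wt_pos, symmetric])
        then show ?thesis using True by (simp add: A_def f_def mult.assoc[symmetric] less_imp_neq[OF jf_pos, symmetric])
      next
        case False then show ?thesis using F by (simp add: A_def band_limited_outside)
      qed
    qed
    have Bg: "G = (\<lambda>p. B p * g p)"
    proof
      fix p
      show "G p = B p * g p"
      proof (cases "fst p \<in> KS \<tau>")
        case True
        have "jf p powr (- s) * wt \<tau> p powr (- b) * (jf p powr s * wt \<tau> p powr b)
            = (jf p powr (- s) * jf p powr s) * (wt \<tau> p powr (- b) * wt \<tau> p powr b)" by (simp only: mult_ac)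
        also have "\<dots> = 1"
          by (simp add: powr_add[symmetric] less_imp_neq[OF wt_pos, symmetric] less_imp_neq[OF jf_pos, symmetric])
        finally have "ennreal (jf p powr (- s) * wt \<tau> p powr (- b)) * ennreal (jf p powr s * wt \<tau> p powr b) = 1"
          by (simp add: ennreal_mult[symmetric])
        then show ?thesis using True by (simp add: B_def g_def mult.assoc[symmetric])
      next
        case False then show ?thesis using G by (simp add: B_def band_limited_outside)
      qed
    qed
    have "(\<integral>\<^sup>+t. (conv \<tau> (\<lambda>p. A p * f p) (\<lambda>p. B p * g p) t)\<^sup>2 \<partial>FM \<tau>)
      \<le> ennreal C * (\<integral>\<^sup>+p. (f p)\<^sup>2 \<partial>FM \<tau>) * (\<integral>\<^sup>+p. (g p)\<^sup>2 \<partial>FM \<tau>)"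
    proof (rule conv_schur)
      show "f \<in> borel_measurable Gam" unfolding f_def by (rule band_limited_weight(1)[OF F tau])
      show "g \<in> borel_measurable Gam" unfolding g_def by (rule band_limited_weight(1)[OF G tau])
      show "periodic2 \<tau> f" unfolding f_def by (rule band_limited_weight(2)[OF F tau])
      show "A \<in> borel_measurable Gam" "B \<in> borel_measurable Gam" unfolding A_def B_def by measurable
      show "(\<integral>\<^sup>+p. (A (t - p) * B p)\<^sup>2 \<partial>FM \<tau>) \<le> ennreal C" for t
        unfolding A_def B_def by (rule C(2)[OF tau])
    qed (rule tau)
    then have "(\<integral>\<^sup>+t. (conv \<tau> F G t)\<^sup>2 \<partial>FM \<tau>)
      \<le> ennreal C * (\<integral>\<^sup>+p. (f p)\<^sup>2 \<partial>FM \<tau>) * (\<integral>\<^sup>+p. (g p)\<^sup>2 \<partial>FM \<tau>)"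
      by (simp only: Af[symmetric] Bg[symmetric])
    then show ?thesis unfolding bsq_def f_def g_def .
  qed
  with C(1) show ?thesis by blast
qed

subsection \<open>The trilinear estimate\<close>

lemma nn_integral_FM_square:
  fixes a :: "freq_space \<Rightarrow> ennreal"
  assumes [measurable]: "a \<in> borel_measurable Gam"
  shows "(\<integral>\<^sup>+t. a t \<partial>FM \<tau>)\<^sup>2 = (\<integral>\<^sup>+t. (\<integral>\<^sup>+u. a t * a u \<partial>FM \<tau>) \<partial>FM \<tau>)"
proof -
  have "(\<integral>\<^sup>+t. (\<integral>\<^sup>+u. a t * a u \<partial>FM \<tau>) \<partial>FM \<tau>) = (\<integral>\<^sup>+t. a t * (\<integral>\<^sup>+u. a u \<partial>FM \<tau>) \<partial>FM \<tau>)"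
    by (intro nn_integral_cong nn_integral_cmult) measurable
  also have "\<dots> = (\<integral>\<^sup>+t. a t \<partial>FM \<tau>) * (\<integral>\<^sup>+u. a u \<partial>FM \<tau>)"
    by (rule nn_integral_multc) measurable
  finally show ?thesis by (simp add: power2_eq_square)
qed

lemma FM_rotate3:
  fixes h :: "freq_space \<Rightarrow> freq_space \<Rightarrow> freq_space \<Rightarrow> ennreal"
  assumes [measurable]: "(\<lambda>(y, t, u). h y t u) \<in> borel_measurable (Gam \<Otimes>\<^sub>M Gam \<Otimes>\<^sub>M Gam)"
  shows "(\<integral>\<^sup>+y. (\<integral>\<^sup>+t. (\<integral>\<^sup>+u. h y t u \<partial>FM \<tau>) \<partial>FM \<tau>) \<partial>FM \<tau>)
    = (\<integral>\<^sup>+t. (\<integral>\<^sup>+u. (\<integral>\<^sup>+y. h y t u \<partial>FM \<tau>) \<partial>FM \<tau>) \<partial>FM \<tau>)"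
proof -
  have m1: "(\<lambda>x. h (fst (fst x)) (snd (fst x)) (snd x)) \<in> borel_measurable ((Gam \<Otimes>\<^sub>M Gam) \<Otimes>\<^sub>M Gam)"
    using measurable_compose[OF _ assms, of "\<lambda>x. (fst (fst x), snd (fst x), snd x)" "(Gam \<Otimes>\<^sub>M Gam) \<Otimes>\<^sub>M Gam"]
    by simp
  have m2: "(\<lambda>x. h (fst x) t (snd x)) \<in> borel_measurable (Gam \<Otimes>\<^sub>M Gam)" for t
    using measurable_compose[OF _ assms, of "\<lambda>x. (fst x, t, snd x)" "Gam \<Otimes>\<^sub>M Gam"] by simp
  have "(\<integral>\<^sup>+y. (\<integral>\<^sup>+t. (\<integral>\<^sup>+u. h y t u \<partial>FM \<tau>) \<partial>FM \<tau>) \<partial>FM \<tau>)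
      = (\<integral>\<^sup>+t. (\<integral>\<^sup>+y. (\<integral>\<^sup>+u. h y t u \<partial>FM \<tau>) \<partial>FM \<tau>) \<partial>FM \<tau>)"
  proof (rule FM_Fubini)
    show "(\<lambda>(y, t). \<integral>\<^sup>+u. h y t u \<partial>FM \<tau>) \<in> borel_measurable (Gam \<Otimes>\<^sub>M Gam)"
      unfolding split_beta' by (rule nn_integral_FM_measurable) (use m1 in \<open>simp add: split_beta'\<close>)
  qed
  also have "\<dots> = (\<integral>\<^sup>+t. (\<integral>\<^sup>+u. (\<integral>\<^sup>+y. h y t u \<partial>FM \<tau>) \<partial>FM \<tau>) \<partial>FM \<tau>)"
    by (intro nn_integral_cong FM_Fubini) (use m2 in \<open>simp add: split_beta'\<close>)
  finally show ?thesis .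
qed

text \<open>Both sides are the integral of \<open>D a * F b * D c * F d\<close> over quadruples with \<open>a + b = c + d\<close>, up
  to exchanging the roles of the two arguments of \<open>F\<close>.\<close>

lemma correlation_L2_eq_conv_L2:
  assumes [measurable]: "D \<in> borel_measurable Gam" "F \<in> borel_measurable Gam"
    and per: "periodic2 \<tau> D" "periodic2 \<tau> F" and tau: "\<tau> > 0"
  shows "(\<integral>\<^sup>+y. (\<integral>\<^sup>+t. D t * F (t + y) \<partial>FM \<tau>)\<^sup>2 \<partial>FM \<tau>) = (\<integral>\<^sup>+z. (conv \<tau> D F z)\<^sup>2 \<partial>FM \<tau>)"
proof -
  have "(\<integral>\<^sup>+y. (\<integral>\<^sup>+t. D t * F (t + y) \<partial>FM \<tau>)\<^sup>2 \<partial>FM \<tau>)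
      = (\<integral>\<^sup>+y. (\<integral>\<^sup>+t. (\<integral>\<^sup>+u. (D t * F (t + y)) * (D u * F (u + y)) \<partial>FM \<tau>) \<partial>FM \<tau>) \<partial>FM \<tau>)"
    by (intro nn_integral_cong nn_integral_FM_square) measurable
  also have "\<dots> = (\<integral>\<^sup>+t. (\<integral>\<^sup>+u. (\<integral>\<^sup>+y. (D t * F (t + y)) * (D u * F (u + y)) \<partial>FM \<tau>) \<partial>FM \<tau>) \<partial>FM \<tau>)"
    by (rule FM_rotate3) measurable
  also have "\<dots> = (\<integral>\<^sup>+t. (\<integral>\<^sup>+u. (\<integral>\<^sup>+z. (F (z - t) * D t) * (F (z - u) * D u) \<partial>FM \<tau>) \<partial>FM \<tau>) \<partial>FM \<tau>)"
  proof (rule nn_integral_cong, rule nn_integral_cong)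
    fix t u
    \<comment> \<open>Substituting \<open>z = y + t + u\<close> turns \<open>t + y\<close> into
      \<open>z - u\<close> and \<open>u + y\<close> into \<open>z - t\<close>: the two arguments of
      \<open>F\<close> change places.\<close>
    define h where "h = (\<lambda>z. (F (z - t) * D t) * (F (z - u) * D u))"
    have hm: "h \<in> borel_measurable Gam" unfolding h_def by measurable
    have "periodic2 \<tau> h"
      by (rule periodic2I)
        (simp add: h_def periodic2D[OF periodic2_compose_plus(2)[OF per(2), of t]]
           periodic2D[OF periodic2_compose_plus(2)[OF per(2), of u]])
    from nn_integral_FM_shift[OF hm this tau, of "t + u"]
    have "(\<integral>\<^sup>+y. h (y + (t + u)) \<partial>FM \<tau>) = (\<integral>\<^sup>+z. h z \<partial>FM \<tau>)" .
    moreover have "h (y + (t + u)) = (D t * F (t + y)) * (D u * F (u + y))" for y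
    proof -
      have *: "y + (t + u) - t = u + y" "y + (t + u) - u = t + y" by (simp_all add: algebra_simps)
      show ?thesis unfolding h_def * by (simp add: mult_ac)
    qed
    ultimately show "(\<integral>\<^sup>+y. (D t * F (t + y)) * (D u * F (u + y)) \<partial>FM \<tau>)
        = (\<integral>\<^sup>+z. (F (z - t) * D t) * (F (z - u) * D u) \<partial>FM \<tau>)" by (simp add: h_def)
  qed
  also have "\<dots> = (\<integral>\<^sup>+z. (\<integral>\<^sup>+t. (\<integral>\<^sup>+u. (F (z - t) * D t) * (F (z - u) * D u) \<partial>FM \<tau>) \<partial>FM \<tau>) \<partial>FM \<tau>)"
    by (rule FM_rotate3[symmetric]) measurable
  also have "\<dots> = (\<integral>\<^sup>+z. (\<integral>\<^sup>+t. F (z - t) * D t \<partial>FM \<tau>)\<^sup>2 \<partial>FM \<tau>)"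
    by (intro nn_integral_cong nn_integral_FM_square[symmetric]) measurable
  also have "\<dots> = (\<integral>\<^sup>+z. (conv \<tau> D F z)\<^sup>2 \<partial>FM \<tau>)"
    using conv_commute[OF _ _ per tau] by (simp add: conv_def[symmetric])
  finally show ?thesis .
qed

text \<open>The Fourier side of \<open>u1 * cnj u2 * u3\<close>. Pairing it with \<open>D\<close> integrates
  \<open>D t * F1 a * F2 q * F3 r\<close> over \<open>t + q = a + r\<close>; the two ways of grouping the four factors decide
  which of the three arguments may go without a spatial weight.\<close>

definition tri :: "real \<Rightarrow> (freq_space \<Rightarrow> ennreal) \<Rightarrow> (freq_space \<Rightarrow> ennreal) \<Rightarrow> (freq_space \<Rightarrow> ennreal)
    \<Rightarrow> freq_space \<Rightarrow> ennreal" where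
  "tri \<tau> F1 F2 F3 t = (\<integral>\<^sup>+q. F2 q * conv \<tau> F1 F3 (t + q) \<partial>FM \<tau>)"

lemma tri_measurable [measurable]:
  assumes [measurable]: "F1 \<in> borel_measurable Gam" "F2 \<in> borel_measurable Gam" "F3 \<in> borel_measurable Gam"
  shows "tri \<tau> F1 F2 F3 \<in> borel_measurable Gam"
  unfolding tri_def[abs_def] by measurable

lemma tri_periodic2:
  assumes "periodic2 \<tau> F1"
  shows "periodic2 \<tau> (tri \<tau> F1 F2 F3)"
  by (rule periodic2I) (simp add: tri_def periodic2D[OF periodic2_compose_plus(1)[OF conv_periodic2[OF assms]]])

text \<open>The constraint \<open>t + q = a + r\<close> is used through its common value
  \<open>z\<close>, so \<open>D\<close> meets \<open>F2\<close> and \<open>F1\<close> meets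
  \<open>F3\<close>. As \<open>D\<close> has no spatial weight, \<open>F2\<close> must have one,
  whereas either of \<open>F1\<close> and \<open>F3\<close> may go without.\<close>

lemma tri_pairing1:
  assumes [measurable]: "D \<in> borel_measurable Gam" "F1 \<in> borel_measurable Gam"
      "F2 \<in> borel_measurable Gam" "F3 \<in> borel_measurable Gam"
    and per: "periodic2 \<tau> D" "periodic2 \<tau> F1" and tau: "\<tau> > 0"
  shows "(\<integral>\<^sup>+t. D t * tri \<tau> F1 F2 F3 t \<partial>FM \<tau>)\<^sup>2
    \<le> (\<integral>\<^sup>+z. (conv \<tau> D F2 z)\<^sup>2 \<partial>FM \<tau>) * (\<integral>\<^sup>+z. (conv \<tau> F1 F3 z)\<^sup>2 \<partial>FM \<tau>)"
proof -
  define V where "V = conv \<tau> F1 F3"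
  have [measurable]: "V \<in> borel_measurable Gam" unfolding V_def by measurable
  have Vp: "periodic2 \<tau> V" unfolding V_def by (rule conv_periodic2[OF per(2)])
  have "(\<integral>\<^sup>+t. D t * tri \<tau> F1 F2 F3 t \<partial>FM \<tau>) = (\<integral>\<^sup>+t. (\<integral>\<^sup>+q. D t * (F2 q * V (t + q)) \<partial>FM \<tau>) \<partial>FM \<tau>)"
    unfolding tri_def V_def[symmetric] by (intro nn_integral_cong nn_integral_cmult[symmetric]) measurable
  also have "\<dots> = (\<integral>\<^sup>+q. (\<integral>\<^sup>+t. D t * (F2 q * V (t + q)) \<partial>FM \<tau>) \<partial>FM \<tau>)"
    by (rule FM_Fubini) measurable
  also have "\<dots> = (\<integral>\<^sup>+q. (\<integral>\<^sup>+z. D (z - q) * F2 q * V z \<partial>FM \<tau>) \<partial>FM \<tau>)"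
  proof (rule nn_integral_cong)
    fix q
    define h where "h = (\<lambda>z. D (z - q) * F2 q * V z)"
    have hm: "h \<in> borel_measurable Gam" unfolding h_def by measurable
    have "periodic2 \<tau> h"
      by (rule periodic2I)
        (simp add: h_def periodic2D[OF Vp] periodic2D[OF periodic2_compose_plus(2)[OF per(1), of q]])
    from nn_integral_FM_shift[OF hm this tau, of q]
    show "(\<integral>\<^sup>+t. D t * (F2 q * V (t + q)) \<partial>FM \<tau>) = (\<integral>\<^sup>+z. D (z - q) * F2 q * V z \<partial>FM \<tau>)"
      by (simp add: h_def mult.assoc)
  qed
  also have "\<dots> = (\<integral>\<^sup>+z. (\<integral>\<^sup>+q. D (z - q) * F2 q * V z \<partial>FM \<tau>) \<partial>FM \<tau>)"
    by (rule FM_Fubini) measurable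
  also have "\<dots> = (\<integral>\<^sup>+z. conv \<tau> D F2 z * V z \<partial>FM \<tau>)"
    unfolding conv_def by (intro nn_integral_cong nn_integral_multc) measurable
  finally show ?thesis
    using Cauchy_Schwarz_nn_integral[of "conv \<tau> D F2" "FM \<tau>" V] by (simp add: V_def)
qed

text \<open>Here the constraint is read as \<open>a - t = q - r\<close>, so \<open>D\<close> meets
  \<open>F1\<close> and \<open>F3\<close> meets \<open>F2\<close>, in correlations whose
  \<open>L2\<close> norms equal those of convolutions. This grouping serves the case in which
  \<open>F2\<close> has no spatial weight.\<close>

lemma tri_pairing2:
  assumes [measurable]: "D \<in> borel_measurable Gam" "F1 \<in> borel_measurable Gam"
      "F2 \<in> borel_measurable Gam" "F3 \<in> borel_measurable Gam"
    and per: "periodic2 \<tau> D" "periodic2 \<tau> F1" "periodic2 \<tau> F2" "periodic2 \<tau> F3" and tau: "\<tau> > 0"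
  shows "(\<integral>\<^sup>+t. D t * tri \<tau> F1 F2 F3 t \<partial>FM \<tau>)\<^sup>2
    \<le> (\<integral>\<^sup>+z. (conv \<tau> D F1 z)\<^sup>2 \<partial>FM \<tau>) * (\<integral>\<^sup>+z. (conv \<tau> F3 F2 z)\<^sup>2 \<partial>FM \<tau>)"
proof -
  define E where "E = (\<lambda>y. \<integral>\<^sup>+t. D t * F1 (t + y) \<partial>FM \<tau>)"
  define H where "H = (\<lambda>y. \<integral>\<^sup>+r. F3 r * F2 (r + y) \<partial>FM \<tau>)"
  have [measurable]: "E \<in> borel_measurable Gam" "H \<in> borel_measurable Gam"
    unfolding E_def H_def by measurable
  have Ep: "periodic2 \<tau> E"
  proof (rule periodic2I)
    fix k \<sigma>
    show "E (k, \<sigma> + 2 * pi / \<tau>) = E (k, \<sigma>)"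
      unfolding E_def using periodic2D[OF periodic2_compose_plus(1)[OF per(2)]] by (simp add: add.commute)
  qed
  have "(\<integral>\<^sup>+t. D t * tri \<tau> F1 F2 F3 t \<partial>FM \<tau>)
      = (\<integral>\<^sup>+t. (\<integral>\<^sup>+q. (\<integral>\<^sup>+r. D t * (F2 q * (F1 (t + q - r) * F3 r)) \<partial>FM \<tau>) \<partial>FM \<tau>) \<partial>FM \<tau>)"
  proof (rule nn_integral_cong)
    fix t
    have "D t * tri \<tau> F1 F2 F3 t = D t * (\<integral>\<^sup>+q. (\<integral>\<^sup>+r. F2 q * (F1 (t + q - r) * F3 r) \<partial>FM \<tau>) \<partial>FM \<tau>)"
      unfolding tri_def conv_def
      by (intro arg_cong2[where f="(*)"] refl nn_integral_cong nn_integral_cmult[symmetric]) measurable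
    also have "\<dots> = (\<integral>\<^sup>+q. D t * (\<integral>\<^sup>+r. F2 q * (F1 (t + q - r) * F3 r) \<partial>FM \<tau>) \<partial>FM \<tau>)"
      by (rule nn_integral_cmult[symmetric]) measurable
    also have "\<dots> = (\<integral>\<^sup>+q. (\<integral>\<^sup>+r. D t * (F2 q * (F1 (t + q - r) * F3 r)) \<partial>FM \<tau>) \<partial>FM \<tau>)"
      by (intro nn_integral_cong nn_integral_cmult[symmetric]) measurable
    finally show "D t * tri \<tau> F1 F2 F3 t
        = (\<integral>\<^sup>+q. (\<integral>\<^sup>+r. D t * (F2 q * (F1 (t + q - r) * F3 r)) \<partial>FM \<tau>) \<partial>FM \<tau>)" .
  qed
  also have "\<dots> = (\<integral>\<^sup>+q. (\<integral>\<^sup>+r. (\<integral>\<^sup>+t. D t * (F2 q * (F1 (t + q - r) * F3 r)) \<partial>FM \<tau>) \<partial>FM \<tau>) \<partial>FM \<tau>)"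
    by (rule FM_rotate3) measurable
  also have "\<dots> = (\<integral>\<^sup>+q. (\<integral>\<^sup>+r. F3 r * F2 q * E (q - r) \<partial>FM \<tau>) \<partial>FM \<tau>)"
  proof (rule nn_integral_cong, rule nn_integral_cong)
    fix q r
    have "(\<integral>\<^sup>+t. D t * (F2 q * (F1 (t + q - r) * F3 r)) \<partial>FM \<tau>)
        = (\<integral>\<^sup>+t. (F3 r * F2 q) * (D t * F1 (t + (q - r))) \<partial>FM \<tau>)"
      by (simp add: mult_ac add_diff_eq)
    also have "\<dots> = F3 r * F2 q * E (q - r)"
      unfolding E_def by (rule nn_integral_cmult) measurable
    finally show "(\<integral>\<^sup>+t. D t * (F2 q * (F1 (t + q - r) * F3 r)) \<partial>FM \<tau>) = F3 r * F2 q * E (q - r)" .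
  qed
  also have "\<dots> = (\<integral>\<^sup>+r. (\<integral>\<^sup>+q. F3 r * F2 q * E (q - r) \<partial>FM \<tau>) \<partial>FM \<tau>)"
    by (rule FM_Fubini) measurable
  also have "\<dots> = (\<integral>\<^sup>+r. (\<integral>\<^sup>+y. F3 r * F2 (r + y) * E y \<partial>FM \<tau>) \<partial>FM \<tau>)"
  proof (rule nn_integral_cong)
    fix r
    define h where "h = (\<lambda>q. F3 r * F2 q * E (q - r))"
    have hm: "h \<in> borel_measurable Gam" unfolding h_def by measurable
    have "periodic2 \<tau> h"
      by (rule periodic2I)
        (simp add: h_def periodic2D[OF per(3)] periodic2D[OF periodic2_compose_plus(2)[OF Ep, of r]])
    from nn_integral_FM_shift[OF hm this tau, of r]
    show "(\<integral>\<^sup>+q. F3 r * F2 q * E (q - r) \<partial>FM \<tau>) = (\<integral>\<^sup>+y. F3 r * F2 (r + y) * E y \<partial>FM \<tau>)"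
      by (simp add: h_def add.commute)
  qed
  also have "\<dots> = (\<integral>\<^sup>+y. (\<integral>\<^sup>+r. F3 r * F2 (r + y) * E y \<partial>FM \<tau>) \<partial>FM \<tau>)"
    by (rule FM_Fubini) measurable
  also have "\<dots> = (\<integral>\<^sup>+y. H y * E y \<partial>FM \<tau>)"
    unfolding H_def by (intro nn_integral_cong nn_integral_multc) measurable
  also have "\<dots> = (\<integral>\<^sup>+y. E y * H y \<partial>FM \<tau>)" by (simp only: mult.commute)
  finally have "(\<integral>\<^sup>+t. D t * tri \<tau> F1 F2 F3 t \<partial>FM \<tau>)\<^sup>2
      \<le> (\<integral>\<^sup>+y. (E y)\<^sup>2 \<partial>FM \<tau>) * (\<integral>\<^sup>+y. (H y)\<^sup>2 \<partial>FM \<tau>)"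
    using Cauchy_Schwarz_nn_integral[of E "FM \<tau>" H] by simp
  then show ?thesis
    unfolding E_def H_def using correlation_L2_eq_conv_L2 per tau assms(1-4) by simp
qed

text \<open>A product of two terms of the sequence is at most the square of the later one.\<close>

lemma SUP_square_ennreal:
  fixes f :: "nat \<Rightarrow> ennreal"
  assumes "incseq f"
  shows "(SUP n. f n)\<^sup>2 \<le> (SUP n. (f n)\<^sup>2)"
proof -
  have "(SUP n. f n)\<^sup>2 = (SUP n. (SUP m. f m) * f n)"
    by (simp add: power2_eq_square SUP_mult_left_ennreal)
  also have "\<dots> = (SUP n. SUP m. f m * f n)"
    by (simp add: SUP_mult_right_ennreal)
  also have "\<dots> \<le> (SUP n. (f n)\<^sup>2)"
  proof (intro SUP_least)
    fix n m
    have "f m * f n \<le> (f (max m n))\<^sup>2"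
      unfolding power2_eq_square by (intro mult_mono incseqD[OF assms]) auto
    also have "\<dots> \<le> (SUP n. (f n)\<^sup>2)" by (rule SUP_upper) simp
    finally show "f m * f n \<le> (SUP n. (f n)\<^sup>2)" .
  qed
  finally show ?thesis .
qed

text \<open>Testing \<open>T\<close> against its own truncations, whose norms are finite and can be divided out.\<close>

lemma duality_bound:
  fixes T :: "freq_space \<Rightarrow> ennreal"
  assumes Tm [measurable]: "T \<in> borel_measurable Gam" and Tp: "periodic2 \<tau> T" and tau: "\<tau> > 0" and b: "b \<ge> 0"
    and K: "\<And>D. band_limited \<tau> D \<Longrightarrow> (\<integral>\<^sup>+t. D t * T t \<partial>FM \<tau>)\<^sup>2 \<le> K * bsq \<tau> 0 b D"
  shows "(\<integral>\<^sup>+p. (ennreal (indicat_real (KS \<tau>) (fst p) * wt \<tau> p powr (- b)) * T p)\<^sup>2 \<partial>FM \<tau>) \<le> K"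
proof -
  have [measurable]: "(\<lambda>p. indicat_real (KS \<tau>) (fst p)) \<in> borel_measurable Gam"
    by (rule borel_measurable_of_fst_Gam)
  define c where "c = (\<lambda>p. ennreal (indicat_real (KS \<tau>) (fst p) * wt \<tau> p powr (- b)))"
  have cm [measurable]: "c \<in> borel_measurable Gam" unfolding c_def by measurable
  define Tn where "Tn = (\<lambda>(n::nat) p. min (T p) (of_nat n))"
  have Tnm [measurable]: "Tn n \<in> borel_measurable Gam" for n unfolding Tn_def by measurable
  have bound: "(\<integral>\<^sup>+p. (c p * Tn n p)\<^sup>2 \<partial>FM \<tau>) \<le> K" for n
  proof -
    define X where "X = (\<integral>\<^sup>+p. (c p * Tn n p)\<^sup>2 \<partial>FM \<tau>)"
    \<comment> \<open>With the factor \<open>c\<close> twice, the weight of exponent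
      \<open>b\<close> cancels one of them: \<open>bsq \<tau> 0 b D\<close> equals \<open>X\<close>,
      while the pairing of \<open>D\<close> with \<open>T\<close> is at least
      \<open>X\<close>.\<close>
    define D where "D = (\<lambda>p. c p * c p * Tn n p)"
    have D: "band_limited \<tau> D"
      unfolding band_limited_def
    proof (intro conjI allI impI)
      show "D \<in> borel_measurable Gam" unfolding D_def by measurable
      show "periodic2 \<tau> D"
        by (rule periodic2I) (simp add: D_def c_def Tn_def periodic2D[OF Tp] periodic2D[OF wt_periodic2[OF tau]])
    qed (simp add: D_def c_def)
    have "bsq \<tau> 0 b D = X"
      unfolding bsq_def X_def
    proof (intro nn_integral_cong arg_cong[where f="\<lambda>x. x\<^sup>2"])
      fix p
      have "ennreal (wt \<tau> p powr b) * ennreal (wt \<tau> p powr (- b)) = 1"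
        by (simp add: ennreal_mult[symmetric] powr_add[symmetric] less_imp_neq[OF wt_pos, symmetric])
      then show "ennreal (jf p powr 0 * wt \<tau> p powr b) * D p = c p * Tn n p"
        by (cases "fst p \<in> KS \<tau>")
          (simp_all add: D_def c_def mult.assoc[symmetric] less_imp_neq[OF jf_pos, symmetric])
    qed
    moreover have "X \<le> (\<integral>\<^sup>+t. D t * T t \<partial>FM \<tau>)"
      unfolding X_def
    proof (rule nn_integral_mono)
      fix p
      have "(c p * Tn n p)\<^sup>2 = c p * c p * Tn n p * Tn n p" by (simp add: power2_eq_square mult_ac)
      also have "\<dots> \<le> c p * c p * Tn n p * T p" by (intro mult_left_mono) (auto simp: Tn_def)
      finally show "(c p * Tn n p)\<^sup>2 \<le> D p * T p" by (simp add: D_def)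
    qed
    then have "X\<^sup>2 \<le> (\<integral>\<^sup>+t. D t * T t \<partial>FM \<tau>)\<^sup>2" by (intro power_mono) auto
    \<comment> \<open>Cancelling one factor \<open>X\<close> requires it to be finite, which follows
      from the truncation at \<open>n\<close>, from \<open>b \<ge> 0\<close> and from the finiteness
      of the band.\<close>
    ultimately have XX: "X * X \<le> X * K" using K[OF D] by (simp add: power2_eq_square mult.commute)
    have "X \<le> (\<integral>\<^sup>+p. ennreal (indicat_real (KS \<tau>) (fst p)) * (of_nat n)\<^sup>2 \<partial>FM \<tau>)"
      unfolding X_def
    proof (rule nn_integral_mono)
      fix p
      have "c p \<le> ennreal (indicat_real (KS \<tau>) (fst p))"
      proof -
        have "wt \<tau> p powr (- b) \<le> 1 powr (- b)" using b by (intro powr_mono2' wt_ge_1) auto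
        then show ?thesis unfolding c_def by (intro ennreal_leI) (auto simp: indicator_def)
      qed
      then have "(c p * Tn n p)\<^sup>2 \<le> (ennreal (indicat_real (KS \<tau>) (fst p)) * of_nat n)\<^sup>2"
        by (intro power_mono mult_mono) (auto simp: Tn_def)
      also have "\<dots> = ennreal (indicat_real (KS \<tau>) (fst p)) * (of_nat n)\<^sup>2"
        by (auto simp: power_mult_distrib indicator_def)
      finally show "(c p * Tn n p)\<^sup>2 \<le> ennreal (indicat_real (KS \<tau>) (fst p)) * (of_nat n)\<^sup>2" .
    qed
    also have "\<dots> = (\<integral>\<^sup>+p. ennreal (indicat_real (KS \<tau>) (fst p)) \<partial>FM \<tau>) * (of_nat n)\<^sup>2"
      by (rule nn_integral_multc) measurable
    also have "(\<integral>\<^sup>+p. ennreal (indicat_real (KS \<tau>) (fst p)) \<partial>FM \<tau>)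
        = (\<integral>\<^sup>+k. (\<integral>\<^sup>+\<sigma>. ennreal (indicat_real (KS \<tau>) k) \<partial>cellM \<tau>) \<partial>count_space UNIV)"
      by (subst nn_integral_FM) auto
    also have "\<dots> = (\<Sum>k\<in>KS \<tau>. (\<integral>\<^sup>+\<sigma>. ennreal (indicat_real (KS \<tau>) k) \<partial>cellM \<tau>))"
      by (rule nn_integral_count_space'[OF finite_KS[OF tau]]) auto
    also have "\<dots> = (\<Sum>k\<in>KS \<tau>. ennreal (2 * pi / \<tau>))"
      by (intro sum.cong refl) (simp add: emeasure_cellM[OF tau])
    also have "\<dots> * (of_nat n)\<^sup>2 < \<infinity>"
      by (simp add: ennreal_mult_less_top of_nat_less_top power_less_top_ennreal)
    finally have fin: "X < \<infinity>" .
    show ?thesis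
    proof (cases "X = 0")
      case True then show ?thesis by (simp add: X_def)
    next
      case False
      then have "X \<le> K" using XX fin by (simp add: ennreal_mult_le_mult_iff)
      then show ?thesis by (simp add: X_def)
    qed
  qed
  have incT: "incseq (\<lambda>n. c p * Tn n p)" for p
    by (intro incseq_SucI mult_left_mono) (auto simp: Tn_def min_le_iff_disj intro!: min.mono)
  have lim: "(c p * T p)\<^sup>2 \<le> (SUP n. (c p * Tn n p)\<^sup>2)" for p
  proof -
    have "(SUP n. Tn n p) = T p"
    proof -
      have "(SUP n. Tn n p) = inf (T p) (SUP n. of_nat n)"
        unfolding Tn_def inf_min[symmetric] by (rule inf_SUP[symmetric])
      then show ?thesis by (simp add: ennreal_SUP_of_nat_eq_top)
    qed
    then have "c p * T p = (SUP n. c p * Tn n p)" by (simp add: SUP_mult_left_ennreal[symmetric])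
    then show ?thesis using SUP_square_ennreal[OF incT[of p]] by simp
  qed
  have "(\<integral>\<^sup>+p. (c p * T p)\<^sup>2 \<partial>FM \<tau>) \<le> (\<integral>\<^sup>+p. (SUP n. (c p * Tn n p)\<^sup>2) \<partial>FM \<tau>)"
    by (intro nn_integral_mono lim)
  also have "\<dots> = (SUP n. (\<integral>\<^sup>+p. (c p * Tn n p)\<^sup>2 \<partial>FM \<tau>))"
  proof (rule nn_integral_monotone_convergence_SUP)
    show "incseq (\<lambda>n p. (c p * Tn n p)\<^sup>2)"
      unfolding incseq_def le_fun_def using incseqD[OF incT] by (intro allI impI power_mono) auto
  qed measurable
  also have "\<dots> \<le> K" by (intro SUP_least bound)
  finally show ?thesis by (simp add: c_def)
qed

text \<open>The minimum records one bound for each argument that may lack a spatial weight.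
  Positions 1 and 3 come from the first pairing, the latter after commuting the convolution of
  \<open>F1\<close> and \<open>F3\<close>; position 2 comes from the second pairing. The constant is
  squared because two bilinear estimates are multiplied.\<close>

lemma trilinear_bound:
  fixes s b :: real
  assumes s: "s > 0" and b: "1 / 4 < b" "1 / 2 - s / 4 < b" "b < 1 / 2"
  shows "\<exists>C>0. \<forall>\<tau>>0. \<forall>F1 F2 F3. band_limited \<tau> F1 \<longrightarrow> band_limited \<tau> F2 \<longrightarrow> band_limited \<tau> F3 \<longrightarrow>
    (\<integral>\<^sup>+p. (ennreal (indicat_real (KS \<tau>) (fst p) * wt \<tau> p powr (- b)) * tri \<tau> F1 F2 F3 p)\<^sup>2 \<partial>FM \<tau>)
    \<le> ennreal C * min (bsq \<tau> 0 b F1 * bsq \<tau> s b F2 * bsq \<tau> s b F3)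
        (min (bsq \<tau> s b F1 * bsq \<tau> 0 b F2 * bsq \<tau> s b F3) (bsq \<tau> s b F1 * bsq \<tau> s b F2 * bsq \<tau> 0 b F3))"
proof -
  obtain C where C: "C > 0" "\<And>\<tau> F G. \<tau> > 0 \<Longrightarrow> band_limited \<tau> F \<Longrightarrow> band_limited \<tau> G \<Longrightarrow>
    (\<integral>\<^sup>+t. (conv \<tau> F G t)\<^sup>2 \<partial>FM \<tau>) \<le> ennreal C * bsq \<tau> 0 b F * bsq \<tau> s b G"
    using bilinear_bound[OF assms] by blast
  have "(\<integral>\<^sup>+p. (ennreal (indicat_real (KS \<tau>) (fst p) * wt \<tau> p powr (- b)) * tri \<tau> F1 F2 F3 p)\<^sup>2 \<partial>FM \<tau>)
    \<le> ennreal (C * C) * min (bsq \<tau> 0 b F1 * bsq \<tau> s b F2 * bsq \<tau> s b F3)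
        (min (bsq \<tau> s b F1 * bsq \<tau> 0 b F2 * bsq \<tau> s b F3) (bsq \<tau> s b F1 * bsq \<tau> s b F2 * bsq \<tau> 0 b F3))"
    (is "?X \<le> _")
    if tau: "\<tau> > 0" and F: "band_limited \<tau> F1" "band_limited \<tau> F2" "band_limited \<tau> F3" for \<tau> F1 F2 F3
  proof -
    have Fm [measurable]: "F1 \<in> borel_measurable Gam" "F2 \<in> borel_measurable Gam" "F3 \<in> borel_measurable Gam"
      and Fp: "periodic2 \<tau> F1" "periodic2 \<tau> F2" "periodic2 \<tau> F3" using F by (auto simp: band_limited_def)
    have CC: "ennreal (C * C) = ennreal C * ennreal C" using C(1) by (simp add: ennreal_mult)
    have dual: "?X \<le> ennreal (C * C) * Y"
      if "\<And>D. band_limited \<tau> D \<Longrightarrow> (\<integral>\<^sup>+t. D t * tri \<tau> F1 F2 F3 t \<partial>FM \<tau>)\<^sup>2 \<le> ennreal (C * C) * Y * bsq \<tau> 0 b D" for Y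
      using b by (intro duality_bound that tri_periodic2 Fp tau) auto
    have conv13: "(\<integral>\<^sup>+t. (conv \<tau> F1 F3 t)\<^sup>2 \<partial>FM \<tau>) = (\<integral>\<^sup>+t. (conv \<tau> F3 F1 t)\<^sup>2 \<partial>FM \<tau>)"
      by (simp add: conv_commute[OF Fm(1,3) Fp(1,3) tau])
    have conv23: "(\<integral>\<^sup>+t. (conv \<tau> F3 F2 t)\<^sup>2 \<partial>FM \<tau>) = (\<integral>\<^sup>+t. (conv \<tau> F2 F3 t)\<^sup>2 \<partial>FM \<tau>)"
      by (simp add: conv_commute[OF Fm(2,3) Fp(2,3) tau])
    have 1: "?X \<le> ennreal (C * C) * (bsq \<tau> 0 b F1 * bsq \<tau> s b F2 * bsq \<tau> s b F3)"
    proof (rule dual)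
      fix D assume D: "band_limited \<tau> D"
      then have Dm: "D \<in> borel_measurable Gam" and Dp: "periodic2 \<tau> D" by (auto simp: band_limited_def)
      have "(\<integral>\<^sup>+t. D t * tri \<tau> F1 F2 F3 t \<partial>FM \<tau>)\<^sup>2
          \<le> (\<integral>\<^sup>+z. (conv \<tau> D F2 z)\<^sup>2 \<partial>FM \<tau>) * (\<integral>\<^sup>+z. (conv \<tau> F1 F3 z)\<^sup>2 \<partial>FM \<tau>)"
        by (rule tri_pairing1[OF Dm Fm Dp Fp(1) tau])
      also have "\<dots> \<le> (ennreal C * bsq \<tau> 0 b D * bsq \<tau> s b F2) * (ennreal C * bsq \<tau> 0 b F1 * bsq \<tau> s b F3)"
        by (intro mult_mono C(2) tau D F) auto
      finally show "(\<integral>\<^sup>+t. D t * tri \<tau> F1 F2 F3 t \<partial>FM \<tau>)\<^sup>2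
          \<le> ennreal (C * C) * (bsq \<tau> 0 b F1 * bsq \<tau> s b F2 * bsq \<tau> s b F3) * bsq \<tau> 0 b D"
        by (simp add: CC mult_ac)
    qed
    have 3: "?X \<le> ennreal (C * C) * (bsq \<tau> s b F1 * bsq \<tau> s b F2 * bsq \<tau> 0 b F3)"
    proof (rule dual)
      fix D assume D: "band_limited \<tau> D"
      then have Dm: "D \<in> borel_measurable Gam" and Dp: "periodic2 \<tau> D" by (auto simp: band_limited_def)
      have "(\<integral>\<^sup>+t. D t * tri \<tau> F1 F2 F3 t \<partial>FM \<tau>)\<^sup>2
          \<le> (\<integral>\<^sup>+z. (conv \<tau> D F2 z)\<^sup>2 \<partial>FM \<tau>) * (\<integral>\<^sup>+z. (conv \<tau> F3 F1 z)\<^sup>2 \<partial>FM \<tau>)"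
        unfolding conv13[symmetric] by (rule tri_pairing1[OF Dm Fm Dp Fp(1) tau])
      also have "\<dots> \<le> (ennreal C * bsq \<tau> 0 b D * bsq \<tau> s b F2) * (ennreal C * bsq \<tau> 0 b F3 * bsq \<tau> s b F1)"
        by (intro mult_mono C(2) tau D F) auto
      finally show "(\<integral>\<^sup>+t. D t * tri \<tau> F1 F2 F3 t \<partial>FM \<tau>)\<^sup>2
          \<le> ennreal (C * C) * (bsq \<tau> s b F1 * bsq \<tau> s b F2 * bsq \<tau> 0 b F3) * bsq \<tau> 0 b D"
        by (simp add: CC mult_ac)
    qed
    have 2: "?X \<le> ennreal (C * C) * (bsq \<tau> s b F1 * bsq \<tau> 0 b F2 * bsq \<tau> s b F3)"
    proof (rule dual)
      fix D assume D: "band_limited \<tau> D"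
      then have Dm: "D \<in> borel_measurable Gam" and Dp: "periodic2 \<tau> D" by (auto simp: band_limited_def)
      have "(\<integral>\<^sup>+t. D t * tri \<tau> F1 F2 F3 t \<partial>FM \<tau>)\<^sup>2
          \<le> (\<integral>\<^sup>+z. (conv \<tau> D F1 z)\<^sup>2 \<partial>FM \<tau>) * (\<integral>\<^sup>+z. (conv \<tau> F2 F3 z)\<^sup>2 \<partial>FM \<tau>)"
        unfolding conv23[symmetric] by (rule tri_pairing2[OF Dm Fm Dp Fp tau])
      also have "\<dots> \<le> (ennreal C * bsq \<tau> 0 b D * bsq \<tau> s b F1) * (ennreal C * bsq \<tau> 0 b F2 * bsq \<tau> s b F3)"
        by (intro mult_mono C(2) tau D F) auto
      finally show "(\<integral>\<^sup>+t. D t * tri \<tau> F1 F2 F3 t \<partial>FM \<tau>)\<^sup>2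
          \<le> ennreal (C * C) * (bsq \<tau> s b F1 * bsq \<tau> 0 b F2 * bsq \<tau> s b F3) * bsq \<tau> 0 b D"
        by (simp add: CC mult_ac)
    qed
    show ?thesis unfolding min_def using 1 2 3 by simp
  qed
  moreover have "C * C > 0" using C(1) by simp
  ultimately show ?thesis by blast
qed


section \<open>Distributing the output weight over the three arguments\<close>

lemma band_limited_measurable: "band_limited \<tau> F \<Longrightarrow> F \<in> borel_measurable Gam"
  unfolding band_limited_def by blast

text \<open>Since \<open>p\<close> is \<open>(p + q - r) - q + r\<close>, one of the three brackets
  is at least a third of \<open>jf p\<close>.\<close>

lemma jf_powr_le:
  assumes s: "s \<ge> 0"
  shows "jf p powr s \<le> 3 powr s * (jf (p + q - r) powr s + jf q powr s + jf r powr s)"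
proof -
  have f: "freq (k + l) = freq k + freq l" "freq (k - l) = freq k - freq l" for k l
    by (simp_all add: freq_def)
  define x where "x = freq (fst (p + q - r))"
  define y where "y = freq (fst q)"
  define z where "z = freq (fst r)"
  have e: "freq (fst p) = (x - y) + z" by (simp add: x_def y_def z_def f)
  have "jap ((x - y) + z) \<le> jap (x - y) + jap z" by (rule jap_add_le[OF norm_triangle_ineq])
  also have "jap (x - y) \<le> jap x + jap y" by (rule jap_add_le[OF norm_triangle_ineq4])
  finally have j: "jf p \<le> jf (p + q - r) + jf q + jf r" by (simp add: jf_def e x_def y_def z_def)
  define m where "m = max (jf (p + q - r)) (max (jf q) (jf r))"
  have "jf p \<le> 3 * m" using j by (simp add: m_def)
  then have "jf p powr s \<le> (3 * m) powr s" using s by (intro powr_mono2) (auto simp: less_imp_le)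
  also have "\<dots> = 3 powr s * m powr s" by (simp add: powr_mult m_def less_imp_le le_max_iff_disj)
  also have "m powr s \<le> jf (p + q - r) powr s + jf q powr s + jf r powr s"
    by (simp add: m_def max_def)
  finally show ?thesis by simp
qed

lemma sum3_square_le_ennreal: "(a + b + c)\<^sup>2 \<le> 9 * (a\<^sup>2 + b\<^sup>2 + c\<^sup>2 :: ennreal)"
proof -
  define m where "m = max a (max b c)"
  have "a + b + c \<le> m + m + m" by (intro add_mono) (auto simp: m_def le_max_iff_disj)
  also have "\<dots> = (1 + 1 + 1) * m" by (simp only: distrib_right mult_1)
  also have "(1 + 1 + 1 :: ennreal) = 3" by simp
  finally have "(a + b + c)\<^sup>2 \<le> (3 * m)\<^sup>2" by (intro power_mono) auto
  also have "\<dots> = 9 * m\<^sup>2" by (simp add: power_mult_distrib)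
  also have "m\<^sup>2 \<le> a\<^sup>2 + b\<^sup>2 + c\<^sup>2" 
    by (auto simp: m_def max_def add_increasing add_increasing2)
  finally show ?thesis by (simp add: mult_left_mono)
qed

text \<open>By positivity the weight of the output frequency can be moved to the input frequencies.
  The argument that receives it takes the weightless place in \<open>trilinear_bound\<close>: the
  \<open>(0, b)\<close> norm of the weighted function is the \<open>(s, b)\<close> norm of the
  original one. The three terms use the three entries of the minimum.\<close>

lemma weighted_trilinear_bound:
  fixes s b :: real
  assumes s: "s > 0" and b: "1 / 4 < b" "1 / 2 - s / 4 < b" "b < 1 / 2"
  shows "\<exists>C>0. \<forall>\<tau>>0. \<forall>F1 F2 F3. band_limited \<tau> F1 \<longrightarrow> band_limited \<tau> F2 \<longrightarrow> band_limited \<tau> F3 \<longrightarrow>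
    (\<integral>\<^sup>+p. (ennreal (indicat_real (KS \<tau>) (fst p) * (jf p powr s * wt \<tau> p powr (- b))) * tri \<tau> F1 F2 F3 p)\<^sup>2 \<partial>FM \<tau>)
    \<le> ennreal C * (bsq \<tau> s b F1 * bsq \<tau> s b F2 * bsq \<tau> s b F3)"
proof -
  obtain C where C: "C > 0" "\<And>\<tau> F1 F2 F3. \<tau> > 0 \<Longrightarrow> band_limited \<tau> F1 \<Longrightarrow> band_limited \<tau> F2 \<Longrightarrow> band_limited \<tau> F3 \<Longrightarrow>
    (\<integral>\<^sup>+p. (ennreal (indicat_real (KS \<tau>) (fst p) * wt \<tau> p powr (- b)) * tri \<tau> F1 F2 F3 p)\<^sup>2 \<partial>FM \<tau>)
    \<le> ennreal C * min (bsq \<tau> 0 b F1 * bsq \<tau> s b F2 * bsq \<tau> s b F3)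
        (min (bsq \<tau> s b F1 * bsq \<tau> 0 b F2 * bsq \<tau> s b F3) (bsq \<tau> s b F1 * bsq \<tau> s b F2 * bsq \<tau> 0 b F3))"
    using trilinear_bound[OF assms] by blast
  define c where "c = 3 powr s"
  have c0: "c > 0" by (simp add: c_def)
  \<comment> \<open>\<open>9 * c\<^sup>2\<close> comes from squaring a sum of three terms with
    factor \<open>c\<close>, and each of the three terms contributes one \<open>C\<close>.\<close>
  define C' where "C' = 27 * c\<^sup>2 * C"
  have "(\<integral>\<^sup>+p. (ennreal (indicat_real (KS \<tau>) (fst p) * (jf p powr s * wt \<tau> p powr (- b))) * tri \<tau> F1 F2 F3 p)\<^sup>2 \<partial>FM \<tau>)
    \<le> ennreal C' * (bsq \<tau> s b F1 * bsq \<tau> s b F2 * bsq \<tau> s b F3)"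
    if tau: "\<tau> > 0" and F: "band_limited \<tau> F1" "band_limited \<tau> F2" "band_limited \<tau> F3" for \<tau> F1 F2 F3
  proof -
    have Fm [measurable]: "F1 \<in> borel_measurable Gam" "F2 \<in> borel_measurable Gam" "F3 \<in> borel_measurable Gam"
      using F by (auto simp: band_limited_def)
    define W where "W = (\<lambda>F (p::freq_space). ennreal (jf p powr s) * F p)"
    have WB: "band_limited \<tau> (W F)" if "band_limited \<tau> F" for F
    proof -
      have [measurable]: "F \<in> borel_measurable Gam" using that by (simp add: band_limited_def)
      have per: "periodic2 \<tau> F" using that by (simp add: band_limited_def)
      show ?thesis unfolding band_limited_def
      proof (intro conjI allI impI)
        show "W F \<in> borel_measurable Gam" unfolding W_def by measurable
        show "periodic2 \<tau> (W F)"
          by (rule periodic2I) (simp add: W_def periodic2D[OF per] periodic2D[OF jf_periodic2])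
      qed (simp add: W_def band_limited_outside[OF that])
    qed
    have Wm [measurable]: "W F1 \<in> borel_measurable Gam" "W F2 \<in> borel_measurable Gam" "W F3 \<in> borel_measurable Gam"
      by (rule band_limited_measurable[OF WB[OF F(1)]], rule band_limited_measurable[OF WB[OF F(2)]],
          rule band_limited_measurable[OF WB[OF F(3)]])
    have Wb: "bsq \<tau> 0 b (W F) = bsq \<tau> s b F" for F
      unfolding bsq_def W_def
      by (intro nn_integral_cong) (simp add: ennreal_mult less_imp_neq[OF jf_pos, symmetric] mult_ac)
    \<comment> \<open>The unfolded integral shows the three frequencies \<open>q\<close>,
      \<open>r\<close> and \<open>p + q - r\<close>, so that the weight of \<open>p\<close> can be
      estimated under both integral signs.\<close>
    define I where "I = (\<lambda>F1 F2 F3 p. \<integral>\<^sup>+q. (\<integral>\<^sup>+r. F2 q * (F1 (p + q - r) * F3 r) \<partial>FM \<tau>) \<partial>FM \<tau>)"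
    have tI: "tri \<tau> F1 F2 F3 p = I F1 F2 F3 p" 
      if [measurable]: "F1 \<in> borel_measurable Gam" "F2 \<in> borel_measurable Gam" "F3 \<in> borel_measurable Gam"
      for F1 F2 F3 p
      unfolding tri_def conv_def I_def by (intro nn_integral_cong nn_integral_cmult[symmetric]) measurable
    have pt: "ennreal (jf p powr s) * tri \<tau> F1 F2 F3 p
        \<le> ennreal c * (tri \<tau> (W F1) F2 F3 p + tri \<tau> F1 (W F2) F3 p + tri \<tau> F1 F2 (W F3) p)" for p
    proof -
      have "ennreal (jf p powr s) * tri \<tau> F1 F2 F3 p
          = (\<integral>\<^sup>+q. ennreal (jf p powr s) * (\<integral>\<^sup>+r. F2 q * (F1 (p + q - r) * F3 r) \<partial>FM \<tau>) \<partial>FM \<tau>)"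
        unfolding tI[OF Fm] I_def by (rule nn_integral_cmult[symmetric]) measurable
      also have "\<dots> = (\<integral>\<^sup>+q. (\<integral>\<^sup>+r. ennreal (jf p powr s) * (F2 q * (F1 (p + q - r) * F3 r)) \<partial>FM \<tau>) \<partial>FM \<tau>)"
        by (intro nn_integral_cong nn_integral_cmult[symmetric]) measurable
      also have "\<dots> \<le> (\<integral>\<^sup>+q. (\<integral>\<^sup>+r. ennreal c * (F2 q * (W F1 (p + q - r) * F3 r)
          + W F2 q * (F1 (p + q - r) * F3 r) + F2 q * (F1 (p + q - r) * W F3 r)) \<partial>FM \<tau>) \<partial>FM \<tau>)"
      proof (intro nn_integral_mono)
        fix q r
        have "ennreal (jf p powr s) \<le> ennreal c * (ennreal (jf (p + q - r) powr s) + ennreal (jf q powr s) + ennreal (jf r powr s))"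
          using jf_powr_le[of s p q r] s c0
          by (simp add: c_def ennreal_plus[symmetric] ennreal_mult[symmetric] ennreal_leI del: ennreal_plus)
        then have "ennreal (jf p powr s) * (F2 q * (F1 (p + q - r) * F3 r))
          \<le> ennreal c * (ennreal (jf (p + q - r) powr s) + ennreal (jf q powr s) + ennreal (jf r powr s))
             * (F2 q * (F1 (p + q - r) * F3 r))" by (rule mult_right_mono) simp
        then show "ennreal (jf p powr s) * (F2 q * (F1 (p + q - r) * F3 r))
          \<le> ennreal c * (F2 q * (W F1 (p + q - r) * F3 r)
            + W F2 q * (F1 (p + q - r) * F3 r) + F2 q * (F1 (p + q - r) * W F3 r))"
          by (simp add: W_def distrib_left distrib_right mult_ac)
      qed
      also have "\<dots> = (\<integral>\<^sup>+q. ennreal c * ((\<integral>\<^sup>+r. F2 q * (W F1 (p + q - r) * F3 r) \<partial>FM \<tau>)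
          + (\<integral>\<^sup>+r. W F2 q * (F1 (p + q - r) * F3 r) \<partial>FM \<tau>) + (\<integral>\<^sup>+r. F2 q * (F1 (p + q - r) * W F3 r) \<partial>FM \<tau>)) \<partial>FM \<tau>)"
        by (intro nn_integral_cong) (simp add: nn_integral_cmult nn_integral_add)
      also have "\<dots> = ennreal c * (I (W F1) F2 F3 p + I F1 (W F2) F3 p + I F1 F2 (W F3) p)"
        unfolding I_def by (simp add: nn_integral_cmult nn_integral_add)
      finally show ?thesis by (simp add: tI)
    qed
    define A where "A = (\<lambda>p. ennreal (indicat_real (KS \<tau>) (fst p) * wt \<tau> p powr (- b)))"
    have [measurable]: "(\<lambda>p. indicat_real (KS \<tau>) (fst p)) \<in> borel_measurable Gam"
      by (rule borel_measurable_of_fst_Gam)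
    have Am [measurable]: "A \<in> borel_measurable Gam" unfolding A_def by measurable
    define B where "B = bsq \<tau> s b F1 * bsq \<tau> s b F2 * bsq \<tau> s b F3"
    have e1: "(\<integral>\<^sup>+p. (A p * tri \<tau> (W F1) F2 F3 p)\<^sup>2 \<partial>FM \<tau>) \<le> ennreal C * B"
    proof -
      have "(\<integral>\<^sup>+p. (A p * tri \<tau> (W F1) F2 F3 p)\<^sup>2 \<partial>FM \<tau>) \<le> ennreal C * (bsq \<tau> 0 b (W F1) * bsq \<tau> s b F2 * bsq \<tau> s b F3)"
        unfolding A_def by (rule order_trans[OF C(2)[OF tau WB[OF F(1)] F(2,3)]]) (intro mult_left_mono, auto)
      then show ?thesis by (simp add: B_def Wb)
    qed
    have e2: "(\<integral>\<^sup>+p. (A p * tri \<tau> F1 (W F2) F3 p)\<^sup>2 \<partial>FM \<tau>) \<le> ennreal C * B"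
    proof -
      have "(\<integral>\<^sup>+p. (A p * tri \<tau> F1 (W F2) F3 p)\<^sup>2 \<partial>FM \<tau>) \<le> ennreal C * (bsq \<tau> s b F1 * bsq \<tau> 0 b (W F2) * bsq \<tau> s b F3)"
        unfolding A_def by (rule order_trans[OF C(2)[OF tau F(1) WB[OF F(2)] F(3)]])
          (intro mult_left_mono, auto simp: min_le_iff_disj)
      then show ?thesis by (simp add: B_def Wb)
    qed
    have e3: "(\<integral>\<^sup>+p. (A p * tri \<tau> F1 F2 (W F3) p)\<^sup>2 \<partial>FM \<tau>) \<le> ennreal C * B"
    proof -
      have "(\<integral>\<^sup>+p. (A p * tri \<tau> F1 F2 (W F3) p)\<^sup>2 \<partial>FM \<tau>) \<le> ennreal C * (bsq \<tau> s b F1 * bsq \<tau> s b F2 * bsq \<tau> 0 b (W F3))"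
        unfolding A_def by (rule order_trans[OF C(2)[OF tau F(1,2) WB[OF F(3)]]])
          (intro mult_left_mono, auto simp: min_le_iff_disj)
      then show ?thesis by (simp add: B_def Wb)
    qed
    have "(\<integral>\<^sup>+p. (ennreal (indicat_real (KS \<tau>) (fst p) * (jf p powr s * wt \<tau> p powr (- b))) * tri \<tau> F1 F2 F3 p)\<^sup>2 \<partial>FM \<tau>)
        \<le> (\<integral>\<^sup>+p. ennreal (9 * c\<^sup>2) * ((A p * tri \<tau> (W F1) F2 F3 p)\<^sup>2 + (A p * tri \<tau> F1 (W F2) F3 p)\<^sup>2
            + (A p * tri \<tau> F1 F2 (W F3) p)\<^sup>2) \<partial>FM \<tau>)"
    proof (rule nn_integral_mono)
      fix p
      define t1 where "t1 = A p * tri \<tau> (W F1) F2 F3 p"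
      define t2 where "t2 = A p * tri \<tau> F1 (W F2) F3 p"
      define t3 where "t3 = A p * tri \<tau> F1 F2 (W F3) p"
      have "ennreal (indicat_real (KS \<tau>) (fst p) * (jf p powr s * wt \<tau> p powr (- b))) * tri \<tau> F1 F2 F3 p
          = A p * (ennreal (jf p powr s) * tri \<tau> F1 F2 F3 p)"
        by (simp add: A_def ennreal_mult mult_ac)
      also have "\<dots> \<le> A p * (ennreal c * (tri \<tau> (W F1) F2 F3 p + tri \<tau> F1 (W F2) F3 p + tri \<tau> F1 F2 (W F3) p))"
        by (intro mult_left_mono pt) auto
      also have "\<dots> = ennreal c * (t1 + t2 + t3)" by (simp add: t1_def t2_def t3_def distrib_left mult_ac)
      finally have "(ennreal (indicat_real (KS \<tau>) (fst p) * (jf p powr s * wt \<tau> p powr (- b))) * tri \<tau> F1 F2 F3 p)\<^sup>2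
          \<le> (ennreal c * (t1 + t2 + t3))\<^sup>2" by (intro power_mono) auto
      also have "\<dots> = (ennreal c)\<^sup>2 * (t1 + t2 + t3)\<^sup>2" by (simp add: power_mult_distrib)
      also have "\<dots> \<le> (ennreal c)\<^sup>2 * (9 * (t1\<^sup>2 + t2\<^sup>2 + t3\<^sup>2))"
        by (intro mult_left_mono sum3_square_le_ennreal) auto
      also have "\<dots> = ennreal (9 * c\<^sup>2) * (t1\<^sup>2 + t2\<^sup>2 + t3\<^sup>2)"
        using c0 by (simp add: ennreal_mult ennreal_power distrib_left mult_ac)
      finally show "(ennreal (indicat_real (KS \<tau>) (fst p) * (jf p powr s * wt \<tau> p powr (- b))) * tri \<tau> F1 F2 F3 p)\<^sup>2
          \<le> ennreal (9 * c\<^sup>2) * ((A p * tri \<tau> (W F1) F2 F3 p)\<^sup>2 + (A p * tri \<tau> F1 (W F2) F3 p)\<^sup>2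
            + (A p * tri \<tau> F1 F2 (W F3) p)\<^sup>2)" unfolding t1_def t2_def t3_def .
    qed
    also have "\<dots> = ennreal (9 * c\<^sup>2) * ((\<integral>\<^sup>+p. (A p * tri \<tau> (W F1) F2 F3 p)\<^sup>2 \<partial>FM \<tau>)
        + (\<integral>\<^sup>+p. (A p * tri \<tau> F1 (W F2) F3 p)\<^sup>2 \<partial>FM \<tau>) + (\<integral>\<^sup>+p. (A p * tri \<tau> F1 F2 (W F3) p)\<^sup>2 \<partial>FM \<tau>))"
      by (simp add: nn_integral_cmult nn_integral_add)
    also have "\<dots> \<le> ennreal (9 * c\<^sup>2) * (ennreal C * B + ennreal C * B + ennreal C * B)"
      by (intro mult_left_mono add_mono e1 e2 e3) auto
    also have "\<dots> = ennreal (9 * c\<^sup>2) * (ennreal (C + C + C) * B)"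
    proof -
      have "ennreal (C + C + C) = ennreal C + ennreal C + ennreal C" using C(1) by (simp only: ennreal_plus add_nonneg_nonneg less_imp_le)
      then show ?thesis by (simp only: distrib_right)
    qed
    also have "\<dots> = ennreal C' * B"
    proof -
      have "ennreal (9 * c\<^sup>2) * ennreal (C + C + C) = ennreal C'"
        using C(1) by (subst ennreal_mult[symmetric]) (auto simp: C'_def)
      then show ?thesis by (simp only: mult.assoc[symmetric])
    qed
    finally show ?thesis by (simp add: B_def)
  qed
  moreover have "C' > 0" using C(1) c0 by (simp add: C'_def)
  ultimately show ?thesis by blast
qed


subsection \<open>Square summable Fourier series in time\<close>

lemma cellM_density_real: "cellM \<tau> = density lborel (\<lambda>x. ennreal (indicat_real (time_cell \<tau>) x))"
  by (simp add: cellM_def ennreal_indicator)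

lemma set_integrable_time_cell_iff:
  fixes f :: "real \<Rightarrow> 'b::{banach, second_countable_topology}"
  assumes "f \<in> borel_measurable borel"
  shows "set_integrable lborel (time_cell \<tau>) f \<longleftrightarrow> integrable (cellM \<tau>) f"
  unfolding cellM_density_real set_integrable_def
  by (subst integrable_density) (use assms in auto)

lemma set_integral_time_cell_eq:
  fixes f :: "real \<Rightarrow> 'b::{banach, second_countable_topology}"
  assumes "f \<in> borel_measurable borel"
  shows "(LINT x:time_cell \<tau>|lborel. f x) = (\<integral>x. f x \<partial>cellM \<tau>)"
  unfolding cellM_density_real set_lebesgue_integral_def
  by (subst integral_density) (use assms in auto)

text \<open>Measurability on the whole line makes translates and reflections available; only the
  square integrability refers to one period.\<close>

definition L2c :: "real \<Rightarrow> (real \<Rightarrow> complex) \<Rightarrow> bool" where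
  "L2c \<tau> f \<longleftrightarrow> f \<in> borel_measurable borel \<and> integrable (cellM \<tau>) (\<lambda>x. (cmod (f x))\<^sup>2)"

definition nrm :: "real \<Rightarrow> (real \<Rightarrow> complex) \<Rightarrow> real" where
  "nrm \<tau> f = sqrt (\<integral>x. (cmod (f x))\<^sup>2 \<partial>cellM \<tau>)"

lemma L2c_measurable: "L2c \<tau> f \<Longrightarrow> f \<in> borel_measurable borel"
  by (simp add: L2c_def)

lemma L2c_integrable: "L2c \<tau> f \<Longrightarrow> integrable (cellM \<tau>) (\<lambda>x. (cmod (f x))\<^sup>2)"
  by (simp add: L2c_def)

lemma nrm_nonneg [simp]: "nrm \<tau> f \<ge> 0"
  by (simp add: nrm_def)

lemma nrm_sq: "(nrm \<tau> f)\<^sup>2 = (\<integral>x. (cmod (f x))\<^sup>2 \<partial>cellM \<tau>)"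
  by (simp add: nrm_def)

lemma nn_integral_L2c: "L2c \<tau> f \<Longrightarrow> (\<integral>\<^sup>+x. ennreal ((cmod (f x))\<^sup>2) \<partial>cellM \<tau>) = ennreal ((nrm \<tau> f)\<^sup>2)"
  unfolding nrm_sq by (rule nn_integral_eq_integral) (auto simp: L2c_def)

lemma L2c_of_nn_integral_eq:
  assumes f: "L2c \<tau> f" and g: "g \<in> borel_measurable borel"
    and eq: "(\<integral>\<^sup>+x. ennreal ((cmod (g x))\<^sup>2) \<partial>cellM \<tau>) = (\<integral>\<^sup>+x. ennreal ((cmod (f x))\<^sup>2) \<partial>cellM \<tau>)"
  shows "L2c \<tau> g" "nrm \<tau> g = nrm \<tau> f"
proof -
  have gm: "(\<lambda>x. (cmod (g x))\<^sup>2) \<in> borel_measurable (cellM \<tau>)" using g by measurable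
  have "(\<integral>\<^sup>+x. ennreal ((cmod (g x))\<^sup>2) \<partial>cellM \<tau>) < \<infinity>" using eq nn_integral_L2c[OF f] by simp
  then show L: "L2c \<tau> g" unfolding L2c_def using g gm by (auto intro!: integrableI_nonneg)
  show "nrm \<tau> g = nrm \<tau> f" using nn_integral_L2c[OF f] nn_integral_L2c[OF L] eq by simp
qed

lemma L2c_bounded:
  assumes "f \<in> borel_measurable borel" "\<And>x. cmod (f x) \<le> B"
  shows "L2c \<tau> f"
proof -
  interpret finite_measure "cellM \<tau>" by (rule finite_measure_cellM)
  have "integrable (cellM \<tau>) (\<lambda>x. (cmod (f x))\<^sup>2)"
  proof (rule integrable_const_bound)
    show "AE x in cellM \<tau>. norm ((cmod (f x))\<^sup>2) \<le> B\<^sup>2"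
      using assms(2) by (intro AE_I2) (auto intro!: power_mono)
  qed (use assms in measurable)
  then show ?thesis using assms by (simp add: L2c_def)
qed

lemma cmod_add_sq_le: "(cmod (x + y))\<^sup>2 \<le> 2 * (cmod x)\<^sup>2 + 2 * (cmod y)\<^sup>2"
proof -
  have "(cmod (x + y))\<^sup>2 \<le> (cmod x + cmod y)\<^sup>2" by (intro power_mono norm_triangle_ineq) auto
  also have "\<dots> \<le> 2 * (cmod x)\<^sup>2 + 2 * (cmod y)\<^sup>2"
    using sum_squares_ge_zero[of "cmod x - cmod y" 0] by (simp add: power2_eq_square algebra_simps)
  finally show ?thesis .
qed

lemma L2c_add:
  assumes "L2c \<tau> f" "L2c \<tau> g"
  shows "L2c \<tau> (\<lambda>x. f x + g x)" "(nrm \<tau> (\<lambda>x. f x + g x))\<^sup>2 \<le> 2 * (nrm \<tau> f)\<^sup>2 + 2 * (nrm \<tau> g)\<^sup>2"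
proof -
  have m [measurable]: "f \<in> borel_measurable borel" "g \<in> borel_measurable borel" using assms by (auto simp: L2c_def)
  have int: "integrable (cellM \<tau>) (\<lambda>x. 2 * (cmod (f x))\<^sup>2 + 2 * (cmod (g x))\<^sup>2)"
    using assms by (auto simp: L2c_def)
  have int2: "integrable (cellM \<tau>) (\<lambda>x. (cmod (f x + g x))\<^sup>2)"
    by (rule Bochner_Integration.integrable_bound[OF int]) (auto intro!: cmod_add_sq_le)
  then show "L2c \<tau> (\<lambda>x. f x + g x)" by (simp add: L2c_def)
  have "(nrm \<tau> (\<lambda>x. f x + g x))\<^sup>2 \<le> (\<integral>x. 2 * (cmod (f x))\<^sup>2 + 2 * (cmod (g x))\<^sup>2 \<partial>cellM \<tau>)"
    unfolding nrm_sq by (intro integral_mono int int2 cmod_add_sq_le)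
  also have "\<dots> = 2 * (nrm \<tau> f)\<^sup>2 + 2 * (nrm \<tau> g)\<^sup>2"
    unfolding nrm_sq using assms by (subst Bochner_Integration.integral_add) (auto simp: L2c_def)
  finally show "(nrm \<tau> (\<lambda>x. f x + g x))\<^sup>2 \<le> 2 * (nrm \<tau> f)\<^sup>2 + 2 * (nrm \<tau> g)\<^sup>2" .
qed

lemma L2c_cmult:
  assumes "L2c \<tau> f"
  shows "L2c \<tau> (\<lambda>x. c * f x)" "nrm \<tau> (\<lambda>x. c * f x) = cmod c * nrm \<tau> f"
  using assms by (auto simp: L2c_def nrm_def norm_mult power_mult_distrib real_sqrt_mult)

lemma L2c_diff:
  assumes "L2c \<tau> f" "L2c \<tau> g"
  shows "L2c \<tau> (\<lambda>x. f x - g x)" "(nrm \<tau> (\<lambda>x. f x - g x))\<^sup>2 \<le> 2 * (nrm \<tau> f)\<^sup>2 + 2 * (nrm \<tau> g)\<^sup>2"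
  using L2c_add[OF assms(1) L2c_cmult(1)[OF assms(2), of "-1"]] L2c_cmult(2)[OF assms(2), of "-1"] by auto

lemma L2c_cnj:
  assumes "L2c \<tau> f"
  shows "L2c \<tau> (\<lambda>x. cnj (f x))" "nrm \<tau> (\<lambda>x. cnj (f x)) = nrm \<tau> f"
proof -
  have [measurable]: "f \<in> borel_measurable borel" using assms by (rule L2c_measurable)
  have "(\<lambda>x. cnj (f x)) \<in> borel_measurable borel"
    by (rule borel_measurable_continuous_on[where f=cnj]) (auto intro: continuous_intros)
  then show "L2c \<tau> (\<lambda>x. cnj (f x))" "nrm \<tau> (\<lambda>x. cnj (f x)) = nrm \<tau> f"
    using assms by (auto simp: L2c_def nrm_def)
qed

lemma L2c_shift:
  assumes f: "L2c \<tau> f" and per: "\<And>x. f (x + 2 * pi / \<tau>) = f x" and tau: "\<tau> > 0"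
  shows "L2c \<tau> (\<lambda>x. f (c + x))" "nrm \<tau> (\<lambda>x. f (c + x)) = nrm \<tau> f"
proof -
  have [measurable]: "f \<in> borel_measurable borel" using f by (rule L2c_measurable)
  have "(\<integral>\<^sup>+x. ennreal ((cmod (f (x + c)))\<^sup>2) \<partial>cellM \<tau>) = (\<integral>\<^sup>+x. ennreal ((cmod (f x))\<^sup>2) \<partial>cellM \<tau>)"
    by (rule nn_integral_cellM_shift[of "\<lambda>x. ennreal ((cmod (f x))\<^sup>2)"]) (use per tau in auto)
  then have "(\<integral>\<^sup>+x. ennreal ((cmod (f (c + x)))\<^sup>2) \<partial>cellM \<tau>) = (\<integral>\<^sup>+x. ennreal ((cmod (f x))\<^sup>2) \<partial>cellM \<tau>)"
    by (simp add: add.commute)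
  from L2c_of_nn_integral_eq[OF f _ this]
  show "L2c \<tau> (\<lambda>x. f (c + x))" "nrm \<tau> (\<lambda>x. f (c + x)) = nrm \<tau> f" by auto
qed

lemma L2c_reflect:
  assumes f: "L2c \<tau> f"
  shows "L2c \<tau> (\<lambda>x. f (- x))" "nrm \<tau> (\<lambda>x. f (- x)) = nrm \<tau> f"
proof -
  have [measurable]: "f \<in> borel_measurable borel" using f by (rule L2c_measurable)
  have "(\<integral>\<^sup>+x. ennreal ((cmod (f (- x)))\<^sup>2) \<partial>cellM \<tau>) = (\<integral>\<^sup>+x. ennreal ((cmod (f x))\<^sup>2) \<partial>cellM \<tau>)"
    by (rule nn_integral_cellM_minus[of "\<lambda>x. ennreal ((cmod (f x))\<^sup>2)"]) measurable
  from L2c_of_nn_integral_eq[OF f _ this]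
  show "L2c \<tau> (\<lambda>x. f (- x))" "nrm \<tau> (\<lambda>x. f (- x)) = nrm \<tau> f" by auto
qed

lemma L2c_Cauchy_Schwarz:
  assumes f: "L2c \<tau> f" and g: "L2c \<tau> g"
  shows "integrable (cellM \<tau>) (\<lambda>x. f x * g x)" "cmod (\<integral>x. f x * g x \<partial>cellM \<tau>) \<le> nrm \<tau> f * nrm \<tau> g"
proof -
  have m [measurable]: "f \<in> borel_measurable borel" "g \<in> borel_measurable borel" using f g by (auto simp: L2c_def)
  have int: "integrable (cellM \<tau>) (\<lambda>x. (cmod (f x))\<^sup>2 + (cmod (g x))\<^sup>2)"
    using f g by (auto simp: L2c_def)
  have le: "cmod (f x) * cmod (g x) \<le> (cmod (f x))\<^sup>2 + (cmod (g x))\<^sup>2" for x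
  proof -
    have "2 * (cmod (f x) * cmod (g x)) \<le> (cmod (f x))\<^sup>2 + (cmod (g x))\<^sup>2"
      using sum_squares_bound[of "cmod (f x)" "cmod (g x)"] by simp
    moreover have "0 \<le> cmod (f x) * cmod (g x)" by simp
    ultimately show ?thesis by linarith
  qed
  show I: "integrable (cellM \<tau>) (\<lambda>x. f x * g x)"
    by (rule Bochner_Integration.integrable_bound[OF int]) (auto simp: norm_mult intro!: le)
  define A where "A = (\<integral>x. cmod (f x) * cmod (g x) \<partial>cellM \<tau>)"
  have IA: "integrable (cellM \<tau>) (\<lambda>x. cmod (f x) * cmod (g x))"
    using integrable_norm[OF I] by (simp add: norm_mult)
  have A0: "A \<ge> 0" unfolding A_def by (intro integral_nonneg_AE) auto
  have "ennreal A = (\<integral>\<^sup>+x. ennreal (cmod (f x)) * ennreal (cmod (g x)) \<partial>cellM \<tau>)"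
    unfolding A_def by (subst nn_integral_eq_integral[OF IA, symmetric]) (auto simp: ennreal_mult)
  then have "(ennreal A)\<^sup>2 \<le> (\<integral>\<^sup>+x. (ennreal (cmod (f x)))\<^sup>2 \<partial>cellM \<tau>) * (\<integral>\<^sup>+x. (ennreal (cmod (g x)))\<^sup>2 \<partial>cellM \<tau>)"
    using Cauchy_Schwarz_nn_integral[of "\<lambda>x. ennreal (cmod (f x))" "cellM \<tau>" "\<lambda>x. ennreal (cmod (g x))"] by simp
  also have "\<dots> = ennreal ((nrm \<tau> f)\<^sup>2) * ennreal ((nrm \<tau> g)\<^sup>2)"
    using nn_integral_L2c[OF f] nn_integral_L2c[OF g] by (simp add: ennreal_power)
  finally have "ennreal (A\<^sup>2) \<le> ennreal ((nrm \<tau> f * nrm \<tau> g)\<^sup>2)"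
    using A0 by (simp add: ennreal_power ennreal_mult[symmetric] power_mult_distrib)
  then have "A\<^sup>2 \<le> (nrm \<tau> f * nrm \<tau> g)\<^sup>2" by (simp add: ennreal_le_iff)
  then have "A \<le> nrm \<tau> f * nrm \<tau> g" by (rule power2_le_imp_le) simp
  moreover have "cmod (\<integral>x. f x * g x \<partial>cellM \<tau>) \<le> A"
    unfolding A_def using integral_norm_bound[of "cellM \<tau>" "\<lambda>x. f x * g x"] by (simp add: norm_mult)
  ultimately show "cmod (\<integral>x. f x * g x \<partial>cellM \<tau>) \<le> nrm \<tau> f * nrm \<tau> g" by linarith
qed

lemma integral_cis_period:
  assumes L: "L > 0" and m: "m \<noteq> (0::int)"
  shows "(\<integral>x. indicat_real {- pi / L..pi / L} x *\<^sub>R cis (of_int m * L * x) \<partial>lborel) = 0"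
proof -
  define c where "c = of_int m * L"
  have c: "c \<noteq> 0" using L m by (simp add: c_def)
  define F where "F = (\<lambda>x. (- \<i> / of_real c) * cis (c * x))"
  have "has_bochner_integral lborel (\<lambda>x. indicat_real {- pi / L..pi / L} x *\<^sub>R cis (c * x)) (F (pi / L) - F (- pi / L))"
  proof (rule has_bochner_integral_FTC_Icc)
    show "- pi / L \<le> pi / L" using L by (simp add: divide_right_mono)
    show "(F has_vector_derivative cis (c * x)) (at x within {- pi / L..pi / L})" for x
    proof -
      have "((\<lambda>x. cis (c * x)) has_vector_derivative (c *\<^sub>R (\<i> * cis (c * x)))) (at x within {- pi / L..pi / L})"
        unfolding has_vector_derivative_def
        by (rule derivative_eq_intros refl | simp add: scaleR_conv_of_real mult_ac)+
      then have "(F has_vector_derivative (- \<i> / of_real c) * (c *\<^sub>R (\<i> * cis (c * x)))) (at x within {- pi / L..pi / L})"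
        unfolding F_def by (rule has_vector_derivative_mult_right)
      then show ?thesis using c by (simp add: scaleR_conv_of_real mult_ac)
    qed
    show "continuous_on {- pi / L..pi / L} (\<lambda>x. cis (c * x))" by (intro continuous_intros)
  qed
  moreover have "F (pi / L) - F (- pi / L) = 0"
  proof -
    have e: "c * (pi / L) = of_int m * pi" "c * (- pi / L) = - (of_int m * pi)" using L by (auto simp: c_def)
    have "cis (of_int m * pi) = cis (- (of_int m * pi))"
      by (rule complex_eqI) (auto simp: mult.commute[of _ pi] sin_npi_int)
    then show ?thesis unfolding F_def e by simp
  qed
  ultimately show ?thesis unfolding c_def by (metis has_bochner_integral_integral_eq)
qed

lemma integral_cis_cellM:
  assumes tau: "\<tau> > 0"
  shows "(\<integral>x. cis (of_int m * \<tau> * x) \<partial>cellM \<tau>) = (if m = 0 then of_real (2 * pi / \<tau>) else 0)"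
proof (cases "m = 0")
  case True
  have "measure (cellM \<tau>) UNIV = 2 * pi / \<tau>"
    unfolding measure_def emeasure_cellM[OF tau] using tau by simp
  then show ?thesis using True by (simp add: scaleR_conv_of_real)
next
  case False
  have cm: "(\<lambda>x. cis (of_int m * \<tau> * x)) \<in> borel_measurable borel"
    by (intro borel_measurable_continuous_onI continuous_intros)
  have "(\<integral>x. cis (of_int m * \<tau> * x) \<partial>cellM \<tau>) = (LINT x:time_cell \<tau>|lborel. cis (of_int m * \<tau> * x))"
    by (rule set_integral_time_cell_eq[symmetric, OF cm])
  also have "\<dots> = (\<integral>x. indicat_real {- pi / \<tau>..pi / \<tau>} x *\<^sub>R cis (of_int m * \<tau> * x) \<partial>lborel)"
    unfolding set_lebesgue_integral_def
  proof (rule integral_cong_AE)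
    have "AE x in lborel. x \<noteq> - pi / \<tau>" "AE x in lborel. x \<noteq> pi / \<tau>" by (rule AE_lborel_singleton)+
    then show "AE x in lborel. indicat_real (time_cell \<tau>) x *\<^sub>R cis (of_int m * \<tau> * x)
        = indicat_real {- pi / \<tau>..pi / \<tau>} x *\<^sub>R cis (of_int m * \<tau> * x)"
      by eventually_elim (auto simp: time_cell_def indicator_def)
  qed (use cm in measurable)
  also have "\<dots> = 0" by (rule integral_cis_period[OF tau False])
  finally show ?thesis using False by simp
qed

section \<open>Partial sums in time and their limits in mean square\<close>

definition tsum :: "real \<Rightarrow> (int \<Rightarrow> complex) \<Rightarrow> int set \<Rightarrow> real \<Rightarrow> complex" where
  "tsum \<tau> a M \<sigma> = of_real \<tau> * (\<Sum>m\<in>M. a m * cis (of_int m * \<tau> * \<sigma>))"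

lemma tsum_continuous: "continuous_on UNIV (tsum \<tau> a M)"
  unfolding tsum_def[abs_def] by (intro continuous_intros)

lemma tsum_L2c: "L2c \<tau> (tsum \<tau> a M)"
proof (rule L2c_bounded)
  show "tsum \<tau> a M \<in> borel_measurable borel" by (rule borel_measurable_continuous_onI[OF tsum_continuous])
  show "cmod (tsum \<tau> a M x) \<le> \<bar>\<tau>\<bar> * (\<Sum>m\<in>M. cmod (a m))" for x
    unfolding tsum_def norm_mult
    by (intro mult_mono order_trans[OF norm_sum] sum_mono) (auto simp: norm_mult)
qed

lemma tsum_periodic:
  assumes "\<tau> > 0"
  shows "tsum \<tau> a M (x + 2 * pi / \<tau>) = tsum \<tau> a M x"
proof -
  have "cis (of_int m * \<tau> * (x + 2 * pi / \<tau>)) = cis (of_int m * \<tau> * x)" for m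
  proof -
    have "of_int m * \<tau> * (x + 2 * pi / \<tau>) = of_int m * \<tau> * x + 2 * pi * of_int m"
      using assms by (simp add: distrib_left)
    then show ?thesis by (simp add: cis_mult[symmetric])
  qed
  then show ?thesis by (simp add: tsum_def)
qed

text \<open>\<open>has_time_fourier\<close> for an arbitrary coefficient sequence, so that products
  and conjugates of Fourier coefficients can be treated as well.\<close>

definition has_tf :: "real \<Rightarrow> (int \<Rightarrow> complex) \<Rightarrow> (real \<Rightarrow> complex) \<Rightarrow> bool" where
  "has_tf \<tau> a g \<longleftrightarrow> (\<forall>x. g (x + 2 * pi / \<tau>) = g x) \<and> L2c \<tau> g \<and>
    ((\<lambda>M. nrm \<tau> (\<lambda>x. g x - tsum \<tau> a M x)) \<longlongrightarrow> 0) (finite_subsets_at_top UNIV)"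

lemma has_tfD:
  assumes "has_tf \<tau> a g"
  shows "\<And>x. g (x + 2 * pi / \<tau>) = g x" "L2c \<tau> g"
    "((\<lambda>M. nrm \<tau> (\<lambda>x. g x - tsum \<tau> a M x)) \<longlongrightarrow> 0) (finite_subsets_at_top UNIV)"
  using assms by (auto simp: has_tf_def)

lemma has_tfI_sq:
  assumes "\<And>x. g (x + 2 * pi / \<tau>) = g x" "L2c \<tau> g"
    "((\<lambda>M. (nrm \<tau> (\<lambda>x. g x - tsum \<tau> a M x))\<^sup>2) \<longlongrightarrow> 0) (finite_subsets_at_top UNIV)"
  shows "has_tf \<tau> a g"
  unfolding has_tf_def using assms tendsto_real_sqrt[OF assms(3)] by simp

text \<open>Supplies the measurability required by \<open>L2c\<close> from the one on the open cell
  in \<open>has_time_fourier\<close>. The map \<open>w\<close> reduces a point to the half-open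
  cell, whose one extra point \<open>- L / 2\<close> gets a separate case in
  \<open>G\<close>.\<close>

lemma borel_measurable_of_periodic:
  fixes g :: "real \<Rightarrow> complex"
  assumes per: "\<And>x. g (x + L) = g x" and L: "L > 0"
    and m: "(\<lambda>x. indicat_real {- L / 2<..<L / 2} x *\<^sub>R g x) \<in> borel_measurable borel"
  shows "g \<in> borel_measurable borel"
proof -
  define w where "w = (\<lambda>x. x - L * real_of_int \<lfloor>x / L + 1 / 2\<rfloor>)"
  have wm [measurable]: "w \<in> borel_measurable borel" unfolding w_def by measurable
  define G where "G = (\<lambda>y. if y = - L / 2 then g (- L / 2) else indicat_real {- L / 2<..<L / 2} y *\<^sub>R g y)"
  have Gm: "G \<in> borel_measurable borel" unfolding G_def using m by measurable
  have "g x = G (w x)" for x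
  proof -
    define n where "n = \<lfloor>x / L + 1 / 2\<rfloor>"
    have "real_of_int n \<le> x / L + 1 / 2" "x / L + 1 / 2 < real_of_int n + 1" unfolding n_def by linarith+
    then have "L * (real_of_int n - 1 / 2) \<le> x" "x < L * (real_of_int n + 1 / 2)"
      using L by (auto simp: field_simps)
    then have b: "- L / 2 \<le> w x" "w x < L / 2" by (auto simp: w_def n_def[symmetric] algebra_simps)
    have "g (w x + of_int n * L) = g (w x)" by (rule periodic_shift_int[where f=g, OF per])
    then have "g x = g (w x)" by (simp add: w_def n_def mult.commute)
    then show ?thesis using b by (auto simp: G_def indicator_def)
  qed
  then have "g = (\<lambda>x. G (w x))" by blast
  then show ?thesis using measurable_compose[OF wm Gm] by simp
qed

lemma has_time_fourier_iff:
  assumes tau: "\<tau> > 0"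
  shows "has_time_fourier \<tau> u k g \<longleftrightarrow> has_tf \<tau> (\<lambda>m. torus_fourier (u m) k) g"
proof -
  define a where "a = (\<lambda>m. torus_fourier (u m) k)"
  have lim: "((\<lambda>M. LINT \<sigma>:time_cell \<tau>|lborel. (cmod (g \<sigma> - of_real \<tau> * (\<Sum>m\<in>M. a m * cis (of_int m * \<tau> * \<sigma>))))\<^sup>2)
       \<longlongrightarrow> 0) (finite_subsets_at_top UNIV) \<longleftrightarrow>
     ((\<lambda>M. (nrm \<tau> (\<lambda>x. g x - tsum \<tau> a M x))\<^sup>2) \<longlongrightarrow> 0) (finite_subsets_at_top UNIV)"
    if gm: "g \<in> borel_measurable borel"
  proof -
    have "(LINT \<sigma>:time_cell \<tau>|lborel. (cmod (g \<sigma> - of_real \<tau> * (\<Sum>m\<in>M. a m * cis (of_int m * \<tau> * \<sigma>))))\<^sup>2)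
        = (nrm \<tau> (\<lambda>x. g x - tsum \<tau> a M x))\<^sup>2" for M
    proof -
      have [measurable]: "tsum \<tau> a M \<in> borel_measurable borel"
        by (rule borel_measurable_continuous_onI[OF tsum_continuous])
      have "(\<lambda>\<sigma>. (cmod (g \<sigma> - tsum \<tau> a M \<sigma>))\<^sup>2) \<in> borel_measurable borel" using gm by measurable
      from set_integral_time_cell_eq[OF this] show ?thesis unfolding nrm_sq by (simp add: tsum_def)
    qed
    then show ?thesis by simp
  qed
  have gmeas: "g \<in> borel_measurable borel"
    if per: "\<forall>x. g (x + 2 * pi / \<tau>) = g x" and m: "set_borel_measurable lborel (time_cell \<tau>) g"
  proof (rule borel_measurable_of_periodic[where L="2 * pi / \<tau>"])
    have "time_cell \<tau> = {- (2 * pi / \<tau>) / 2<..<(2 * pi / \<tau>) / 2}" by (simp add: time_cell_def)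
    then show "(\<lambda>x. indicat_real {- (2 * pi / \<tau>) / 2<..<(2 * pi / \<tau>) / 2} x *\<^sub>R g x) \<in> borel_measurable borel"
      using m by (simp add: set_borel_measurable_def)
  qed (use per tau in auto)
  have sq: "set_integrable lborel (time_cell \<tau>) (\<lambda>\<sigma>. (cmod (g \<sigma>))\<^sup>2) \<longleftrightarrow> integrable (cellM \<tau>) (\<lambda>\<sigma>. (cmod (g \<sigma>))\<^sup>2)"
    if "g \<in> borel_measurable borel" by (rule set_integrable_time_cell_iff) (use that in measurable)
  show ?thesis
  proof
    assume h: "has_time_fourier \<tau> u k g"
    then have per: "\<forall>x. g (x + 2 * pi / \<tau>) = g x" and m: "set_borel_measurable lborel (time_cell \<tau>) g"
      by (auto simp: has_time_fourier_def)
    note gm = gmeas[OF per m]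
    have "L2c \<tau> g" using h gm sq[OF gm] by (auto simp: has_time_fourier_def L2c_def)
    moreover have "((\<lambda>M. (nrm \<tau> (\<lambda>x. g x - tsum \<tau> a M x))\<^sup>2) \<longlongrightarrow> 0) (finite_subsets_at_top UNIV)"
      using h lim[OF gm] unfolding has_time_fourier_def a_def by blast
    ultimately show "has_tf \<tau> (\<lambda>m. torus_fourier (u m) k) g"
      using per unfolding a_def by (intro has_tfI_sq) auto
  next
    assume h: "has_tf \<tau> (\<lambda>m. torus_fourier (u m) k) g"
    have gm: "g \<in> borel_measurable borel" by (rule L2c_measurable[OF has_tfD(2)[OF h]])
    have "((\<lambda>M. (nrm \<tau> (\<lambda>x. g x - tsum \<tau> a M x))\<^sup>2) \<longlongrightarrow> 0\<^sup>2) (finite_subsets_at_top UNIV)"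
      using has_tfD(3)[OF h] unfolding a_def by (rule tendsto_power)
    then have "((\<lambda>M. LINT \<sigma>:time_cell \<tau>|lborel. (cmod (g \<sigma> - of_real \<tau> * (\<Sum>m\<in>M. a m * cis (of_int m * \<tau> * \<sigma>))))\<^sup>2)
       \<longlongrightarrow> 0) (finite_subsets_at_top UNIV)" using lim[OF gm] by simp
    moreover have "set_borel_measurable lborel (time_cell \<tau>) g"
      unfolding set_borel_measurable_def using gm by measurable
    moreover have "set_integrable lborel (time_cell \<tau>) (\<lambda>\<sigma>. (cmod (g \<sigma>))\<^sup>2)"
      using sq[OF gm] L2c_integrable[OF has_tfD(2)[OF h]] by simp
    ultimately show "has_time_fourier \<tau> u k g"
      unfolding has_time_fourier_def a_def using has_tfD(1)[OF h] by blast
  qed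
qed

text \<open>A correlation instead of a convolution because the conjugated factor of the cubic term
  calls for it: up to the factor \<open>2 * pi\<close> its coefficients are
  \<open>a m * cnj (b m)\<close>.\<close>

definition corr :: "real \<Rightarrow> (real \<Rightarrow> complex) \<Rightarrow> (real \<Rightarrow> complex) \<Rightarrow> real \<Rightarrow> complex" where
  "corr \<tau> g h \<sigma> = (\<integral>q. g (\<sigma> + q) * cnj (h q) \<partial>cellM \<tau>)"

lemma corr_tsum:
  assumes tau: "\<tau> > 0" and M: "finite M"
  shows "corr \<tau> (tsum \<tau> a M) (tsum \<tau> b M) \<sigma> = of_real (2 * pi) * tsum \<tau> (\<lambda>m. a m * cnj (b m)) M \<sigma>"
proof -
  have ex: "tsum \<tau> a M (\<sigma> + q) * cnj (tsum \<tau> b M q)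
      = (\<Sum>m\<in>M. \<Sum>n\<in>M. (of_real (\<tau>\<^sup>2) * a m * cnj (b n) * cis (of_int m * \<tau> * \<sigma>)) * cis (of_int (m - n) * \<tau> * q))" for q
  proof -
    have "tsum \<tau> a M (\<sigma> + q) * cnj (tsum \<tau> b M q)
        = of_real (\<tau>\<^sup>2) * ((\<Sum>m\<in>M. a m * cis (of_int m * \<tau> * (\<sigma> + q))) * (\<Sum>n\<in>M. cnj (b n) * cis (- (of_int n * \<tau> * q))))"
      by (simp add: tsum_def cis_cnj power2_eq_square)
    also have "\<dots> = (\<Sum>m\<in>M. \<Sum>n\<in>M. of_real (\<tau>\<^sup>2) * ((a m * cis (of_int m * \<tau> * (\<sigma> + q))) * (cnj (b n) * cis (- (of_int n * \<tau> * q)))))"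
      by (subst sum_product) (simp only: sum_distrib_left)
    also have "\<dots> = (\<Sum>m\<in>M. \<Sum>n\<in>M. (of_real (\<tau>\<^sup>2) * a m * cnj (b n) * cis (of_int m * \<tau> * \<sigma>)) * cis (of_int (m - n) * \<tau> * q))"
    proof (intro sum.cong refl)
      fix m n
      have "cis (of_int m * \<tau> * (\<sigma> + q)) * cis (- (of_int n * \<tau> * q)) = cis (of_int m * \<tau> * \<sigma>) * cis (of_int (m - n) * \<tau> * q)"
        by (simp add: cis_mult algebra_simps)
      then have "(of_real (\<tau>\<^sup>2) * a m * cnj (b n)) * (cis (of_int m * \<tau> * (\<sigma> + q)) * cis (- (of_int n * \<tau> * q)))
          = (of_real (\<tau>\<^sup>2) * a m * cnj (b n)) * (cis (of_int m * \<tau> * \<sigma>) * cis (of_int (m - n) * \<tau> * q))" by simp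
      then show "of_real (\<tau>\<^sup>2) * ((a m * cis (of_int m * \<tau> * (\<sigma> + q))) * (cnj (b n) * cis (- (of_int n * \<tau> * q))))
          = (of_real (\<tau>\<^sup>2) * a m * cnj (b n) * cis (of_int m * \<tau> * \<sigma>)) * cis (of_int (m - n) * \<tau> * q)"
        by (simp only: mult_ac)
    qed
    finally show ?thesis .
  qed
  have int: "integrable (cellM \<tau>) (\<lambda>q. c * cis (of_int m * \<tau> * q))" for c m
  proof -
    interpret finite_measure "cellM \<tau>" by (rule finite_measure_cellM)
    show ?thesis
    proof (rule integrable_const_bound[where B="cmod c"])
      have "(\<lambda>q. c * cis (of_int m * \<tau> * q)) \<in> borel_measurable borel"
        by (intro borel_measurable_continuous_onI continuous_intros)
      then show "(\<lambda>q. c * cis (of_int m * \<tau> * q)) \<in> borel_measurable (cellM \<tau>)" by simp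
    qed (auto simp: norm_mult)
  qed
  have "corr \<tau> (tsum \<tau> a M) (tsum \<tau> b M) \<sigma>
      = (\<Sum>m\<in>M. \<Sum>n\<in>M. (of_real (\<tau>\<^sup>2) * a m * cnj (b n) * cis (of_int m * \<tau> * \<sigma>)) * (\<integral>q. cis (of_int (m - n) * \<tau> * q) \<partial>cellM \<tau>))"
    unfolding corr_def ex
    by (subst Bochner_Integration.integral_sum, intro Bochner_Integration.integrable_sum int,
        intro sum.cong refl, subst Bochner_Integration.integral_sum, rule int, intro sum.cong refl, rule integral_mult_right_zero)
  also have "\<dots> = (\<Sum>m\<in>M. \<Sum>n\<in>M. if m = n then of_real (\<tau>\<^sup>2) * a m * cnj (b n) * cis (of_int m * \<tau> * \<sigma>) * of_real (2 * pi / \<tau>) else 0)"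
    unfolding integral_cis_cellM[OF tau] by (intro sum.cong refl) auto
  also have "\<dots> = (\<Sum>m\<in>M. of_real (\<tau>\<^sup>2) * a m * cnj (b m) * cis (of_int m * \<tau> * \<sigma>) * of_real (2 * pi / \<tau>))"
    using M by (intro sum.cong refl) (simp add: sum.delta)
  also have "\<dots> = of_real (2 * pi) * tsum \<tau> (\<lambda>m. a m * cnj (b m)) M \<sigma>"
    unfolding tsum_def sum_distrib_left using tau
    by (intro sum.cong refl) (simp add: power2_eq_square field_simps)
  finally show ?thesis .
qed

text \<open>The norm is invariant under translation, so the bound is uniform in \<sigma>. It serves
  both for convergence in mean square and for the value at \<open>\<sigma> = 0\<close>.\<close>

lemma corr_approx:
  fixes a b :: "int \<Rightarrow> complex"
  assumes tau: "\<tau> > 0" and M: "finite M"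
    and g: "L2c \<tau> g" "\<And>x. g (x + 2 * pi / \<tau>) = g x" and h: "L2c \<tau> h"
  defines "e \<equiv> nrm \<tau> (\<lambda>x. g x - tsum \<tau> a M x)" and "f \<equiv> nrm \<tau> (\<lambda>x. h x - tsum \<tau> b M x)"
  shows "cmod (corr \<tau> g h \<sigma> - of_real (2 * pi) * tsum \<tau> (\<lambda>m. a m * cnj (b m)) M \<sigma>)
    \<le> nrm \<tau> g * f + e * nrm \<tau> h + e * f"
proof -
  define E where "E = (\<lambda>x. g x - tsum \<tau> a M x)"
  define F where "F = (\<lambda>x. h x - tsum \<tau> b M x)"
  have E: "L2c \<tau> E" unfolding E_def by (rule L2c_diff(1)[OF g(1) tsum_L2c])
  have F: "L2c \<tau> F" unfolding F_def by (rule L2c_diff(1)[OF h tsum_L2c])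
  have Ep: "E (x + 2 * pi / \<tau>) = E x" for x unfolding E_def using g(2) tsum_periodic[OF tau] by simp
  note gs = L2c_shift[OF g tau, of \<sigma>]
  note Es = L2c_shift[OF E Ep tau, of \<sigma>]
  note hc = L2c_cnj[OF h] and Fc = L2c_cnj[OF F]
  have i1: "integrable (cellM \<tau>) (\<lambda>q. g (\<sigma> + q) * cnj (F q))"
    and b1: "cmod (\<integral>q. g (\<sigma> + q) * cnj (F q) \<partial>cellM \<tau>) \<le> nrm \<tau> g * f"
    using L2c_Cauchy_Schwarz[OF gs(1) Fc(1)] gs(2) Fc(2) by (auto simp: f_def F_def)
  have i2: "integrable (cellM \<tau>) (\<lambda>q. E (\<sigma> + q) * cnj (h q))"
    and b2: "cmod (\<integral>q. E (\<sigma> + q) * cnj (h q) \<partial>cellM \<tau>) \<le> e * nrm \<tau> h"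
    using L2c_Cauchy_Schwarz[OF Es(1) hc(1)] Es(2) hc(2) by (auto simp: e_def E_def)
  have i3: "integrable (cellM \<tau>) (\<lambda>q. E (\<sigma> + q) * cnj (F q))"
    and b3: "cmod (\<integral>q. E (\<sigma> + q) * cnj (F q) \<partial>cellM \<tau>) \<le> e * f"
    using L2c_Cauchy_Schwarz[OF Es(1) Fc(1)] Es(2) Fc(2) by (auto simp: e_def E_def f_def F_def)
  have i0: "integrable (cellM \<tau>) (\<lambda>q. g (\<sigma> + q) * cnj (h q))"
    using L2c_Cauchy_Schwarz(1)[OF gs(1) hc(1)] .
  \<comment> \<open>The partial sums are \<open>g - E\<close> and \<open>h - F\<close>. Their
    correlation is known by \<open>corr_tsum\<close>, and expanding the product leaves three error
    terms.\<close>
  have "of_real (2 * pi) * tsum \<tau> (\<lambda>m. a m * cnj (b m)) M \<sigma>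
      = (\<integral>q. g (\<sigma> + q) * cnj (h q) - g (\<sigma> + q) * cnj (F q) - E (\<sigma> + q) * cnj (h q) + E (\<sigma> + q) * cnj (F q) \<partial>cellM \<tau>)"
    unfolding corr_tsum[OF tau M, symmetric] corr_def
    by (intro Bochner_Integration.integral_cong refl) (simp add: E_def F_def algebra_simps)
  also have "\<dots> = corr \<tau> g h \<sigma> - (\<integral>q. g (\<sigma> + q) * cnj (F q) \<partial>cellM \<tau>) - (\<integral>q. E (\<sigma> + q) * cnj (h q) \<partial>cellM \<tau>)
      + (\<integral>q. E (\<sigma> + q) * cnj (F q) \<partial>cellM \<tau>)"
    unfolding corr_def using i0 i1 i2 i3 by simp
  finally have "corr \<tau> g h \<sigma> - of_real (2 * pi) * tsum \<tau> (\<lambda>m. a m * cnj (b m)) M \<sigma>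
      = (\<integral>q. g (\<sigma> + q) * cnj (F q) \<partial>cellM \<tau>) + (\<integral>q. E (\<sigma> + q) * cnj (h q) \<partial>cellM \<tau>)
        - (\<integral>q. E (\<sigma> + q) * cnj (F q) \<partial>cellM \<tau>)" (is "?l = ?a + ?b - ?c") by simp
  also have "cmod (?a + ?b - ?c) \<le> cmod ?a + cmod ?b + cmod ?c"
    by (intro norm_triangle_le_diff add_mono norm_triangle_ineq order_refl)
  finally show ?thesis using b1 b2 b3 by linarith
qed

lemma corr_bound_tendsto:
  assumes "has_tf \<tau> a g" "has_tf \<tau> b h"
  shows "((\<lambda>M. nrm \<tau> g * nrm \<tau> (\<lambda>x. h x - tsum \<tau> b M x) + nrm \<tau> (\<lambda>x. g x - tsum \<tau> a M x) * nrm \<tau> h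
      + nrm \<tau> (\<lambda>x. g x - tsum \<tau> a M x) * nrm \<tau> (\<lambda>x. h x - tsum \<tau> b M x)) \<longlongrightarrow> 0) (finite_subsets_at_top UNIV)"
  using has_tfD(3)[OF assms(1)] has_tfD(3)[OF assms(2)]
  by (auto intro!: tendsto_eq_intros)

text \<open>The partial sums of the product converge uniformly, by the Cauchy-Schwarz inequality.\<close>

lemma has_tf_corr:
  assumes tau: "\<tau> > 0" and g: "has_tf \<tau> a g" and h: "has_tf \<tau> b h"
  shows "has_tf \<tau> (\<lambda>m. a m * cnj (b m)) (\<lambda>\<sigma>. corr \<tau> g h \<sigma> / of_real (2 * pi))"
proof (rule has_tfI_sq)
  have [measurable]: "g \<in> borel_measurable borel" "h \<in> borel_measurable borel"
    using L2c_measurable has_tfD(2) g h by blast+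
  show "corr \<tau> g h (x + 2 * pi / \<tau>) / of_real (2 * pi) = corr \<tau> g h x / of_real (2 * pi)" for x
  proof -
    have "g (x + 2 * pi / \<tau> + q) = g (x + q)" for q
      using has_tfD(1)[OF g, of "x + q"] by (simp add: algebra_simps)
    then show ?thesis by (simp add: corr_def)
  qed
  interpret T: sigma_finite_measure "cellM \<tau>" by (rule sigma_finite_cellM)
  interpret Fin: finite_measure "cellM \<tau>" by (rule finite_measure_cellM)
  have cm: "corr \<tau> g h \<in> borel_measurable borel"
    unfolding corr_def[abs_def]
  proof (rule T.borel_measurable_lebesgue_integral)
    have sets: "sets (borel \<Otimes>\<^sub>M cellM \<tau>) = sets (borel \<Otimes>\<^sub>M (borel :: real measure))"
      by (intro sets_pair_measure_cong) auto
    have "(\<lambda>x. cnj (h x)) \<in> borel_measurable borel"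
      by (rule L2c_measurable[OF L2c_cnj(1)[OF has_tfD(2)[OF h]]])
    then have [measurable]: "(\<lambda>x. cnj (h x)) \<in> borel_measurable borel" .
    have "(\<lambda>(\<sigma>, q). g (\<sigma> + q) * cnj (h q)) \<in> borel_measurable (borel \<Otimes>\<^sub>M (borel :: real measure))"
      by measurable
    then show "(\<lambda>(\<sigma>, q). g (\<sigma> + q) * cnj (h q)) \<in> borel_measurable (borel \<Otimes>\<^sub>M cellM \<tau>)"
      using sets by (simp cong: measurable_cong_sets)
  qed
  show Lc: "L2c \<tau> (\<lambda>\<sigma>. corr \<tau> g h \<sigma> / of_real (2 * pi))"
  proof (rule L2c_bounded)
    show "(\<lambda>\<sigma>. corr \<tau> g h \<sigma> / of_real (2 * pi)) \<in> borel_measurable borel" using cm by measurable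
    fix \<sigma>
    have "cmod (corr \<tau> g h \<sigma>) \<le> nrm \<tau> g * nrm \<tau> h"
      unfolding corr_def
      using L2c_Cauchy_Schwarz(2)[OF L2c_shift(1)[OF has_tfD(2,1)[OF g] tau] L2c_cnj(1)[OF has_tfD(2)[OF h]], of \<sigma>]
      by (simp add: L2c_shift(2)[OF has_tfD(2,1)[OF g] tau] L2c_cnj(2)[OF has_tfD(2)[OF h]])
    then show "cmod (corr \<tau> g h \<sigma> / of_real (2 * pi)) \<le> nrm \<tau> g * nrm \<tau> h / (2 * pi)"
      by (simp add: norm_divide divide_right_mono)
  qed
  define B where "B = (\<lambda>M. nrm \<tau> g * nrm \<tau> (\<lambda>x. h x - tsum \<tau> b M x) + nrm \<tau> (\<lambda>x. g x - tsum \<tau> a M x) * nrm \<tau> h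
      + nrm \<tau> (\<lambda>x. g x - tsum \<tau> a M x) * nrm \<tau> (\<lambda>x. h x - tsum \<tau> b M x))"
  have Blim: "(B \<longlongrightarrow> 0) (finite_subsets_at_top UNIV)" unfolding B_def by (rule corr_bound_tendsto[OF g h])
  let ?D = "\<lambda>M x. corr \<tau> g h x / of_real (2 * pi) - tsum \<tau> (\<lambda>m. a m * cnj (b m)) M x"
  \<comment> \<open>A pointwise bound by a constant, squared and integrated over a cell of length
    \<open>2 * pi / \<tau>\<close>.\<close>
  have le: "(nrm \<tau> (?D M))\<^sup>2 \<le> (B M / (2 * pi))\<^sup>2 * (2 * pi / \<tau>)" if M: "finite M" for M
  proof -
    have pt: "cmod (?D M x) \<le> B M / (2 * pi)" for x
    proof -
      have "?D M x = (corr \<tau> g h x - of_real (2 * pi) * tsum \<tau> (\<lambda>m. a m * cnj (b m)) M x) / of_real (2 * pi)"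
        by (simp add: field_simps)
      then have "cmod (?D M x) = cmod (corr \<tau> g h x - of_real (2 * pi) * tsum \<tau> (\<lambda>m. a m * cnj (b m)) M x) / (2 * pi)"
        by (simp add: norm_divide)
      also have "\<dots> \<le> B M / (2 * pi)" unfolding B_def
        by (intro divide_right_mono corr_approx tau M has_tfD[OF g] has_tfD(2)[OF h]) auto
      finally show ?thesis .
    qed
    have "(nrm \<tau> (?D M))\<^sup>2 \<le> (\<integral>x. (B M / (2 * pi))\<^sup>2 \<partial>cellM \<tau>)"
      unfolding nrm_sq
      by (intro integral_mono L2c_integrable[OF L2c_diff(1)[OF Lc tsum_L2c]] power_mono pt) auto
    also have "\<dots> = (B M / (2 * pi))\<^sup>2 * (2 * pi / \<tau>)"
      using tau by (simp add: measure_def emeasure_cellM)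
    finally show ?thesis .
  qed
  show "((\<lambda>M. (nrm \<tau> (?D M))\<^sup>2) \<longlongrightarrow> 0) (finite_subsets_at_top UNIV)"
  proof (rule tendsto_sandwich[OF _ _ tendsto_const])
    show "\<forall>\<^sub>F M in finite_subsets_at_top UNIV. (nrm \<tau> (?D M))\<^sup>2 \<le> (B M / (2 * pi))\<^sup>2 * (2 * pi / \<tau>)"
      by (rule eventually_finite_subsets_at_top_weakI) (use le in auto)
    have "((\<lambda>M. (B M / (2 * pi))\<^sup>2 * (2 * pi / \<tau>)) \<longlongrightarrow> (0 / (2 * pi))\<^sup>2 * (2 * pi / \<tau>)) (finite_subsets_at_top UNIV)"
      by (intro tendsto_intros Blim) auto
    then show "((\<lambda>M. (B M / (2 * pi))\<^sup>2 * (2 * pi / \<tau>)) \<longlongrightarrow> 0) (finite_subsets_at_top UNIV)" by simp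
  qed auto
qed

text \<open>The correlation of \<open>g\<close> with itself at 0 is the squared norm, and the
  partial sums there are multiples of the sums of squared coefficients.\<close>

lemma has_tf_Parseval:
  assumes tau: "\<tau> > 0" and g: "has_tf \<tau> a g"
  shows "((\<lambda>m. (cmod (a m))\<^sup>2) has_sum ((nrm \<tau> g)\<^sup>2 / (2 * pi * \<tau>))) UNIV"
proof -
  define B where "B = (\<lambda>M. nrm \<tau> g * nrm \<tau> (\<lambda>x. g x - tsum \<tau> a M x) + nrm \<tau> (\<lambda>x. g x - tsum \<tau> a M x) * nrm \<tau> g
      + nrm \<tau> (\<lambda>x. g x - tsum \<tau> a M x) * nrm \<tau> (\<lambda>x. g x - tsum \<tau> a M x))"
  have Blim: "(B \<longlongrightarrow> 0) (finite_subsets_at_top UNIV)" unfolding B_def by (rule corr_bound_tendsto[OF g g])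
  have c0: "corr \<tau> g g 0 = of_real ((nrm \<tau> g)\<^sup>2)"
    unfolding corr_def nrm_sq integral_complex_of_real[symmetric]
    by (intro Bochner_Integration.integral_cong refl) (simp add: complex_norm_square[symmetric])
  have t0: "of_real (2 * pi) * tsum \<tau> (\<lambda>m. a m * cnj (a m)) M 0 = of_real (2 * pi * \<tau> * (\<Sum>m\<in>M. (cmod (a m))\<^sup>2))" for M
  proof -
    have "a m * cnj (a m) = of_real ((cmod (a m))\<^sup>2)" for m by (rule complex_norm_square[symmetric])
    then show ?thesis by (simp add: tsum_def)
  qed
  have le: "norm ((\<Sum>m\<in>M. (cmod (a m))\<^sup>2) - (nrm \<tau> g)\<^sup>2 / (2 * pi * \<tau>)) \<le> B M / (2 * pi * \<tau>)" if M: "finite M" for M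
  proof -
    have "cmod (of_real ((nrm \<tau> g)\<^sup>2) - of_real (2 * pi * \<tau> * (\<Sum>m\<in>M. (cmod (a m))\<^sup>2))) \<le> B M"
      unfolding B_def c0[symmetric] t0[symmetric]
      by (intro corr_approx tau M has_tfD[OF g])
    then have "\<bar>(nrm \<tau> g)\<^sup>2 - 2 * pi * \<tau> * (\<Sum>m\<in>M. (cmod (a m))\<^sup>2)\<bar> \<le> B M"
      by (metis norm_of_real of_real_diff)
    then have "\<bar>(nrm \<tau> g)\<^sup>2 - 2 * pi * \<tau> * (\<Sum>m\<in>M. (cmod (a m))\<^sup>2)\<bar> / (2 * pi * \<tau>) \<le> B M / (2 * pi * \<tau>)"
      using tau by (intro divide_right_mono) auto
    moreover have "\<bar>(nrm \<tau> g)\<^sup>2 - 2 * pi * \<tau> * (\<Sum>m\<in>M. (cmod (a m))\<^sup>2)\<bar> / (2 * pi * \<tau>)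
        = \<bar>(\<Sum>m\<in>M. (cmod (a m))\<^sup>2) - (nrm \<tau> g)\<^sup>2 / (2 * pi * \<tau>)\<bar>"
    proof -
      have "(\<Sum>m\<in>M. (cmod (a m))\<^sup>2) - (nrm \<tau> g)\<^sup>2 / (2 * pi * \<tau>)
          = - (((nrm \<tau> g)\<^sup>2 - 2 * pi * \<tau> * (\<Sum>m\<in>M. (cmod (a m))\<^sup>2)) / (2 * pi * \<tau>))"
        using tau by (simp add: field_simps)
      then show ?thesis using tau by (simp add: abs_divide abs_mult)
    qed
    ultimately show ?thesis by simp
  qed
  have "((\<lambda>M. B M / (2 * pi * \<tau>)) \<longlongrightarrow> 0) (finite_subsets_at_top UNIV)"
    using tendsto_divide_zero[OF Blim] .
  then have "((\<lambda>M. (\<Sum>m\<in>M. (cmod (a m))\<^sup>2) - (nrm \<tau> g)\<^sup>2 / (2 * pi * \<tau>)) \<longlongrightarrow> 0) (finite_subsets_at_top UNIV)"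
    by (rule Lim_null_comparison[rotated]) (rule eventually_finite_subsets_at_top_weakI, use le in auto)
  then show ?thesis unfolding has_sum_def by (rule LIM_zero_cancel)
qed

text \<open>\<open>time_fourier\<close> is an unspecified choice among the limits; uniqueness up to
  null sets allows replacing it by an explicitly constructed one.\<close>

lemma has_tf_unique:
  assumes g: "has_tf \<tau> a g" and h: "has_tf \<tau> a h"
  shows "AE x in cellM \<tau>. g x = h x"
proof -
  note gL = has_tfD(2)[OF g] and hL = has_tfD(2)[OF h]
  have dL: "L2c \<tau> (\<lambda>x. g x - h x)" by (rule L2c_diff(1)[OF gL hL])
  have "(nrm \<tau> (\<lambda>x. g x - h x))\<^sup>2 \<le> 0"
  proof (rule tendsto_le[OF finite_subsets_at_top_neq_bot _ tendsto_const])
    have "((\<lambda>M. 2 * (nrm \<tau> (\<lambda>x. g x - tsum \<tau> a M x))\<^sup>2 + 2 * (nrm \<tau> (\<lambda>x. h x - tsum \<tau> a M x))\<^sup>2) \<longlongrightarrow> 2 * 0\<^sup>2 + 2 * 0\<^sup>2)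
      (finite_subsets_at_top UNIV)"
      by (intro tendsto_intros has_tfD(3)[OF g] has_tfD(3)[OF h])
    then show "((\<lambda>M. 2 * (nrm \<tau> (\<lambda>x. g x - tsum \<tau> a M x))\<^sup>2 + 2 * (nrm \<tau> (\<lambda>x. h x - tsum \<tau> a M x))\<^sup>2) \<longlongrightarrow> 0)
      (finite_subsets_at_top (UNIV :: int set))" by simp
    have "(nrm \<tau> (\<lambda>x. g x - h x))\<^sup>2 \<le> 2 * (nrm \<tau> (\<lambda>x. g x - tsum \<tau> a M x))\<^sup>2 + 2 * (nrm \<tau> (\<lambda>x. h x - tsum \<tau> a M x))\<^sup>2" for M
      using L2c_diff(2)[OF L2c_diff(1)[OF gL tsum_L2c] L2c_diff(1)[OF hL tsum_L2c], of a M a M] by simp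
    then show "\<forall>\<^sub>F M in finite_subsets_at_top (UNIV :: int set). (nrm \<tau> (\<lambda>x. g x - h x))\<^sup>2
        \<le> 2 * (nrm \<tau> (\<lambda>x. g x - tsum \<tau> a M x))\<^sup>2 + 2 * (nrm \<tau> (\<lambda>x. h x - tsum \<tau> a M x))\<^sup>2" by simp
  qed
  then have "(\<integral>x. (cmod (g x - h x))\<^sup>2 \<partial>cellM \<tau>) = 0"
    unfolding nrm_sq by (intro antisym integral_nonneg_AE) auto
  then have "AE x in cellM \<tau>. (cmod (g x - h x))\<^sup>2 = 0"
    using L2c_integrable[OF dL] by (subst (asm) integral_nonneg_eq_0_iff_AE) auto
  then show ?thesis by simp
qed

lemma has_tf_0: "has_tf \<tau> (\<lambda>m. 0) (\<lambda>x. 0)"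
  by (rule has_tfI_sq) (auto simp: tsum_def nrm_def L2c_def)

lemma has_tf_add:
  assumes g: "has_tf \<tau> a g" and h: "has_tf \<tau> b h"
  shows "has_tf \<tau> (\<lambda>m. a m + b m) (\<lambda>x. g x + h x)"
proof (rule has_tfI_sq)
  note gL = has_tfD(2)[OF g] and hL = has_tfD(2)[OF h]
  show "L2c \<tau> (\<lambda>x. g x + h x)" by (rule L2c_add(1)[OF gL hL])
  let ?E = "\<lambda>M x. g x - tsum \<tau> a M x" and ?F = "\<lambda>M x. h x - tsum \<tau> b M x"
  show "((\<lambda>M. (nrm \<tau> (\<lambda>x. g x + h x - tsum \<tau> (\<lambda>m. a m + b m) M x))\<^sup>2) \<longlongrightarrow> 0) (finite_subsets_at_top UNIV)"
  proof (rule tendsto_sandwich[OF _ _ tendsto_const])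
    have "(nrm \<tau> (\<lambda>x. g x + h x - tsum \<tau> (\<lambda>m. a m + b m) M x))\<^sup>2 \<le> 2 * (nrm \<tau> (?E M))\<^sup>2 + 2 * (nrm \<tau> (?F M))\<^sup>2" for M
    proof -
      have "(\<lambda>x. g x + h x - tsum \<tau> (\<lambda>m. a m + b m) M x) = (\<lambda>x. ?E M x + ?F M x)"
        by (simp add: tsum_def distrib_left distrib_right sum.distrib fun_eq_iff)
      then show ?thesis
        using L2c_add(2)[OF L2c_diff(1)[OF gL tsum_L2c] L2c_diff(1)[OF hL tsum_L2c], of a M b M] by simp
    qed
    then show "\<forall>\<^sub>F M in finite_subsets_at_top UNIV. (nrm \<tau> (\<lambda>x. g x + h x - tsum \<tau> (\<lambda>m. a m + b m) M x))\<^sup>2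
        \<le> 2 * (nrm \<tau> (?E M))\<^sup>2 + 2 * (nrm \<tau> (?F M))\<^sup>2" by simp
    have "((\<lambda>M. 2 * (nrm \<tau> (?E M))\<^sup>2 + 2 * (nrm \<tau> (?F M))\<^sup>2) \<longlongrightarrow> 2 * 0\<^sup>2 + 2 * 0\<^sup>2) (finite_subsets_at_top UNIV)"
      by (intro tendsto_intros has_tfD(3)[OF g] has_tfD(3)[OF h])
    then show "((\<lambda>M. 2 * (nrm \<tau> (?E M))\<^sup>2 + 2 * (nrm \<tau> (?F M))\<^sup>2) \<longlongrightarrow> 0) (finite_subsets_at_top UNIV)" by simp
  qed auto
qed (use has_tfD(1)[OF g] has_tfD(1)[OF h] in simp)

lemma has_tf_sum:
  assumes "\<And>j. j \<in> J \<Longrightarrow> has_tf \<tau> (a j) (g j)"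
  shows "has_tf \<tau> (\<lambda>m. \<Sum>j\<in>J. a j m) (\<lambda>x. \<Sum>j\<in>J. g j x)"
  using assms
proof (induction J rule: infinite_finite_induct)
  case (insert j J)
  then show ?case using has_tf_add[of \<tau> "a j" "g j" "\<lambda>m. \<Sum>j\<in>J. a j m" "\<lambda>x. \<Sum>j\<in>J. g j x"] by simp
qed (simp_all add: has_tf_0)

text \<open>Turns correlations into convolutions: \<open>a m * b m\<close> is
  \<open>a m * cnj (cnj (b m))\<close>, so its series is a correlation with the reflected
  conjugate.\<close>

lemma has_tf_cnj_reflect:
  assumes g: "has_tf \<tau> a g"
  shows "has_tf \<tau> (\<lambda>m. cnj (a m)) (\<lambda>x. cnj (g (- x)))"
  unfolding has_tf_def
proof (intro conjI allI)
  show "cnj (g (- (x + 2 * pi / \<tau>))) = cnj (g (- x))" for x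
    using has_tfD(1)[OF g, of "- (x + 2 * pi / \<tau>)"] by simp
  note gL = has_tfD(2)[OF g]
  show "L2c \<tau> (\<lambda>x. cnj (g (- x)))" by (intro L2c_cnj L2c_reflect gL)
  have "nrm \<tau> (\<lambda>x. cnj (g (- x)) - tsum \<tau> (\<lambda>m. cnj (a m)) M x) = nrm \<tau> (\<lambda>x. g x - tsum \<tau> a M x)" for M
  proof -
    let ?E = "\<lambda>x. g x - tsum \<tau> a M x"
    have E: "L2c \<tau> ?E" by (rule L2c_diff(1)[OF gL tsum_L2c])
    have "(\<lambda>x. cnj (g (- x)) - tsum \<tau> (\<lambda>m. cnj (a m)) M x) = (\<lambda>x. cnj (?E (- x)))"
      by (simp add: tsum_def cis_cnj fun_eq_iff)
    then show ?thesis using L2c_cnj(2)[OF L2c_reflect(1)[OF E]] L2c_reflect(2)[OF E] by simp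
  qed
  then show "((\<lambda>M. nrm \<tau> (\<lambda>x. cnj (g (- x)) - tsum \<tau> (\<lambda>m. cnj (a m)) M x)) \<longlongrightarrow> 0) (finite_subsets_at_top UNIV)"
    using has_tfD(3)[OF g] by simp
qed

lemma corr_norm_le:
  assumes "L2c \<tau> g" "L2c \<tau> h"
  shows "ennreal (cmod (corr \<tau> g h \<sigma>)) \<le> (\<integral>\<^sup>+q. ennreal (cmod (g (\<sigma> + q))) * ennreal (cmod (h q)) \<partial>cellM \<tau>)"
proof -
  have [measurable]: "g \<in> borel_measurable borel" "h \<in> borel_measurable borel" using assms L2c_measurable by blast+
  have "ennreal (cmod (corr \<tau> g h \<sigma>)) \<le> (\<integral>\<^sup>+q. ennreal (norm (g (\<sigma> + q) * cnj (h q))) \<partial>cellM \<tau>)"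
  proof (cases "integrable (cellM \<tau>) (\<lambda>q. g (\<sigma> + q) * cnj (h q))")
    case True
    then show ?thesis unfolding corr_def by (rule integral_norm_bound_ennreal)
  next
    \<comment> \<open>The integral of a function that is not integrable is 0 by convention.\<close>
    case False
    then show ?thesis by (simp add: corr_def not_integrable_integral_eq)
  qed
  then show ?thesis by (simp add: norm_mult ennreal_mult)
qed


subsection \<open>Trigonometric polynomials on the torus\<close>

definition ech :: "int \<times> int \<Rightarrow> real \<times> real \<Rightarrow> complex" where
  "ech k x = cis (freq k \<bullet> x)"

lemma ech_eq: "ech k (x, y) = cis (of_int (fst k) * x) * cis (of_int (snd k) * y)"
  by (simp add: ech_def freq_def cis_mult)

lemma ech_mult: "ech k x * ech l x = ech (k + l) x"
  by (cases x) (simp add: ech_def freq_def cis_mult inner_add_left algebra_simps)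

lemma ech_cnj: "cnj (ech k x) = ech (- k) x"
  by (cases x) (simp add: ech_def freq_def cis_cnj)

lemma ech_continuous [continuous_intros]: "continuous_on A (ech k)"
  unfolding ech_def[abs_def] by (intro continuous_intros)

lemma ech_periodic: "torus_periodic (ech k)"
proof -
  have "cis (of_int m * (x + 2 * pi)) = cis (of_int m * x)" for m x
  proof -
    have "of_int m * (x + 2 * pi) = of_int m * x + 2 * pi * of_int m" by (simp add: distrib_left)
    then show ?thesis by (simp add: cis_mult[symmetric])
  qed
  then show ?thesis by (simp add: torus_periodic_def ech_eq)
qed

lemma set_integrable_torus_continuous:
  fixes f :: "real \<times> real \<Rightarrow> 'b::{banach, second_countable_topology}"
  assumes "continuous_on UNIV f"
  shows "set_integrable lborel torus_cell f"
  unfolding set_integrable_def torus_cell_def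
  by (rule borel_integrable_compact) (auto intro: continuous_on_subset[OF assms])

lemma torus_cell_eq: "torus_cell = {- pi..pi} \<times> {- pi..pi}"
  by (simp add: torus_cell_def cbox_Pair_eq)

lemma integral_ech: "(LINT x:torus_cell|lborel. ech k x) = (if k = 0 then of_real (4 * pi\<^sup>2) else 0)"
proof -
  define I where "I = (\<lambda>m::int. \<integral>x. indicat_real {- pi..pi} x *\<^sub>R cis (of_int m * x) \<partial>lborel)"
  have I: "I m = (if m = 0 then of_real (2 * pi) else 0)" for m
  proof (cases "m = 0")
    case True
    have "I 0 = (\<integral>x. indicat_real {- pi..pi} x *\<^sub>R (1::complex) \<partial>lborel)" by (simp add: I_def)
    also have "\<dots> = of_real (2 * pi)"
      by (subst integral_scaleR_left) (auto simp: scaleR_conv_of_real)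
    finally show ?thesis using True by simp
  next
    case False
    then show ?thesis using integral_cis_period[of 1 m] by (simp add: I_def)
  qed
  have int: "integrable (lborel \<Otimes>\<^sub>M lborel) (\<lambda>x. indicat_real torus_cell x *\<^sub>R ech k x)"
    using set_integrable_torus_continuous[OF ech_continuous] by (simp add: set_integrable_def lborel_prod)
  have "(LINT x:torus_cell|lborel. ech k x) = (\<integral>x. indicat_real torus_cell x *\<^sub>R ech k x \<partial>(lborel \<Otimes>\<^sub>M lborel))"
    by (simp add: set_lebesgue_integral_def lborel_prod)
  also have "\<dots> = (\<integral>x. (\<integral>y. indicat_real torus_cell (x, y) *\<^sub>R ech k (x, y) \<partial>lborel) \<partial>lborel)"
    by (rule lborel_pair.integral_fst'[OF int, symmetric])
  also have "\<dots> = (\<integral>x. (indicat_real {- pi..pi} x *\<^sub>R cis (of_int (fst k) * x)) * I (snd k) \<partial>lborel)"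
  proof (intro Bochner_Integration.integral_cong refl)
    fix x :: real
    have "(\<integral>y. indicat_real torus_cell (x, y) *\<^sub>R ech k (x, y) \<partial>lborel)
        = (\<integral>y. (indicat_real {- pi..pi} x *\<^sub>R cis (of_int (fst k) * x)) * (indicat_real {- pi..pi} y *\<^sub>R cis (of_int (snd k) * y)) \<partial>lborel)"
      by (intro Bochner_Integration.integral_cong refl) (auto simp: torus_cell_eq ech_eq indicator_def)
    also have "\<dots> = (indicat_real {- pi..pi} x *\<^sub>R cis (of_int (fst k) * x)) * I (snd k)"
      unfolding I_def by (rule integral_mult_right_zero)
    finally show "(\<integral>y. indicat_real torus_cell (x, y) *\<^sub>R ech k (x, y) \<partial>lborel)
        = (indicat_real {- pi..pi} x *\<^sub>R cis (of_int (fst k) * x)) * I (snd k)" .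
  qed
  also have "\<dots> = I (fst k) * I (snd k)"
    unfolding I_def by (rule integral_mult_left_zero)
  also have "\<dots> = (if k = 0 then of_real (4 * pi\<^sup>2) else 0)"
    by (cases k) (auto simp: I power2_eq_square zero_prod_def)
  finally show ?thesis .
qed

lemma set_integral_sum_ech:
  assumes "finite J"
  shows "(LINT x:torus_cell|lborel. (\<Sum>j\<in>J. c j * ech (\<phi> j) x)) = of_real (4 * pi\<^sup>2) * (\<Sum>j\<in>J. if \<phi> j = 0 then c j else 0)"
proof -
  have "(LINT x:torus_cell|lborel. (\<Sum>j\<in>J. c j * ech (\<phi> j) x)) = (\<Sum>j\<in>J. LINT x:torus_cell|lborel. c j * ech (\<phi> j) x)"
    unfolding set_lebesgue_integral_def scaleR_sum_right
  proof (rule Bochner_Integration.integral_sum)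
    fix j
    have "set_integrable lborel torus_cell (\<lambda>x. c j * ech (\<phi> j) x)"
      by (intro set_integrable_torus_continuous continuous_intros)
    then show "integrable lborel (\<lambda>x. indicat_real torus_cell x *\<^sub>R (c j * ech (\<phi> j) x))" by (simp add: set_integrable_def)
  qed
  also have "\<dots> = (\<Sum>j\<in>J. c j * (if \<phi> j = 0 then of_real (4 * pi\<^sup>2) else 0))"
    by (simp add: integral_ech)
  also have "\<dots> = of_real (4 * pi\<^sup>2) * (\<Sum>j\<in>J. if \<phi> j = 0 then c j else 0)"
    unfolding sum_distrib_left by (intro sum.cong refl) auto
  finally show ?thesis .
qed

text \<open>\<phi> may take a value several times: the coefficients at equal frequencies are added
  up, as products of trigonometric polynomials require.\<close>

lemma torus_fourier_sum_ech:
  assumes "finite J"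
  shows "torus_fourier (\<lambda>x. \<Sum>j\<in>J. c j * ech (\<phi> j) x) k = (\<Sum>j\<in>J. if \<phi> j = k then c j else 0)"
proof -
  have e: "(\<Sum>j\<in>J. c j * ech (\<phi> j) x) * cis (- (freq k \<bullet> x)) = (\<Sum>j\<in>J. c j * ech (\<phi> j - k) x)" for x
  proof -
    have "cis (- (freq k \<bullet> x)) = ech (- k) x" by (cases x) (simp add: ech_def freq_def)
    then show ?thesis by (simp add: sum_distrib_right mult.assoc ech_mult)
  qed
  have "torus_fourier (\<lambda>x. \<Sum>j\<in>J. c j * ech (\<phi> j) x) k
      = (1 / (4 * pi\<^sup>2)) *\<^sub>R (of_real (4 * pi\<^sup>2) * (\<Sum>j\<in>J. if \<phi> j - k = 0 then c j else 0))"
    unfolding torus_fourier_def e set_integral_sum_ech[OF assms] ..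
  also have "\<dots> = (\<Sum>j\<in>J. if \<phi> j - k = 0 then c j else 0)"
    by (simp add: scaleR_conv_of_real)
  finally show ?thesis by simp
qed

lemma torus_L2_sum_ech:
  assumes Z: "finite Z"
  shows "(LINT x:torus_cell|lborel. (cmod (\<Sum>z\<in>Z. c z * ech z x))\<^sup>2) = 4 * pi\<^sup>2 * (\<Sum>z\<in>Z. (cmod (c z))\<^sup>2)"
proof -
  define p where "p = (\<lambda>x. \<Sum>z\<in>Z. c z * ech z x)"
  have sq: "complex_of_real ((cmod (p x))\<^sup>2) = (\<Sum>j\<in>Z \<times> Z. (c (fst j) * cnj (c (snd j))) * ech (fst j - snd j) x)" for x
  proof -
    have "complex_of_real ((cmod (p x))\<^sup>2) = p x * cnj (p x)" by (rule complex_norm_square)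
    also have "\<dots> = (\<Sum>z\<in>Z. \<Sum>w\<in>Z. (c z * ech z x) * (cnj (c w) * ech (- w) x))"
      unfolding p_def by (simp add: ech_cnj sum_product)
    also have "\<dots> = (\<Sum>z\<in>Z. \<Sum>w\<in>Z. (c z * cnj (c w)) * ech (z - w) x)"
    proof (intro sum.cong refl)
      fix z w
      have "(c z * ech z x) * (cnj (c w) * ech (- w) x) = (c z * cnj (c w)) * (ech z x * ech (- w) x)" by (simp only: mult_ac)
      then show "(c z * ech z x) * (cnj (c w) * ech (- w) x) = (c z * cnj (c w)) * ech (z - w) x" by (simp add: ech_mult)
    qed
    finally show ?thesis by (simp add: sum.cartesian_product split_beta)
  qed
  have "complex_of_real (LINT x:torus_cell|lborel. (cmod (p x))\<^sup>2) = (LINT x:torus_cell|lborel. complex_of_real ((cmod (p x))\<^sup>2))"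
    unfolding set_lebesgue_integral_def
    by (subst integral_complex_of_real[symmetric]) (simp add: scaleR_conv_of_real)
  also have "\<dots> = of_real (4 * pi\<^sup>2) * (\<Sum>j\<in>Z \<times> Z. if fst j - snd j = 0 then c (fst j) * cnj (c (snd j)) else 0)"
    unfolding sq using Z by (intro set_integral_sum_ech) auto
  also have "(\<Sum>j\<in>Z \<times> Z. if fst j - snd j = 0 then c (fst j) * cnj (c (snd j)) else 0)
      = (\<Sum>z\<in>Z. \<Sum>w\<in>Z. if z = w then c z * cnj (c w) else 0)"
    by (simp add: sum.cartesian_product split_beta)
  also have "\<dots> = (\<Sum>z\<in>Z. c z * cnj (c z))" using Z by (intro sum.cong refl) (simp add: sum.delta)
  also have "\<dots> = of_real (\<Sum>z\<in>Z. (cmod (c z))\<^sup>2)" unfolding of_real_sum by (intro sum.cong refl complex_norm_square[symmetric])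
  finally have "complex_of_real (LINT x:torus_cell|lborel. (cmod (p x))\<^sup>2) = of_real (4 * pi\<^sup>2 * (\<Sum>z\<in>Z. (cmod (c z))\<^sup>2))"
    by simp
  then show ?thesis unfolding p_def of_real_eq_iff .
qed

lemma Proj_eq:
  assumes tau: "\<tau> > 0"
  shows "Proj \<tau> f = (\<lambda>x. \<Sum>k\<in>KS \<tau>. torus_fourier f k * ech k x)"
proof
  fix x
  have "Proj \<tau> f x = (\<Sum>\<^sub>\<infinity>k\<in>KS \<tau>. torus_fourier f k * ech k x)"
    unfolding Proj_def by (rule infsum_cong_neutral) (auto simp: KS_def ech_def indicator_def)
  then show "Proj \<tau> f x = (\<Sum>k\<in>KS \<tau>. torus_fourier f k * ech k x)"
    using finite_KS[OF tau] by simp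
qed

lemma Proj_continuous: "\<tau> > 0 \<Longrightarrow> continuous_on A (Proj \<tau> f)"
  unfolding Proj_eq by (intro continuous_intros)

lemma Proj_periodic: "\<tau> > 0 \<Longrightarrow> torus_periodic (Proj \<tau> f)"
  using ech_periodic unfolding Proj_eq torus_periodic_def by simp

lemma torus_fourier_Proj:
  assumes tau: "\<tau> > 0"
  shows "torus_fourier (Proj \<tau> f) k = (if k \<in> KS \<tau> then torus_fourier f k else 0)"
  unfolding Proj_eq[OF tau]
  by (subst torus_fourier_sum_ech[OF finite_KS[OF tau], where \<phi>="\<lambda>k. k"]) (simp add: sum.delta finite_KS[OF tau])

text \<open>The conjugation gives the second frequency a minus sign. The factors are ordered so that
  their time series arises as a convolution of numbers 1 and 3 followed by a correlation with number
  2, just as \<open>tri\<close> is built.\<close>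

lemma torus_fourier_cubic:
  assumes tau: "\<tau> > 0"
  shows "torus_fourier (cubic \<tau> v n) k = (if k \<in> KS \<tau> then
    (\<Sum>j\<in>{j\<in>KS \<tau> \<times> KS \<tau> \<times> KS \<tau>. fst j - fst (snd j) + snd (snd j) = k}.
       torus_fourier (v 1 n) (fst j) * torus_fourier (v 3 n) (snd (snd j)) * cnj (torus_fourier (v 2 n) (fst (snd j)))) else 0)"
proof -
  define K where "K = KS \<tau>"
  have finK: "finite K" unfolding K_def by (rule finite_KS[OF tau])
  define a where "a = (\<lambda>i. torus_fourier (v i n))"
  have w: "Proj \<tau> (v 1 n) x * cnj (Proj \<tau> (v 2 n) x) * Proj \<tau> (v 3 n) x
      = (\<Sum>j\<in>K \<times> K \<times> K. (a 1 (fst j) * a 3 (snd (snd j)) * cnj (a 2 (fst (snd j)))) * ech (fst j - fst (snd j) + snd (snd j)) x)" for x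
  proof -
    have "Proj \<tau> (v 1 n) x * cnj (Proj \<tau> (v 2 n) x) * Proj \<tau> (v 3 n) x
        = (\<Sum>k1\<in>K. a 1 k1 * ech k1 x) * ((\<Sum>k2\<in>K. cnj (a 2 k2) * ech (- k2) x) * (\<Sum>k3\<in>K. a 3 k3 * ech k3 x))"
      by (simp add: Proj_eq[OF tau] a_def K_def ech_cnj mult.assoc)
    also have "\<dots> = (\<Sum>k1\<in>K. \<Sum>j\<in>K \<times> K. (a 1 k1 * ech k1 x) * ((cnj (a 2 (fst j)) * ech (- fst j) x) * (a 3 (snd j) * ech (snd j) x)))"
      unfolding sum_product sum.cartesian_product split_beta ..
    also have "\<dots> = (\<Sum>j\<in>K \<times> K \<times> K. (a 1 (fst j) * ech (fst j) x) * ((cnj (a 2 (fst (snd j))) * ech (- fst (snd j)) x) * (a 3 (snd (snd j)) * ech (snd (snd j)) x)))"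
      unfolding sum.cartesian_product split_beta ..
    also have "\<dots> = (\<Sum>j\<in>K \<times> K \<times> K. (a 1 (fst j) * a 3 (snd (snd j)) * cnj (a 2 (fst (snd j)))) * ech (fst j - fst (snd j) + snd (snd j)) x)"
    proof (intro sum.cong refl)
      fix j :: "(int \<times> int) \<times> (int \<times> int) \<times> (int \<times> int)"
      have "(a 1 (fst j) * ech (fst j) x) * ((cnj (a 2 (fst (snd j))) * ech (- fst (snd j)) x) * (a 3 (snd (snd j)) * ech (snd (snd j)) x))
          = (a 1 (fst j) * a 3 (snd (snd j)) * cnj (a 2 (fst (snd j)))) * ((ech (fst j) x * ech (- fst (snd j)) x) * ech (snd (snd j)) x)"
        by (simp only: mult_ac)
      then show "(a 1 (fst j) * ech (fst j) x) * ((cnj (a 2 (fst (snd j))) * ech (- fst (snd j)) x) * (a 3 (snd (snd j)) * ech (snd (snd j)) x))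
          = (a 1 (fst j) * a 3 (snd (snd j)) * cnj (a 2 (fst (snd j)))) * ech (fst j - fst (snd j) + snd (snd j)) x"
        by (simp add: ech_mult)
    qed
    finally show ?thesis .
  qed
  have "torus_fourier (\<lambda>x. Proj \<tau> (v 1 n) x * cnj (Proj \<tau> (v 2 n) x) * Proj \<tau> (v 3 n) x) k
      = (\<Sum>j\<in>K \<times> K \<times> K. if fst j - fst (snd j) + snd (snd j) = k then a 1 (fst j) * a 3 (snd (snd j)) * cnj (a 2 (fst (snd j))) else 0)"
    unfolding w using finK by (intro torus_fourier_sum_ech) auto
  also have "\<dots> = (\<Sum>j\<in>{j\<in>K \<times> K \<times> K. fst j - fst (snd j) + snd (snd j) = k}. a 1 (fst j) * a 3 (snd (snd j)) * cnj (a 2 (fst (snd j))))"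
    using finK by (intro sum.inter_filter[symmetric]) auto
  finally show ?thesis
    unfolding cubic_def torus_fourier_Proj[OF tau] by (simp add: a_def K_def)
qed

text \<open>The fourth power of a modulus is the squared modulus of the square, which is a
  trigonometric polynomial with frequencies in \<open>Z\<close>, so Parseval applies to it.\<close>

lemma torus_L4_Proj:
  assumes tau: "\<tau> > 0"
  defines "Z \<equiv> (\<lambda>j. fst j + snd j) ` (KS \<tau> \<times> KS \<tau>)"
  shows "torus_Lp 4 (Proj \<tau> f)"
    and "torus_Lp_norm 4 (Proj \<tau> f) powr 4 = 4 * pi\<^sup>2 * (\<Sum>z\<in>Z. (cmod (\<Sum>j\<in>{j\<in>KS \<tau> \<times> KS \<tau>. fst j + snd j = z}.
          torus_fourier f (fst j) * torus_fourier f (snd j)))\<^sup>2)"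
proof -
  define K where "K = KS \<tau>"
  have finK: "finite K" unfolding K_def by (rule finite_KS[OF tau])
  define a where "a = torus_fourier f"
  have p4: "cmod w powr 4 = (cmod (w * w))\<^sup>2" for w
    by (simp add: norm_mult power2_eq_square numeral_eq_Suc mult_ac powr_numeral)
  have cont: "continuous_on UNIV (\<lambda>x. cmod (Proj \<tau> f x) powr 4)"
    unfolding p4 by (intro continuous_intros Proj_continuous tau)
  have bm: "set_borel_measurable lborel torus_cell (Proj \<tau> f)"
    using borel_measurable_integrable set_integrable_torus_continuous[OF Proj_continuous[OF tau]]
    unfolding set_borel_measurable_def set_integrable_def by blast
  show "torus_Lp 4 (Proj \<tau> f)"
    unfolding torus_Lp_def using bm Proj_periodic[OF tau] set_integrable_torus_continuous[OF cont] by blast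
  have sq: "Proj \<tau> f x * Proj \<tau> f x = (\<Sum>z\<in>Z. (\<Sum>j\<in>{j\<in>K \<times> K. fst j + snd j = z}. a (fst j) * a (snd j)) * ech z x)" for x
  proof -
    have "Proj \<tau> f x * Proj \<tau> f x = (\<Sum>j\<in>K \<times> K. (a (fst j) * a (snd j)) * ech (fst j + snd j) x)"
    proof -
      have "Proj \<tau> f x * Proj \<tau> f x = (\<Sum>j\<in>K \<times> K. (a (fst j) * ech (fst j) x) * (a (snd j) * ech (snd j) x))"
        unfolding Proj_eq[OF tau] a_def K_def sum_product sum.cartesian_product split_beta ..
      also have "\<dots> = (\<Sum>j\<in>K \<times> K. (a (fst j) * a (snd j)) * (ech (fst j) x * ech (snd j) x))"
        by (simp only: mult_ac)
      finally show ?thesis by (simp only: ech_mult)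
    qed
    also have "\<dots> = (\<Sum>z\<in>Z. \<Sum>j\<in>{j\<in>K \<times> K. fst j + snd j = z}. (a (fst j) * a (snd j)) * ech (fst j + snd j) x)"
      unfolding Z_def K_def[symmetric] using finK by (intro sum.image_gen) auto
    also have "\<dots> = (\<Sum>z\<in>Z. (\<Sum>j\<in>{j\<in>K \<times> K. fst j + snd j = z}. a (fst j) * a (snd j)) * ech z x)"
      unfolding sum_distrib_right by (intro sum.cong refl) auto
    finally show ?thesis .
  qed
  have finZ: "finite Z" unfolding Z_def K_def[symmetric] using finK by auto
  have "(LINT x:torus_cell|lborel. cmod (Proj \<tau> f x) powr 4)
      = 4 * pi\<^sup>2 * (\<Sum>z\<in>Z. (cmod (\<Sum>j\<in>{j\<in>K \<times> K. fst j + snd j = z}. a (fst j) * a (snd j)))\<^sup>2)" (is "?I = ?S")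
    unfolding p4 sq by (rule torus_L2_sum_ech[OF finZ])
  moreover have "?S \<ge> 0" by (intro mult_nonneg_nonneg sum_nonneg) auto
  ultimately have "torus_Lp_norm 4 (Proj \<tau> f) powr 4 = ?S"
    unfolding torus_Lp_norm_def by (simp add: powr_powr)
  then show "torus_Lp_norm 4 (Proj \<tau> f) powr 4 = 4 * pi\<^sup>2 * (\<Sum>z\<in>Z. (cmod (\<Sum>j\<in>{j\<in>KS \<tau> \<times> KS \<tau>. fst j + snd j = z}.
          torus_fourier f (fst j) * torus_fourier f (snd j)))\<^sup>2)" by (simp add: a_def K_def)
qed


subsection \<open>Transfer to the discrete Bourgain spaces\<close>

text \<open>The indicator carries the projection. Phases are given up here: from this point only
  nonnegative band-limited functions are estimated.\<close>

definition tf_abs :: "real \<Rightarrow> (int \<Rightarrow> plane_fun) \<Rightarrow> freq_space \<Rightarrow> ennreal" where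
  "tf_abs \<tau> u p = ennreal (indicat_real (KS \<tau>) (fst p) * cmod (time_fourier \<tau> u (snd p) (fst p)))"

lemma has_tf_time_fourier:
  assumes "\<tau> > 0" "\<exists>g. has_time_fourier \<tau> u k g"
  shows "has_tf \<tau> (\<lambda>m. torus_fourier (u m) k) (\<lambda>\<sigma>. time_fourier \<tau> u \<sigma> k)"
proof -
  have "has_time_fourier \<tau> u k (SOME g. has_time_fourier \<tau> u k g)" using assms(2) by (rule someI_ex)
  moreover have "(\<lambda>\<sigma>. time_fourier \<tau> u \<sigma> k) = (SOME g. has_time_fourier \<tau> u k g)"
    by (simp add: time_fourier_def fun_eq_iff)
  ultimately show ?thesis using has_time_fourier_iff[OF assms(1)] by simp
qed

lemma in_bourgainD:
  assumes "in_bourgain \<tau> s b u"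
  shows "\<exists>g. has_time_fourier \<tau> u k g" "set_integrable lborel (time_cell \<tau>) (bourgain_density \<tau> s b u k)"
  using assms unfolding in_bourgain_def by blast+

lemma in_bourgain_has_tf:
  assumes "\<tau> > 0" "in_bourgain \<tau> s b u"
  shows "has_tf \<tau> (\<lambda>m. torus_fourier (u m) k) (\<lambda>\<sigma>. time_fourier \<tau> u \<sigma> k)"
  by (rule has_tf_time_fourier[OF assms(1) in_bourgainD(1)[OF assms(2)]])

lemma tf_abs_band_limited:
  assumes tau: "\<tau> > 0" and u: "in_bourgain \<tau> s b u"
  shows "band_limited \<tau> (tf_abs \<tau> u)"
  unfolding band_limited_def
proof (intro conjI allI impI)
  show "tf_abs \<tau> u \<in> borel_measurable Gam"
  proof (rule borel_measurable_Gam_iff)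
    fix k
    have [measurable]: "(\<lambda>\<sigma>. time_fourier \<tau> u \<sigma> k) \<in> borel_measurable borel"
      by (rule L2c_measurable[OF has_tfD(2)[OF in_bourgain_has_tf[OF assms]]])
    show "(\<lambda>\<sigma>. tf_abs \<tau> u (k, \<sigma>)) \<in> borel_measurable borel" unfolding tf_abs_def by simp
  qed
  show "periodic2 \<tau> (tf_abs \<tau> u)"
    by (rule periodic2I) (simp add: tf_abs_def has_tfD(1)[OF in_bourgain_has_tf[OF assms]])
qed (simp add: tf_abs_def)

lemma bourgain_density_eq:
  "bourgain_density \<tau> s b u k \<sigma> = (jf (k, \<sigma>) powr s * wt \<tau> (k, \<sigma>) powr b * cmod (time_fourier \<tau> u \<sigma> k))\<^sup>2"
  unfolding bourgain_density_def norm_mult norm_of_real jf_def wt_def jd_def norm_freq_sq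
  by (simp add: abs_mult)

text \<open>Only an inequality, because the frequencies outside the band are dropped.\<close>

lemma bsq_tf_abs_le:
  assumes tau: "\<tau> > 0" and u: "in_bourgain \<tau> s b u"
  shows "bsq \<tau> s b (tf_abs \<tau> u) \<le> ennreal ((bourgain_norm \<tau> s b u)\<^sup>2)"
proof -
  define I where "I = (\<lambda>k. LINT \<sigma>:time_cell \<tau>|lborel. bourgain_density \<tau> s b u k \<sigma>)"
  have dm: "bourgain_density \<tau> s b u k \<in> borel_measurable borel" for k
  proof -
    have [measurable]: "(\<lambda>\<sigma>. time_fourier \<tau> u \<sigma> k) \<in> borel_measurable borel"
      by (rule L2c_measurable[OF has_tfD(2)[OF in_bourgain_has_tf[OF assms]]])
    have [measurable]: "(\<lambda>\<sigma>. wt \<tau> (k, \<sigma>)) \<in> borel_measurable borel" unfolding wt_def by simp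
    show ?thesis unfolding bourgain_density_eq[abs_def] jf_def by simp
  qed
  have d0: "bourgain_density \<tau> s b u k \<sigma> \<ge> 0" for k \<sigma> by (simp add: bourgain_density_def)
  have dI: "integrable (cellM \<tau>) (bourgain_density \<tau> s b u k)" for k
    using in_bourgainD(2)[OF u] set_integrable_time_cell_iff[OF dm] by blast
  have Ik: "(\<integral>\<^sup>+\<sigma>. ennreal (bourgain_density \<tau> s b u k \<sigma>) \<partial>cellM \<tau>) = ennreal (I k)" for k
    unfolding I_def set_integral_time_cell_eq[OF dm] by (rule nn_integral_eq_integral[OF dI]) (simp add: d0)
  have I0: "I k \<ge> 0" for k unfolding I_def set_integral_time_cell_eq[OF dm] by (intro integral_nonneg_AE) (simp add: d0)
  have Is: "I summable_on UNIV" using u by (simp add: in_bourgain_def I_def[abs_def])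
  have "bsq \<tau> s b (tf_abs \<tau> u) = (\<integral>\<^sup>+k. (\<integral>\<^sup>+\<sigma>. (ennreal (jf (k, \<sigma>) powr s * wt \<tau> (k, \<sigma>) powr b) * tf_abs \<tau> u (k, \<sigma>))\<^sup>2 \<partial>cellM \<tau>) \<partial>count_space UNIV)"
    unfolding bsq_def
    by (rule nn_integral_FM) (use band_limited_weight(1)[OF tf_abs_band_limited[OF assms] tau] in measurable)
  also have "\<dots> = (\<Sum>k\<in>KS \<tau>. (\<integral>\<^sup>+\<sigma>. (ennreal (jf (k, \<sigma>) powr s * wt \<tau> (k, \<sigma>) powr b) * tf_abs \<tau> u (k, \<sigma>))\<^sup>2 \<partial>cellM \<tau>))"
    by (rule nn_integral_count_space'[OF finite_KS[OF tau]]) (auto simp: tf_abs_def)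
  also have "\<dots> = (\<Sum>k\<in>KS \<tau>. (\<integral>\<^sup>+\<sigma>. ennreal (bourgain_density \<tau> s b u k \<sigma>) \<partial>cellM \<tau>))"
    by (intro sum.cong refl nn_integral_cong)
      (simp add: tf_abs_def bourgain_density_eq ennreal_mult[symmetric] ennreal_power)
  also have "\<dots> = ennreal (\<Sum>k\<in>KS \<tau>. I k)" unfolding Ik by (simp add: sum_ennreal I0)
  also have "\<dots> \<le> ennreal (\<Sum>\<^sub>\<infinity>k\<in>UNIV. I k)"
    by (intro ennreal_leI finite_sum_le_infsum Is finite_KS tau) (auto simp: I0)
  also have "\<dots> = ennreal ((bourgain_norm \<tau> s b u)\<^sup>2)"
    unfolding bourgain_norm_def by (simp add: I_def infsum_nonneg I0[unfolded I_def])
  finally show ?thesis .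
qed

text \<open>The passage back from the Fourier side: any family \<open>h\<close> of time series
  supported in the band may be used for the bound, since it agrees almost everywhere with the chosen
  \<open>time_fourier\<close>.\<close>

lemma bourgain_of_bound:
  assumes tau: "\<tau> > 0" and w: "\<And>n. torus_periodic (w n) \<and> set_integrable lborel torus_cell (w n)"
    and h: "\<And>k. has_tf \<tau> (\<lambda>m. torus_fourier (w m) k) (h k)" and h0: "\<And>k. k \<notin> KS \<tau> \<Longrightarrow> h k = (\<lambda>\<sigma>. 0)"
    and B: "(\<integral>\<^sup>+p. (ennreal (jf p powr s * wt \<tau> p powr b) * ennreal (cmod (h (fst p) (snd p))))\<^sup>2 \<partial>FM \<tau>) \<le> ennreal (B\<^sup>2)" "B \<ge> 0"
  shows "in_bourgain \<tau> s b w" "bourgain_norm \<tau> s b w \<le> B"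
proof -
  have ex: "\<exists>g. has_time_fourier \<tau> w k g" for k using h[of k] has_time_fourier_iff[OF tau] by blast
  note tf = has_tf_time_fourier[OF tau ex]
  have ae: "AE \<sigma> in cellM \<tau>. time_fourier \<tau> w \<sigma> k = h k \<sigma>" for k
    by (rule has_tf_unique[OF tf h])
  define I where "I = (\<lambda>k. LINT \<sigma>:time_cell \<tau>|lborel. bourgain_density \<tau> s b w k \<sigma>)"
  have wm [measurable]: "(\<lambda>\<sigma>. wt \<tau> (k, \<sigma>)) \<in> borel_measurable borel" for k unfolding wt_def by simp
  have dm: "bourgain_density \<tau> s b w k \<in> borel_measurable borel" for k
  proof -
    have [measurable]: "(\<lambda>\<sigma>. time_fourier \<tau> w \<sigma> k) \<in> borel_measurable borel"
      by (rule L2c_measurable[OF has_tfD(2)[OF tf]])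
    show ?thesis unfolding bourgain_density_eq[abs_def] jf_def by simp
  qed
  have hm [measurable]: "h k \<in> borel_measurable borel" for k by (rule L2c_measurable[OF has_tfD(2)[OF h]])
  have d0: "bourgain_density \<tau> s b w k \<sigma> \<ge> 0" for k \<sigma> by (simp add: bourgain_density_def)
  define J where "J = (\<lambda>k. \<integral>\<^sup>+\<sigma>. (ennreal (jf (k, \<sigma>) powr s * wt \<tau> (k, \<sigma>) powr b) * ennreal (cmod (h k \<sigma>)))\<^sup>2 \<partial>cellM \<tau>)"
  have J: "(\<integral>\<^sup>+\<sigma>. ennreal (bourgain_density \<tau> s b w k \<sigma>) \<partial>cellM \<tau>) = J k" for k
    unfolding J_def
  proof (rule nn_integral_cong_AE)
    show "AE \<sigma> in cellM \<tau>. ennreal (bourgain_density \<tau> s b w k \<sigma>)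
        = (ennreal (jf (k, \<sigma>) powr s * wt \<tau> (k, \<sigma>) powr b) * ennreal (cmod (h k \<sigma>)))\<^sup>2"
      using ae[of k]
      by eventually_elim (simp add: bourgain_density_eq ennreal_mult[symmetric] ennreal_power)
  qed
  have J0: "J k = 0" if "k \<notin> KS \<tau>" for k unfolding J_def h0[OF that] by simp
  define H where "H = (\<lambda>p. h (fst p) (snd p))"
  have [measurable]: "H \<in> borel_measurable Gam"
    by (rule borel_measurable_Gam_iff) (simp add: H_def)
  have Hm: "(\<lambda>p. (ennreal (jf p powr s * wt \<tau> p powr b) * ennreal (cmod (H p)))\<^sup>2) \<in> borel_measurable Gam"
    by measurable
  have "(\<integral>\<^sup>+p. (ennreal (jf p powr s * wt \<tau> p powr b) * ennreal (cmod (h (fst p) (snd p))))\<^sup>2 \<partial>FM \<tau>)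
      = (\<integral>\<^sup>+k. J k \<partial>count_space UNIV)"
    using nn_integral_FM[OF Hm] by (simp add: H_def J_def)
  also have "\<dots> = (\<Sum>k\<in>KS \<tau>. J k)"
    by (rule nn_integral_count_space'[OF finite_KS[OF tau]]) (auto simp: J0)
  finally have sumJ: "(\<Sum>k\<in>KS \<tau>. J k) \<le> ennreal (B\<^sup>2)" using B(1) by simp
  have Jfin: "J k < \<infinity>" for k
  proof (cases "k \<in> KS \<tau>")
    case True
    have "J k \<le> (\<Sum>k\<in>KS \<tau>. J k)" using True finite_KS[OF tau] by (intro member_le_sum) auto
    also note sumJ
    finally show ?thesis by (rule le_less_trans) simp
  qed (simp add: J0)
  have dI: "integrable (cellM \<tau>) (bourgain_density \<tau> s b w k)" for k
    by (rule integrableI_nonneg) (use dm d0 J Jfin in auto)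
  have IJ: "ennreal (I k) = J k" for k
    unfolding I_def set_integral_time_cell_eq[OF dm] J[symmetric]
    by (rule nn_integral_eq_integral[OF dI, symmetric]) (simp add: d0)
  have I0: "I k \<ge> 0" for k unfolding I_def set_integral_time_cell_eq[OF dm] by (intro integral_nonneg_AE) (simp add: d0)
  have Iz: "I k = 0" if "k \<notin> KS \<tau>" for k using IJ[of k] J0[OF that] I0[of k] by simp
  have Is: "(I has_sum (\<Sum>k\<in>KS \<tau>. I k)) UNIV"
    by (rule has_sum_finite_neutralI[OF finite_KS[OF tau]]) (auto simp: Iz)
  show "in_bourgain \<tau> s b w"
    unfolding in_bourgain_def
    using w ex dI set_integrable_time_cell_iff[OF dm] has_sum_imp_summable[OF Is] by (auto simp: I_def[abs_def])
  have "ennreal (\<Sum>k\<in>KS \<tau>. I k) \<le> ennreal (B\<^sup>2)"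
    using sumJ by (simp add: sum_ennreal[symmetric] I0 IJ)
  then have "(\<Sum>k\<in>KS \<tau>. I k) \<le> B\<^sup>2" by (simp add: ennreal_le_iff)
  then have "(\<Sum>\<^sub>\<infinity>k\<in>UNIV. I k) \<le> B\<^sup>2" using infsumI[OF Is] by simp
  then show "bourgain_norm \<tau> s b w \<le> B"
    unfolding bourgain_norm_def I_def[symmetric] using B(2) by (intro real_le_lsqrt)
qed

text \<open>Turns the spatial part of the convolution into a finite sum, to be compared with sums
  over pairs of frequencies.\<close>

lemma conv_slice:
  assumes tau: "\<tau> > 0" and [measurable]: "F \<in> borel_measurable Gam" "G \<in> borel_measurable Gam"
    and G0: "\<And>p. fst p \<notin> KS \<tau> \<Longrightarrow> G p = 0"
  shows "conv \<tau> F G (z, x) = (\<Sum>l\<in>KS \<tau>. \<integral>\<^sup>+r. F (z - l, x - r) * G (l, r) \<partial>cellM \<tau>)"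
proof -
  have "conv \<tau> F G (z, x) = (\<integral>\<^sup>+l. (\<integral>\<^sup>+r. F ((z, x) - (l, r)) * G (l, r) \<partial>cellM \<tau>) \<partial>count_space UNIV)"
    unfolding conv_def by (rule nn_integral_FM) measurable
  also have "\<dots> = (\<Sum>l\<in>KS \<tau>. \<integral>\<^sup>+r. F ((z, x) - (l, r)) * G (l, r) \<partial>cellM \<tau>)"
    by (rule nn_integral_count_space'[OF finite_KS[OF tau]]) (auto simp: G0)
  finally show ?thesis by simp
qed

lemma conv_slice_measurable:
  assumes "F1 \<in> borel_measurable Gam" "F3 \<in> borel_measurable Gam"
  shows "(\<lambda>q. \<integral>\<^sup>+r. F1 (l, \<sigma> + q - r) * F3 (k3, r) \<partial>cellM \<tau>) \<in> borel_measurable (cellM \<tau>)"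
proof -
  interpret T: sigma_finite_measure "cellM \<tau>" by (rule sigma_finite_cellM)
  show ?thesis
  proof (rule T.borel_measurable_nn_integral)
    have s: "(\<lambda>x. F1 (l, x)) \<in> borel_measurable borel" "(\<lambda>x. F3 (k3, x)) \<in> borel_measurable borel"
      using measurable_section_Gam assms by blast+
    have "(\<lambda>y. F1 (l, \<sigma> + fst y - snd y)) \<in> borel_measurable (cellM \<tau> \<Otimes>\<^sub>M cellM \<tau>)"
      by (rule measurable_compose[OF _ s(1)]) measurable
    moreover have "(\<lambda>y. F3 (k3, snd y)) \<in> borel_measurable (cellM \<tau> \<Otimes>\<^sub>M cellM \<tau>)"
      by (rule measurable_compose[OF _ s(2)]) measurable
    ultimately have "(\<lambda>y. F1 (l, \<sigma> + fst y - snd y) * F3 (k3, snd y)) \<in> borel_measurable (cellM \<tau> \<Otimes>\<^sub>M cellM \<tau>)"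
      by (rule borel_measurable_times_ennreal)
    then show "(\<lambda>(q, r). F1 (l, \<sigma> + q - r) * F3 (k3, r)) \<in> borel_measurable (cellM \<tau> \<Otimes>\<^sub>M cellM \<tau>)"
      by (simp add: split_beta')
  qed
qed

lemma tri_slice:
  assumes tau: "\<tau> > 0" and F: "band_limited \<tau> F1" "band_limited \<tau> F2" "band_limited \<tau> F3"
  shows "tri \<tau> F1 F2 F3 (k, \<sigma>) = (\<Sum>k2\<in>KS \<tau>. \<Sum>k3\<in>KS \<tau>.
    \<integral>\<^sup>+q. F2 (k2, q) * (\<integral>\<^sup>+r. F1 (k + k2 - k3, \<sigma> + q - r) * F3 (k3, r) \<partial>cellM \<tau>) \<partial>cellM \<tau>)"
proof -
  have [measurable]: "F1 \<in> borel_measurable Gam" "F2 \<in> borel_measurable Gam" "F3 \<in> borel_measurable Gam"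
    using F band_limited_measurable by blast+
  note m = conv_slice_measurable[OF band_limited_measurable[OF F(1)] band_limited_measurable[OF F(3)]]
  have m2: "(\<lambda>q. F2 (k2, q)) \<in> borel_measurable (cellM \<tau>)" for k2
    using measurable_section_Gam[of F2 k2] by simp
  have "tri \<tau> F1 F2 F3 (k, \<sigma>)
      = (\<integral>\<^sup>+k2. (\<integral>\<^sup>+q. F2 (k2, q) * conv \<tau> F1 F3 ((k, \<sigma>) + (k2, q)) \<partial>cellM \<tau>) \<partial>count_space UNIV)"
    unfolding tri_def by (rule nn_integral_FM) measurable
  also have "\<dots> = (\<Sum>k2\<in>KS \<tau>. \<integral>\<^sup>+q. F2 (k2, q) * conv \<tau> F1 F3 ((k, \<sigma>) + (k2, q)) \<partial>cellM \<tau>)"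
    by (rule nn_integral_count_space'[OF finite_KS[OF tau]]) (auto simp: band_limited_outside[OF F(2)])
  also have "\<dots> = (\<Sum>k2\<in>KS \<tau>. \<integral>\<^sup>+q. (\<Sum>k3\<in>KS \<tau>. F2 (k2, q) * (\<integral>\<^sup>+r. F1 (k + k2 - k3, \<sigma> + q - r) * F3 (k3, r) \<partial>cellM \<tau>)) \<partial>cellM \<tau>)"
    by (simp add: conv_slice[OF tau] band_limited_outside[OF F(3)] sum_distrib_left)
  also have "\<dots> = (\<Sum>k2\<in>KS \<tau>. \<Sum>k3\<in>KS \<tau>.
    \<integral>\<^sup>+q. F2 (k2, q) * (\<integral>\<^sup>+r. F1 (k + k2 - k3, \<sigma> + q - r) * F3 (k3, r) \<partial>cellM \<tau>) \<partial>cellM \<tau>)"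
    by (intro sum.cong refl nn_integral_sum borel_measurable_times_ennreal m m2)
  finally show ?thesis .
qed

lemma corr_cnj_reflect_le:
  assumes g: "L2c \<tau> g" and h: "L2c \<tau> h"
  shows "ennreal (cmod (corr \<tau> g (\<lambda>x. cnj (h (- x))) x / of_real (2 * pi)))
    \<le> (\<integral>\<^sup>+r. ennreal (cmod (g (x - r))) * ennreal (cmod (h r)) \<partial>cellM \<tau>)"
proof -
  have [measurable]: "g \<in> borel_measurable borel" "h \<in> borel_measurable borel" using assms L2c_measurable by blast+
  \<comment> \<open>The factor \<open>1 / (2 * pi)\<close> is less than 1 and is given away.\<close>
  have "cmod (corr \<tau> g (\<lambda>x. cnj (h (- x))) x / of_real (2 * pi)) \<le> cmod (corr \<tau> g (\<lambda>x. cnj (h (- x))) x) / 1"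
    unfolding norm_divide using pi_gt3 by (intro divide_left_mono) auto
  then have "ennreal (cmod (corr \<tau> g (\<lambda>x. cnj (h (- x))) x / of_real (2 * pi))) \<le> ennreal (cmod (corr \<tau> g (\<lambda>x. cnj (h (- x))) x))"
    by (intro ennreal_leI) simp
  also have "\<dots> \<le> (\<integral>\<^sup>+r. ennreal (cmod (g (x + r))) * ennreal (cmod (cnj (h (- r)))) \<partial>cellM \<tau>)"
    by (intro corr_norm_le g L2c_cnj L2c_reflect h)
  also have "\<dots> = (\<integral>\<^sup>+r. ennreal (cmod (g (x - - r))) * ennreal (cmod (h (- r))) \<partial>cellM \<tau>)" by simp
  also have "\<dots> = (\<integral>\<^sup>+r. ennreal (cmod (g (x - r))) * ennreal (cmod (h r)) \<partial>cellM \<tau>)"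
    by (rule nn_integral_cellM_minus[of "\<lambda>r. ennreal (cmod (g (x - r))) * ennreal (cmod (h r))"]) measurable
  finally show ?thesis .
qed

lemma has_tf_product:
  assumes "\<tau> > 0" "has_tf \<tau> a g" "has_tf \<tau> b h"
  shows "has_tf \<tau> (\<lambda>m. a m * b m) (\<lambda>x. corr \<tau> g (\<lambda>x. cnj (h (- x))) x / of_real (2 * pi))"
  using has_tf_corr[OF assms(1,2) has_tf_cnj_reflect[OF assms(3)]] by simp

text \<open>Each of the finitely many triples of frequencies has an explicit time series. Taking
  absolute values inside its integrals and summing over the triples leads to the nonnegative
  expression \<open>tri\<close>.\<close>

lemma cubic_time_fourier:
  assumes tau: "\<tau> > 0" and v: "in_bourgain \<tau> s1 b1 (v 1)" "in_bourgain \<tau> s2 b2 (v 2)" "in_bourgain \<tau> s3 b3 (v 3)"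
  obtains h where "\<And>k. has_tf \<tau> (\<lambda>m. torus_fourier (cubic \<tau> v m) k) (h k)" "\<And>k. k \<notin> KS \<tau> \<Longrightarrow> h k = (\<lambda>\<sigma>. 0)"
    "\<And>k \<sigma>. ennreal (cmod (h k \<sigma>)) \<le> tri \<tau> (tf_abs \<tau> (v 1)) (tf_abs \<tau> (v 2)) (tf_abs \<tau> (v 3)) (k, \<sigma>)"
proof -
  define G where "G = (\<lambda>(i::nat) k \<sigma>. time_fourier \<tau> (v i) \<sigma> k)"
  define F where "F = (\<lambda>i::nat. tf_abs \<tau> (v i))"
  have G1: "has_tf \<tau> (\<lambda>m. torus_fourier (v 1 m) k) (G 1 k)"
    and G2: "has_tf \<tau> (\<lambda>m. torus_fourier (v 2 m) k) (G 2 k)"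
    and G3: "has_tf \<tau> (\<lambda>m. torus_fourier (v 3 m) k) (G 3 k)" for k
    unfolding G_def using in_bourgain_has_tf[OF tau] v by blast+
  have FB: "band_limited \<tau> (F 1)" "band_limited \<tau> (F 2)" "band_limited \<tau> (F 3)"
    unfolding F_def using tf_abs_band_limited[OF tau] v by blast+
  have FG: "ennreal (cmod (G i k \<sigma>)) = F i (k, \<sigma>)" if "k \<in> KS \<tau>" for i k \<sigma>
    using that by (simp add: F_def G_def tf_abs_def)
  \<comment> \<open>The series of the product of coefficients 1 and 3; correlating it with number 2
    in \<open>H\<close> brings in the conjugate.\<close>
  define V where "V = (\<lambda>k1 k3 x. corr \<tau> (G 1 k1) (\<lambda>x. cnj (G 3 k3 (- x))) x / of_real (2 * pi))"
  have V: "has_tf \<tau> (\<lambda>m. torus_fourier (v 1 m) k1 * torus_fourier (v 3 m) k3) (V k1 k3)" for k1 k3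
    unfolding V_def by (rule has_tf_product[OF tau G1 G3])
  define H where "H = (\<lambda>j x. corr \<tau> (V (fst j) (snd (snd j))) (G 2 (fst (snd j))) x / of_real (2 * pi))"
  have H: "has_tf \<tau> (\<lambda>m. torus_fourier (v 1 m) (fst j) * torus_fourier (v 3 m) (snd (snd j)) * cnj (torus_fourier (v 2 m) (fst (snd j)))) (H j)" for j
    unfolding H_def by (rule has_tf_corr[OF tau V G2])
  define J where "J = (\<lambda>k. {j\<in>KS \<tau> \<times> KS \<tau> \<times> KS \<tau>. fst j - fst (snd j) + snd (snd j) = k})"
  define h where "h = (\<lambda>k. if k \<in> KS \<tau> then (\<lambda>x. \<Sum>j\<in>J k. H j x) else (\<lambda>x. 0))"
  define t where "t = (\<lambda>k \<sigma> l. \<integral>\<^sup>+q. F 2 (fst l, q) * (\<integral>\<^sup>+r. F 1 (k + fst l - snd l, \<sigma> + q - r) * F 3 (snd l, r) \<partial>cellM \<tau>) \<partial>cellM \<tau>)"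
  show ?thesis
  proof (rule that[of h])
    show "h k = (\<lambda>\<sigma>. 0)" if "k \<notin> KS \<tau>" for k using that by (simp add: h_def)
    show "has_tf \<tau> (\<lambda>m. torus_fourier (cubic \<tau> v m) k) (h k)" for k
    proof (cases "k \<in> KS \<tau>")
      case True
      then show ?thesis
        unfolding torus_fourier_cubic[OF tau] h_def J_def by (simp only: if_True) (rule has_tf_sum, rule H)
    next
      case False
      then show ?thesis unfolding torus_fourier_cubic[OF tau] h_def by (simp add: has_tf_0)
    qed
    have Hb: "ennreal (cmod (H j \<sigma>)) \<le> t k \<sigma> (snd j)" if j: "j \<in> J k" for j k \<sigma>
    proof -
      obtain k1 k2 k3 where jj: "j = (k1, k2, k3)" by (cases j)
      have K: "k1 \<in> KS \<tau>" "k2 \<in> KS \<tau>" "k3 \<in> KS \<tau>" and k: "k + k2 - k3 = k1" using j by (auto simp: J_def jj)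
      have "cmod (H j \<sigma>) \<le> cmod (corr \<tau> (V k1 k3) (G 2 k2) \<sigma>) / 1"
        unfolding H_def jj fst_conv snd_conv norm_divide using pi_gt3 by (intro divide_left_mono) auto
      then have "ennreal (cmod (H j \<sigma>)) \<le> ennreal (cmod (corr \<tau> (V k1 k3) (G 2 k2) \<sigma>))" by (intro ennreal_leI) simp
      also have "\<dots> \<le> (\<integral>\<^sup>+q. ennreal (cmod (V k1 k3 (\<sigma> + q))) * ennreal (cmod (G 2 k2 q)) \<partial>cellM \<tau>)"
        by (rule corr_norm_le[OF has_tfD(2)[OF V] has_tfD(2)[OF G2]])
      also have "\<dots> \<le> (\<integral>\<^sup>+q. (\<integral>\<^sup>+r. ennreal (cmod (G 1 k1 (\<sigma> + q - r))) * ennreal (cmod (G 3 k3 r)) \<partial>cellM \<tau>) * ennreal (cmod (G 2 k2 q)) \<partial>cellM \<tau>)"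
        unfolding V_def
        by (intro nn_integral_mono mult_right_mono corr_cnj_reflect_le has_tfD(2)[OF G1] has_tfD(2)[OF G3]) auto
      also have "\<dots> = t k \<sigma> (snd j)" unfolding t_def jj snd_conv fst_conv k FG[OF K(1)] FG[OF K(2)] FG[OF K(3)]
        by (simp add: mult.commute)
      finally show ?thesis .
    qed
    show "ennreal (cmod (h k \<sigma>)) \<le> tri \<tau> (tf_abs \<tau> (v 1)) (tf_abs \<tau> (v 2)) (tf_abs \<tau> (v 3)) (k, \<sigma>)" for k \<sigma>
    proof (cases "k \<in> KS \<tau>")
      case True
      have fin: "finite (KS \<tau>)" by (rule finite_KS[OF tau])
      have "ennreal (cmod (h k \<sigma>)) \<le> ennreal (\<Sum>j\<in>J k. cmod (H j \<sigma>))"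
        using True by (intro ennreal_leI) (simp add: h_def norm_sum)
      also have "\<dots> = (\<Sum>j\<in>J k. ennreal (cmod (H j \<sigma>)))" by (simp add: sum_ennreal)
      also have "\<dots> \<le> (\<Sum>j\<in>J k. t k \<sigma> (snd j))" by (intro sum_mono Hb)
      \<comment> \<open>In \<open>J k\<close> the first frequency is determined by the other two, so
        the last two entries index the triples. The pairs added afterwards contribute nonnegative
        terms.\<close>
      also have "\<dots> = (\<Sum>l\<in>snd ` J k. t k \<sigma> l)"
        by (rule sum.reindex_cong[symmetric, where l=snd]) (auto simp: inj_on_def J_def)
      also have "\<dots> \<le> (\<Sum>l\<in>KS \<tau> \<times> KS \<tau>. t k \<sigma> l)"
        using fin by (intro sum_mono2) (auto simp: J_def)
      also have "\<dots> = tri \<tau> (F 1) (F 2) (F 3) (k, \<sigma>)"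
        unfolding tri_slice[OF tau FB] t_def by (simp add: sum.cartesian_product split_beta)
      finally show ?thesis by (simp add: F_def)
    qed (simp add: h_def)
  qed
qed

text \<open>An estimate with exponent \<open>b0\<close> suffices for every larger \<open>b\<close>,
  as \<open>wt\<close> is at least 1 and enters with a negative power. The spaces of the three
  arguments are left independent, so that the one without spatial weight may stand anywhere.\<close>

lemma cubic_estimate:
  assumes tau: "\<tau> > 0" and v: "in_bourgain \<tau> s1 b1 (v 1)" "in_bourgain \<tau> s2 b2 (v 2)" "in_bourgain \<tau> s3 b3 (v 3)"
    and b: "b0 \<le> b" and C: "C \<ge> 0" and N: "N1 \<ge> 0" "N2 \<ge> 0" "N3 \<ge> 0"
    and est: "(\<integral>\<^sup>+p. (ennreal (indicat_real (KS \<tau>) (fst p) * (jf p powr s * wt \<tau> p powr (- b0)))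
        * tri \<tau> (tf_abs \<tau> (v 1)) (tf_abs \<tau> (v 2)) (tf_abs \<tau> (v 3)) p)\<^sup>2 \<partial>FM \<tau>)
      \<le> ennreal C * (ennreal (N1\<^sup>2) * ennreal (N2\<^sup>2) * ennreal (N3\<^sup>2))"
  shows "in_bourgain \<tau> s (- b) (cubic \<tau> v) \<and> bourgain_norm \<tau> s (- b) (cubic \<tau> v) \<le> sqrt C * N1 * N2 * N3"
proof -
  obtain h where h: "\<And>k. has_tf \<tau> (\<lambda>m. torus_fourier (cubic \<tau> v m) k) (h k)" "\<And>k. k \<notin> KS \<tau> \<Longrightarrow> h k = (\<lambda>\<sigma>. 0)"
    "\<And>k \<sigma>. ennreal (cmod (h k \<sigma>)) \<le> tri \<tau> (tf_abs \<tau> (v 1)) (tf_abs \<tau> (v 2)) (tf_abs \<tau> (v 3)) (k, \<sigma>)"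
    using cubic_time_fourier[where v=v, OF tau v] by blast
  have w: "torus_periodic (cubic \<tau> v n) \<and> set_integrable lborel torus_cell (cubic \<tau> v n)" for n
    unfolding cubic_def using Proj_periodic[OF tau] set_integrable_torus_continuous[OF Proj_continuous[OF tau]] by blast
  define B where "B = sqrt C * N1 * N2 * N3"
  have "(\<integral>\<^sup>+p. (ennreal (jf p powr s * wt \<tau> p powr (- b)) * ennreal (cmod (h (fst p) (snd p))))\<^sup>2 \<partial>FM \<tau>)
      \<le> (\<integral>\<^sup>+p. (ennreal (indicat_real (KS \<tau>) (fst p) * (jf p powr s * wt \<tau> p powr (- b0)))
        * tri \<tau> (tf_abs \<tau> (v 1)) (tf_abs \<tau> (v 2)) (tf_abs \<tau> (v 3)) p)\<^sup>2 \<partial>FM \<tau>)"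
  proof (intro nn_integral_mono power_mono)
    fix p
    show "ennreal (jf p powr s * wt \<tau> p powr (- b)) * ennreal (cmod (h (fst p) (snd p)))
      \<le> ennreal (indicat_real (KS \<tau>) (fst p) * (jf p powr s * wt \<tau> p powr (- b0)))
        * tri \<tau> (tf_abs \<tau> (v 1)) (tf_abs \<tau> (v 2)) (tf_abs \<tau> (v 3)) p"
    proof (cases "fst p \<in> KS \<tau>")
      case True
      have "wt \<tau> p powr (- b) \<le> wt \<tau> p powr (- b0)" using b by (intro powr_mono wt_ge_1) auto
      then have "jf p powr s * wt \<tau> p powr (- b) \<le> jf p powr s * wt \<tau> p powr (- b0)" by (intro mult_left_mono) auto
      then have e: "ennreal (jf p powr s * wt \<tau> p powr (- b))
          \<le> ennreal (indicat_real (KS \<tau>) (fst p) * (jf p powr s * wt \<tau> p powr (- b0)))"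
        using True by (intro ennreal_leI) simp
      show ?thesis by (rule mult_mono[OF e]) (use h(3)[of "fst p" "snd p"] in auto)
    next
      case False
      then show ?thesis by (simp add: h(2))
    qed
  qed auto
  also note est
  also have "ennreal C * (ennreal (N1\<^sup>2) * ennreal (N2\<^sup>2) * ennreal (N3\<^sup>2)) = ennreal (B\<^sup>2)"
    using C by (simp add: B_def power_mult_distrib ennreal_mult[symmetric] mult.assoc)
  finally have est': "(\<integral>\<^sup>+p. (ennreal (jf p powr s * wt \<tau> p powr (- b)) * ennreal (cmod (h (fst p) (snd p))))\<^sup>2 \<partial>FM \<tau>)
      \<le> ennreal (B\<^sup>2)" .
  have B0: "B \<ge> 0" using C N by (simp add: B_def)
  from bourgain_of_bound[OF tau w h(1,2) est' B0] show ?thesis by (simp add: B_def)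
qed

text \<open>Parseval in space expresses the fourth power of the norm by squared coefficients of the
  square of the function. Parseval in time turns their sum over \<open>n\<close> into squared norms
  of the series \<open>h z\<close>, which the convolution of \<open>tf_abs \<tau> u\<close> with
  itself dominates.\<close>

lemma L4_estimate:
  assumes tau: "\<tau> > 0" and u: "in_bourgain \<tau> s b u" and A: "A \<ge> 0"
    and est: "(\<integral>\<^sup>+p. (conv \<tau> (tf_abs \<tau> u) (tf_abs \<tau> u) p)\<^sup>2 \<partial>FM \<tau>) \<le> ennreal A"
  shows "in_lpLp 4 (\<lambda>n. Proj \<tau> (u n)) \<and> lpLp_norm \<tau> 4 (\<lambda>n. Proj \<tau> (u n)) \<le> (2 * pi * A) powr (1 / 4)"
proof -
  define G where "G = (\<lambda>k \<sigma>. time_fourier \<tau> u \<sigma> k)"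
  define F where "F = tf_abs \<tau> u"
  have G: "has_tf \<tau> (\<lambda>m. torus_fourier (u m) k) (G k)" for k
    unfolding G_def by (rule in_bourgain_has_tf[OF tau u])
  have FB: "band_limited \<tau> F" unfolding F_def by (rule tf_abs_band_limited[OF tau u])
  note Fm = band_limited_measurable[OF FB]
  have FG: "ennreal (cmod (G k \<sigma>)) = F (k, \<sigma>)" if "k \<in> KS \<tau>" for k \<sigma>
    using that by (simp add: F_def G_def tf_abs_def)
  define Z where "Z = (\<lambda>j. fst j + snd j) ` (KS \<tau> \<times> KS \<tau>)"
  have fin: "finite (KS \<tau>)" by (rule finite_KS[OF tau])
  have finZ: "finite Z" unfolding Z_def using fin by auto
  define J where "J = (\<lambda>z. {j\<in>KS \<tau> \<times> KS \<tau>. fst j + snd j = z})"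
  define c where "c = (\<lambda>z n. \<Sum>j\<in>J z. torus_fourier (u n) (fst j) * torus_fourier (u n) (snd j))"
  define H where "H = (\<lambda>j x. corr \<tau> (G (fst j)) (\<lambda>x. cnj (G (snd j) (- x))) x / of_real (2 * pi))"
  define h where "h = (\<lambda>z x. \<Sum>j\<in>J z. H j x)"
  have h: "has_tf \<tau> (c z) (h z)" for z
    unfolding c_def h_def H_def by (intro has_tf_sum has_tf_product[OF tau G G])
  have hb: "ennreal (cmod (h z x)) \<le> conv \<tau> F F (z, x)" for z x
  proof -
    have "ennreal (cmod (h z x)) \<le> ennreal (\<Sum>j\<in>J z. cmod (H j x))"
      by (intro ennreal_leI) (simp add: h_def norm_sum)
    also have "\<dots> = (\<Sum>j\<in>J z. ennreal (cmod (H j x)))" by (simp add: sum_ennreal)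
    also have "\<dots> \<le> (\<Sum>j\<in>J z. \<integral>\<^sup>+r. F (z - snd j, x - r) * F (snd j, r) \<partial>cellM \<tau>)"
    proof (rule sum_mono)
      fix j assume j: "j \<in> J z"
      then have K: "fst j \<in> KS \<tau>" "snd j \<in> KS \<tau>" and z: "z - snd j = fst j" by (auto simp: J_def)
      show "ennreal (cmod (H j x)) \<le> (\<integral>\<^sup>+r. F (z - snd j, x - r) * F (snd j, r) \<partial>cellM \<tau>)"
        unfolding H_def z FG[OF K(1), symmetric] FG[OF K(2), symmetric]
        by (rule corr_cnj_reflect_le[OF has_tfD(2)[OF G] has_tfD(2)[OF G]])
    qed
    also have "\<dots> = (\<Sum>l\<in>snd ` J z. \<integral>\<^sup>+r. F (z - l, x - r) * F (l, r) \<partial>cellM \<tau>)"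
      by (rule sum.reindex_cong[symmetric, where l=snd]) (auto simp: inj_on_def J_def)
    also have "\<dots> \<le> (\<Sum>l\<in>KS \<tau>. \<integral>\<^sup>+r. F (z - l, x - r) * F (l, r) \<partial>cellM \<tau>)"
      using fin by (intro sum_mono2) (auto simp: J_def)
    also have "\<dots> = conv \<tau> F F (z, x)"
      by (rule conv_slice[OF tau Fm Fm, symmetric]) (rule band_limited_outside[OF FB])
    finally show ?thesis .
  qed
  have "ennreal (\<Sum>z\<in>Z. (nrm \<tau> (h z))\<^sup>2) = (\<Sum>z\<in>Z. \<integral>\<^sup>+x. ennreal ((cmod (h z x))\<^sup>2) \<partial>cellM \<tau>)"
    by (simp add: nn_integral_L2c[OF has_tfD(2)[OF h]] sum_ennreal)
  also have "\<dots> \<le> (\<Sum>z\<in>Z. \<integral>\<^sup>+x. (conv \<tau> F F (z, x))\<^sup>2 \<partial>cellM \<tau>)"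
    using hb by (intro sum_mono nn_integral_mono) (simp add: ennreal_power[symmetric] power_mono)
  also have "\<dots> = (\<integral>\<^sup>+z. (\<integral>\<^sup>+x. (conv \<tau> F F (z, x))\<^sup>2 \<partial>cellM \<tau>) * indicator Z z \<partial>count_space UNIV)"
    by (subst nn_integral_count_space'[OF finZ]) (auto intro!: sum.cong)
  also have "\<dots> \<le> (\<integral>\<^sup>+z. (\<integral>\<^sup>+x. (conv \<tau> F F (z, x))\<^sup>2 \<partial>cellM \<tau>) \<partial>count_space UNIV)"
    by (intro nn_integral_mono) (auto simp: indicator_def)
  also have "\<dots> = (\<integral>\<^sup>+p. (conv \<tau> F F p)\<^sup>2 \<partial>FM \<tau>)"
  proof (rule nn_integral_FM[symmetric])
    show "(\<lambda>p. (conv \<tau> F F p)\<^sup>2) \<in> borel_measurable Gam" using conv_measurable[OF Fm Fm, of \<tau>] by measurable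
  qed
  also have "\<dots> \<le> ennreal A" using est by (simp add: F_def)
  finally have S: "(\<Sum>z\<in>Z. (nrm \<tau> (h z))\<^sup>2) \<le> A" using A by (simp add: ennreal_le_iff)
  have L4: "torus_Lp_norm 4 (Proj \<tau> (u n)) powr 4 = 4 * pi\<^sup>2 * (\<Sum>z\<in>Z. (cmod (c z n))\<^sup>2)" for n
    unfolding torus_L4_Proj(2)[OF tau] c_def Z_def J_def ..
  have "((\<lambda>n. 4 * pi\<^sup>2 * (\<Sum>z\<in>Z. (cmod (c z n))\<^sup>2)) has_sum (4 * pi\<^sup>2 * (\<Sum>z\<in>Z. (nrm \<tau> (h z))\<^sup>2 / (2 * pi * \<tau>)))) UNIV"
  proof (rule has_sum_cmult_right)
    show "((\<lambda>n. \<Sum>z\<in>Z. (cmod (c z n))\<^sup>2) has_sum (\<Sum>z\<in>Z. (nrm \<tau> (h z))\<^sup>2 / (2 * pi * \<tau>))) UNIV"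
      using finZ
    proof (induction Z)
      case (insert z Z)
      then show ?case using has_sum_add[OF has_tf_Parseval[OF tau h[of z]] insert.IH] by simp
    qed simp
  qed
  then have hs: "((\<lambda>n. torus_Lp_norm 4 (Proj \<tau> (u n)) powr 4) has_sum
      (4 * pi\<^sup>2 * (\<Sum>z\<in>Z. (nrm \<tau> (h z))\<^sup>2 / (2 * pi * \<tau>)))) UNIV" unfolding L4 .
  \<comment> \<open>The area \<open>4 * pi\<^sup>2\<close> of the torus, the factor
    \<open>1 / (2 * pi * \<tau>)\<close> of Parseval in time and the \<tau> of the norm leave
    \<open>2 * pi\<close>.\<close>
  have "\<tau> * (4 * pi\<^sup>2 * (\<Sum>z\<in>Z. (nrm \<tau> (h z))\<^sup>2 / (2 * pi * \<tau>))) = 2 * pi * (\<Sum>z\<in>Z. (nrm \<tau> (h z))\<^sup>2)"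
    using tau by (simp add: sum_divide_distrib[symmetric] power2_eq_square field_simps)
  also have "\<dots> \<le> 2 * pi * A" using S by simp
  finally have le: "\<tau> * (4 * pi\<^sup>2 * (\<Sum>z\<in>Z. (nrm \<tau> (h z))\<^sup>2 / (2 * pi * \<tau>))) \<le> 2 * pi * A" .
  have "lpLp_norm \<tau> 4 (\<lambda>n. Proj \<tau> (u n)) \<le> (2 * pi * A) powr (1 / 4)"
    unfolding lpLp_norm_def infsumI[OF hs] using le tau by (intro powr_mono2) (auto intro!: mult_nonneg_nonneg sum_nonneg)
  then show ?thesis
    unfolding in_lpLp_def using torus_L4_Proj(1)[OF tau] has_sum_imp_summable[OF hs] by blast
qed

section \<open>Assembly of the three estimates\<close>

lemma bsq_mono:
  assumes "s \<le> s'" "b \<le> b'"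
  shows "bsq \<tau> s b F \<le> bsq \<tau> s' b' F"
  unfolding bsq_def
proof (intro nn_integral_mono power_mono mult_right_mono ennreal_leI mult_mono)
  show "jf p powr s \<le> jf p powr s'" "wt \<tau> p powr b \<le> wt \<tau> p powr b'" for p
    using assms by (auto intro!: powr_mono jf_ge_1 wt_ge_1)
qed auto

theorem theorem3p3:
  fixes s b b1 :: real
  assumes "s > 0"
    and "b > max (1 / 4) (1 / 2 - s / 4)"
    and "b1 > 1 / 2"
  shows "\<exists>C::real. C > 0 \<and> (\<forall>\<tau>::real. 0 < \<tau> \<and> \<tau> \<le> 1 \<longrightarrow>
    (\<forall>u. in_bourgain \<tau> s b1 u \<longrightarrow>
       in_lpLp 4 (\<lambda>n. Proj \<tau> (u n)) \<and>
       lpLp_norm \<tau> 4 (\<lambda>n. Proj \<tau> (u n)) \<le> C * bourgain_norm \<tau> s b1 u) \<and>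
    (\<forall>v. (\<forall>i\<in>{1, 2, 3}. in_bourgain \<tau> s b (v i)) \<longrightarrow>
       in_bourgain \<tau> s (- b) (cubic \<tau> v) \<and>
       bourgain_norm \<tau> s (- b) (cubic \<tau> v)
         \<le> C * bourgain_norm \<tau> s b (v 1) * bourgain_norm \<tau> s b (v 2) * bourgain_norm \<tau> s b (v 3)) \<and>
    (\<forall>\<pi> v. \<pi> permutes {1, 2, 3::nat} \<and> in_bourgain \<tau> s b (v (\<pi> 1)) \<and>
         in_bourgain \<tau> s b (v (\<pi> 2)) \<and> in_bourgain \<tau> 0 b (v (\<pi> 3)) \<longrightarrow>
       in_bourgain \<tau> 0 (- b) (cubic \<tau> v) \<and>
       bourgain_norm \<tau> 0 (- b) (cubic \<tau> v)
         \<le> C * bourgain_norm \<tau> s b (v (\<pi> 1)) * bourgain_norm \<tau> s b (v (\<pi> 2))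
             * bourgain_norm \<tau> 0 b (v (\<pi> 3))))"
proof -
  define m where "m = max (1 / 4) (1 / 2 - s / 4)"
  \<comment> \<open>The midpoint of \<open>m\<close> and \<open>1 / 2\<close>, or \<open>b\<close>
    if that is smaller. It exceeds \<open>m\<close>, is at most \<open>b\<close> and is less than
    \<open>b1\<close>; as the norms increase with the exponent, it serves all three
    estimates.\<close>
  define b0 where "b0 = min b (m / 2 + 1 / 4)"
  have m: "m < 1 / 2" using \<open>s > 0\<close> unfolding m_def max_less_iff_conj by simp
  have "m < b0" using m assms(2) by (auto simp: b0_def m_def[symmetric])
  then have b0: "1 / 4 < b0" "1 / 2 - s / 4 < b0" by (auto simp: m_def)
  have "b0 \<le> m / 2 + 1 / 4" unfolding b0_def by (rule min.cobounded2)
  then have "b0 < 1 / 2" using m by linarith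
  moreover have "b0 \<le> b" unfolding b0_def by (rule min.cobounded1)
  ultimately have b0': "b0 < 1 / 2" "b0 \<le> b" .
  have b0b1: "b0 \<le> b1" using b0'(1) assms(3) by simp
  obtain C1 where C1: "C1 > 0" "\<And>\<tau> F G. \<tau> > 0 \<Longrightarrow> band_limited \<tau> F \<Longrightarrow> band_limited \<tau> G \<Longrightarrow>
    (\<integral>\<^sup>+t. (conv \<tau> F G t)\<^sup>2 \<partial>FM \<tau>) \<le> ennreal C1 * bsq \<tau> 0 b0 F * bsq \<tau> s b0 G"
    using bilinear_bound[OF \<open>s > 0\<close> b0 b0'(1)] by blast
  obtain C2 where C2: "C2 > 0" "\<And>\<tau> F1 F2 F3. \<tau> > 0 \<Longrightarrow> band_limited \<tau> F1 \<Longrightarrow> band_limited \<tau> F2 \<Longrightarrow> band_limited \<tau> F3 \<Longrightarrow>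
    (\<integral>\<^sup>+p. (ennreal (indicat_real (KS \<tau>) (fst p) * wt \<tau> p powr (- b0)) * tri \<tau> F1 F2 F3 p)\<^sup>2 \<partial>FM \<tau>)
    \<le> ennreal C2 * min (bsq \<tau> 0 b0 F1 * bsq \<tau> s b0 F2 * bsq \<tau> s b0 F3)
        (min (bsq \<tau> s b0 F1 * bsq \<tau> 0 b0 F2 * bsq \<tau> s b0 F3) (bsq \<tau> s b0 F1 * bsq \<tau> s b0 F2 * bsq \<tau> 0 b0 F3))"
    using trilinear_bound[OF \<open>s > 0\<close> b0 b0'(1)] by blast
  obtain C3 where C3: "C3 > 0" "\<And>\<tau> F1 F2 F3. \<tau> > 0 \<Longrightarrow> band_limited \<tau> F1 \<Longrightarrow> band_limited \<tau> F2 \<Longrightarrow> band_limited \<tau> F3 \<Longrightarrow>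
    (\<integral>\<^sup>+p. (ennreal (indicat_real (KS \<tau>) (fst p) * (jf p powr s * wt \<tau> p powr (- b0))) * tri \<tau> F1 F2 F3 p)\<^sup>2 \<partial>FM \<tau>)
    \<le> ennreal C3 * (bsq \<tau> s b0 F1 * bsq \<tau> s b0 F2 * bsq \<tau> s b0 F3)"
    using weighted_trilinear_bound[OF \<open>s > 0\<close> b0 b0'(1)] by blast
  have norm0: "bourgain_norm \<tau> s' b' u \<ge> 0" for \<tau> s' b' u
    unfolding bourgain_norm_def
    by (intro real_sqrt_ge_zero infsum_nonneg)
      (auto simp: set_lebesgue_integral_def bourgain_density_def intro!: integral_nonneg_AE)
  have bsqN: "bsq \<tau> s' b0 (tf_abs \<tau> u) \<le> ennreal ((bourgain_norm \<tau> s' b' u)\<^sup>2)"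
    if "\<tau> > 0" "in_bourgain \<tau> s' b' u" "b0 \<le> b'" for \<tau> s' b' u
    using bsq_mono[OF order_refl that(3)] bsq_tf_abs_le[OF that(1,2)] by (rule order_trans)
  \<comment> \<open>The Fourier side bounds fourth powers in the first estimate and squares in the
    cubic ones, whence the roots; \<open>2 * pi\<close> is the factor of
    \<open>L4_estimate\<close>.\<close>
  define C where "C = Max {(2 * pi * C1) powr (1 / 4), sqrt C2, sqrt C3}"
  have CC: "(2 * pi * C1) powr (1 / 4) \<le> C" "sqrt C2 \<le> C" "sqrt C3 \<le> C" by (simp_all add: C_def)
  have "C > 0" using CC(2) C2(1) by (smt (verit) real_sqrt_gt_zero)
  have part1: "in_lpLp 4 (\<lambda>n. Proj \<tau> (u n)) \<and> lpLp_norm \<tau> 4 (\<lambda>n. Proj \<tau> (u n)) \<le> C * bourgain_norm \<tau> s b1 u"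
    if tau: "\<tau> > 0" and u: "in_bourgain \<tau> s b1 u" for \<tau> u
  proof -
    define N where "N = bourgain_norm \<tau> s b1 u"
    have N: "N \<ge> 0" by (simp add: N_def norm0)
    note FB = tf_abs_band_limited[OF tau u]
    have B: "bsq \<tau> s b0 (tf_abs \<tau> u) \<le> ennreal (N\<^sup>2)" unfolding N_def by (rule bsqN[OF tau u b0b1])
    have B0: "bsq \<tau> 0 b0 (tf_abs \<tau> u) \<le> ennreal (N\<^sup>2)"
      using bsq_mono[of 0 s b0 b0] \<open>s > 0\<close> B by (meson less_imp_le order_refl order_trans)
    have "(\<integral>\<^sup>+p. (conv \<tau> (tf_abs \<tau> u) (tf_abs \<tau> u) p)\<^sup>2 \<partial>FM \<tau>)
        \<le> ennreal C1 * bsq \<tau> 0 b0 (tf_abs \<tau> u) * bsq \<tau> s b0 (tf_abs \<tau> u)"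
      by (rule C1(2)[OF tau FB FB])
    also have "\<dots> \<le> ennreal C1 * ennreal (N\<^sup>2) * ennreal (N\<^sup>2)" by (intro mult_mono B B0) auto
    also have "\<dots> = ennreal (C1 * N ^ 4)"
      using C1(1) by (simp add: ennreal_mult[symmetric] mult.assoc power_add[symmetric])
    finally have est: "(\<integral>\<^sup>+p. (conv \<tau> (tf_abs \<tau> u) (tf_abs \<tau> u) p)\<^sup>2 \<partial>FM \<tau>) \<le> ennreal (C1 * N ^ 4)" .
    have "0 \<le> C1 * N ^ 4" using C1(1) by simp
    note L = L4_estimate[OF tau u this est]
    have "(2 * pi * (C1 * N ^ 4)) powr (1 / 4) = (2 * pi * C1) powr (1 / 4) * (N ^ 4) powr (1 / 4)"
      using C1(1) by (simp add: powr_mult[symmetric] mult.assoc)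
    also have "(N ^ 4) powr (1 / 4) = N"
      using N by (cases "N = 0") (simp_all add: powr_realpow[symmetric] powr_powr del: powr_numeral)
    also have "(2 * pi * C1) powr (1 / 4) * N \<le> C * N" using CC(1) N by (intro mult_right_mono)
    finally show ?thesis using L unfolding N_def by linarith
  qed
  have part2: "in_bourgain \<tau> s (- b) (cubic \<tau> v) \<and>
       bourgain_norm \<tau> s (- b) (cubic \<tau> v)
         \<le> C * bourgain_norm \<tau> s b (v 1) * bourgain_norm \<tau> s b (v 2) * bourgain_norm \<tau> s b (v 3)"
    if tau: "\<tau> > 0" and v: "in_bourgain \<tau> s b (v 1)" "in_bourgain \<tau> s b (v 2)" "in_bourgain \<tau> s b (v 3)" for \<tau> v
  proof -
    define N where "N = (\<lambda>i::nat. bourgain_norm \<tau> s b (v i))"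
    have N: "N i \<ge> 0" for i by (simp add: N_def norm0)
    note FB = tf_abs_band_limited[OF tau v(1)] tf_abs_band_limited[OF tau v(2)] tf_abs_band_limited[OF tau v(3)]
    have "(\<integral>\<^sup>+p. (ennreal (indicat_real (KS \<tau>) (fst p) * (jf p powr s * wt \<tau> p powr (- b0)))
        * tri \<tau> (tf_abs \<tau> (v 1)) (tf_abs \<tau> (v 2)) (tf_abs \<tau> (v 3)) p)\<^sup>2 \<partial>FM \<tau>)
      \<le> ennreal C3 * (ennreal ((N 1)\<^sup>2) * ennreal ((N 2)\<^sup>2) * ennreal ((N 3)\<^sup>2))"
      unfolding N_def
      by (rule order_trans[OF C3(2)[OF tau FB]]) (intro mult_mono bsqN[OF tau _ b0'(2)] v order_refl, auto)
    from cubic_estimate[where v=v, OF tau v b0'(2) _ N N N this] C3(1)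
    have "in_bourgain \<tau> s (- b) (cubic \<tau> v)" "bourgain_norm \<tau> s (- b) (cubic \<tau> v) \<le> sqrt C3 * N 1 * N 2 * N 3"
      by auto
    moreover have "sqrt C3 * N 1 * N 2 * N 3 \<le> C * N 1 * N 2 * N 3"
      by (intro mult_right_mono CC N)
    ultimately show ?thesis unfolding N_def by linarith
  qed
  \<comment> \<open>The exponents are attached to the three positions. Among the six permutations
    only the place \<open>\<pi> 3\<close> without spatial weight matters, because the product of the
    norms is symmetric; three cases remain.\<close>
  have part3: "in_bourgain \<tau> 0 (- b) (cubic \<tau> v) \<and> bourgain_norm \<tau> 0 (- b) (cubic \<tau> v)
         \<le> C * (bourgain_norm \<tau> s1 b (v 1) * bourgain_norm \<tau> s2 b (v 2) * bourgain_norm \<tau> s3 b (v 3))"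
    if tau: "\<tau> > 0" and v: "in_bourgain \<tau> s1 b (v 1)" "in_bourgain \<tau> s2 b (v 2)" "in_bourgain \<tau> s3 b (v 3)"
      and cs: "(s1, s2, s3) \<in> {(0, s, s), (s, 0, s), (s, s, 0)}" for \<tau> v s1 s2 s3
  proof -
    define N1 where "N1 = bourgain_norm \<tau> s1 b (v 1)"
    define N2 where "N2 = bourgain_norm \<tau> s2 b (v 2)"
    define N3 where "N3 = bourgain_norm \<tau> s3 b (v 3)"
    have N: "N1 \<ge> 0" "N2 \<ge> 0" "N3 \<ge> 0" by (simp_all add: N1_def N2_def N3_def norm0)
    note FB = tf_abs_band_limited[OF tau v(1)] tf_abs_band_limited[OF tau v(2)] tf_abs_band_limited[OF tau v(3)]
    let ?F1 = "tf_abs \<tau> (v 1)" and ?F2 = "tf_abs \<tau> (v 2)" and ?F3 = "tf_abs \<tau> (v 3)"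
    have "(\<integral>\<^sup>+p. (ennreal (indicat_real (KS \<tau>) (fst p) * (jf p powr 0 * wt \<tau> p powr (- b0))) * tri \<tau> ?F1 ?F2 ?F3 p)\<^sup>2 \<partial>FM \<tau>)
      = (\<integral>\<^sup>+p. (ennreal (indicat_real (KS \<tau>) (fst p) * wt \<tau> p powr (- b0)) * tri \<tau> ?F1 ?F2 ?F3 p)\<^sup>2 \<partial>FM \<tau>)"
      by (simp add: less_imp_neq[OF jf_pos, symmetric])
    also have "\<dots> \<le> ennreal C2 * (bsq \<tau> s1 b0 ?F1 * bsq \<tau> s2 b0 ?F2 * bsq \<tau> s3 b0 ?F3)"
      by (rule order_trans[OF C2(2)[OF tau FB]]) (use cs in \<open>intro mult_left_mono, auto simp: min_le_iff_disj\<close>)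
    also have "\<dots> \<le> ennreal C2 * (ennreal (N1\<^sup>2) * ennreal (N2\<^sup>2) * ennreal (N3\<^sup>2))"
      unfolding N1_def N2_def N3_def by (intro mult_mono bsqN[OF tau _ b0'(2)] v order_refl) auto
    finally have est: "(\<integral>\<^sup>+p. (ennreal (indicat_real (KS \<tau>) (fst p) * (jf p powr 0 * wt \<tau> p powr (- b0))) * tri \<tau> ?F1 ?F2 ?F3 p)\<^sup>2 \<partial>FM \<tau>)
      \<le> ennreal C2 * (ennreal (N1\<^sup>2) * ennreal (N2\<^sup>2) * ennreal (N3\<^sup>2))" .
    from cubic_estimate[where v=v, OF tau v b0'(2) _ N est] C2(1)
    have "in_bourgain \<tau> 0 (- b) (cubic \<tau> v)" "bourgain_norm \<tau> 0 (- b) (cubic \<tau> v) \<le> sqrt C2 * N1 * N2 * N3"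
      by auto
    moreover have "sqrt C2 * N1 * N2 * N3 \<le> C * N1 * N2 * N3" by (intro mult_right_mono CC N)
    ultimately show ?thesis unfolding N1_def N2_def N3_def by (simp add: mult.assoc)
  qed
  have part3': "in_bourgain \<tau> 0 (- b) (cubic \<tau> v) \<and> bourgain_norm \<tau> 0 (- b) (cubic \<tau> v)
         \<le> C * bourgain_norm \<tau> s b (v (\<pi> 1)) * bourgain_norm \<tau> s b (v (\<pi> 2)) * bourgain_norm \<tau> 0 b (v (\<pi> 3))"
    if tau: "\<tau> > 0" and p: "\<pi> permutes {1, 2, 3::nat}" and v: "in_bourgain \<tau> s b (v (\<pi> 1))"
      "in_bourgain \<tau> s b (v (\<pi> 2))" "in_bourgain \<tau> 0 b (v (\<pi> 3))" for \<tau> \<pi> v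
  proof -
    have "\<pi> i \<in> {1, 2, 3}" if "i \<in> {1, 2, 3}" for i
      using permutes_in_image[OF p, of i] that by simp
    from this[of 1] this[of 2] this[of 3]
    have "\<pi> 1 \<in> {1, 2, 3}" "\<pi> 2 \<in> {1, 2, 3}" "\<pi> 3 \<in> {1, 2, 3}" by simp_all
    moreover have "\<pi> 1 \<noteq> \<pi> 2" "\<pi> 1 \<noteq> \<pi> 3" "\<pi> 2 \<noteq> \<pi> 3"
      using inj_eq[OF permutes_inj[OF p]] by simp_all
    ultimately consider "\<pi> 1 = 1" "\<pi> 2 = 2" "\<pi> 3 = 3" | "\<pi> 1 = 2" "\<pi> 2 = 1" "\<pi> 3 = 3"
      | "\<pi> 1 = 1" "\<pi> 2 = 3" "\<pi> 3 = 2" | "\<pi> 1 = 3" "\<pi> 2 = 1" "\<pi> 3 = 2"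
      | "\<pi> 1 = 2" "\<pi> 2 = 3" "\<pi> 3 = 1" | "\<pi> 1 = 3" "\<pi> 2 = 2" "\<pi> 3 = 1"
      by auto
    then show ?thesis
    proof cases
      case 1 then show ?thesis using part3[of \<tau> s v s 0] tau v by (simp add: mult_ac)
    next
      case 2 then show ?thesis using part3[of \<tau> s v s 0] tau v by (simp add: mult_ac)
    next
      case 3 then show ?thesis using part3[of \<tau> s v 0 s] tau v by (simp add: mult_ac)
    next
      case 4 then show ?thesis using part3[of \<tau> s v 0 s] tau v by (simp add: mult_ac)
    next
      case 5 then show ?thesis using part3[of \<tau> 0 v s s] tau v by (simp add: mult_ac)
    next
      case 6 then show ?thesis using part3[of \<tau> 0 v s s] tau v by (simp add: mult_ac)
    qed
  qed
  show ?thesis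
  proof (intro exI[of _ C] conjI allI impI \<open>C > 0\<close>)
    fix \<tau> :: real and u
    assume "0 < \<tau> \<and> \<tau> \<le> 1" "in_bourgain \<tau> s b1 u"
    then show "in_lpLp 4 (\<lambda>n. Proj \<tau> (u n))" "lpLp_norm \<tau> 4 (\<lambda>n. Proj \<tau> (u n)) \<le> C * bourgain_norm \<tau> s b1 u"
      using part1 by blast+
  next
    fix \<tau> :: real and v :: "nat \<Rightarrow> int \<Rightarrow> plane_fun"
    assume "0 < \<tau> \<and> \<tau> \<le> 1" "\<forall>i\<in>{1, 2, 3}. in_bourgain \<tau> s b (v i)"
    then have "0 < \<tau>" "in_bourgain \<tau> s b (v 1)" "in_bourgain \<tau> s b (v 2)" "in_bourgain \<tau> s b (v 3)" by auto
    note part2[OF this]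
    then show "in_bourgain \<tau> s (- b) (cubic \<tau> v)" "bourgain_norm \<tau> s (- b) (cubic \<tau> v)
        \<le> C * bourgain_norm \<tau> s b (v 1) * bourgain_norm \<tau> s b (v 2) * bourgain_norm \<tau> s b (v 3)" by blast+
  next
    fix \<tau> :: real and \<pi> :: "nat \<Rightarrow> nat" and v :: "nat \<Rightarrow> int \<Rightarrow> plane_fun"
    assume a: "0 < \<tau> \<and> \<tau> \<le> 1" and h: "\<pi> permutes {1, 2, 3} \<and> in_bourgain \<tau> s b (v (\<pi> 1)) \<and>
         in_bourgain \<tau> s b (v (\<pi> 2)) \<and> in_bourgain \<tau> 0 b (v (\<pi> 3))"
    have "0 < \<tau>" "\<pi> permutes {1, 2, 3}" "in_bourgain \<tau> s b (v (\<pi> 1))" "in_bourgain \<tau> s b (v (\<pi> 2))" "in_bourgain \<tau> 0 b (v (\<pi> 3))"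
      using a h by blast+
    note part3'[OF this]
    then show "in_bourgain \<tau> 0 (- b) (cubic \<tau> v)" "bourgain_norm \<tau> 0 (- b) (cubic \<tau> v)
         \<le> C * bourgain_norm \<tau> s b (v (\<pi> 1)) * bourgain_norm \<tau> s b (v (\<pi> 2)) * bourgain_norm \<tau> 0 b (v (\<pi> 3))" by blast+
  qed
qed

end
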